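(* Let $Q\subset\mathbb{P}^2$ be a general smooth quartic curve with bitangent lines $L_1,\ldots,L_{28}$, and fix $r\in\{1,\ldots,28\}$. Then the combinatorics of the curves $$Q+L_{i_1}+\cdots+L_{i_r}$$ is the same for every $r$-element subset $\{i_1,\ldots,i_r\}\subset\{1,\ldots,28\}$. Namely, every $L_{i_k}$ is a true bitangent, i.e. it is tangent to $Q$ at two distinct points, and any three of $L_{i_1},\ldots,L_{i_r}$ are non-concurrent.
   Context: Everything is over $\mathbb{C}$. A bitangent line of a smooth quartic $Q$ is a line all of whose local intersection numbers with $Q$ are even (a line meeting $Q$ at a single point with multiplicity 4 is also counted as a bitangent). "General" means: for $Q$ in some nonempty Zariski-open subset of the space of smooth plane quartics. The combinatorics of a reduced plane curve is the data of its irreducible components with their degrees, its singular points with their topological types, and the assignment of the local branches at each singular point to the irreducible components. *)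

theory Defs
  imports "HOL-Analysis.Analysis" "HOL-Library.Poly_Mapping"
    "HOL-Computational_Algebra.Polynomial_Factorial"
    "HOL-Computational_Algebra.Formal_Power_Series"
begin

section \<open>Polynomials and forms\<close>

text \<open>A polynomial with complex coefficients in variables indexed by \<open>'v\<close>: a finitely supported
  map from exponent vectors to coefficients, with the convolution product of \<open>Poly_Mapping\<close>.\<close>

type_synonym 'v mpoly = "('v \<Rightarrow>\<^sub>0 nat) \<Rightarrow>\<^sub>0 complex"

text \<open>Image of a polynomial under the ring homomorphism that is \<open>h\<close> on constants and sends the
  variable \<open>i\<close> to \<open>x i\<close>.\<close>

definition subst_mpoly :: "(complex \<Rightarrow> 'b::comm_semiring_1) \<Rightarrow> ('v \<Rightarrow> 'b) \<Rightarrow> 'v mpoly \<Rightarrow> 'b" where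
  "subst_mpoly h x F =
     (\<Sum>m\<in>Poly_Mapping.keys F. h (Poly_Mapping.lookup F m) *
        (\<Prod>i\<in>Poly_Mapping.keys m. x i ^ Poly_Mapping.lookup m i))"

definition monom_deg :: "('v \<Rightarrow>\<^sub>0 nat) \<Rightarrow> nat" where
  "monom_deg m = (\<Sum>i\<in>Poly_Mapping.keys m. Poly_Mapping.lookup m i)"

definition homogeneous :: "nat \<Rightarrow> 'v mpoly \<Rightarrow> bool" where
  "homogeneous d F \<longleftrightarrow> (\<forall>m\<in>Poly_Mapping.keys F. monom_deg m = d)"

definition total_degree :: "'v mpoly \<Rightarrow> nat" where
  "total_degree F = Max (insert 0 (monom_deg ` Poly_Mapping.keys F))"

definition forms :: "nat \<Rightarrow> 3 mpoly set" where
  "forms d = {F. F \<noteq> 0 \<and> homogeneous d F}"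

definition form_val :: "3 mpoly \<Rightarrow> complex^3 \<Rightarrow> complex" where
  "form_val F x = subst_mpoly id (\<lambda>i. x $ i) F"

section \<open>The projective plane and plane curves\<close>

text \<open>Points of the complex projective plane are the one-dimensional complex subspaces of
  \<open>complex^3\<close>. A plane curve of degree \<open>d\<close> is given by an element of \<open>forms d\<close>, determined up
  to a nonzero scalar; a line is an element of \<open>forms 1\<close>. The sum of curves is given by the product
  of the forms.\<close>

definition proj_plane :: "(complex^3) set set" where
  "proj_plane = {vec.span {p} | p. p \<noteq> 0}"

definition on_curve :: "(complex^3) set \<Rightarrow> 3 mpoly \<Rightarrow> bool" where
  "on_curve P F \<longleftrightarrow> P \<in> proj_plane \<and> (\<forall>x\<in>P. form_val F x = 0)"

definition singular_points :: "3 mpoly \<Rightarrow> (complex^3) set set" where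
  "singular_points F = {P. on_curve P F \<and>
     (\<forall>x\<in>P - {0}. (form_val F has_derivative (\<lambda>_. 0)) (at x))}"

definition smooth_quartics :: "3 mpoly set" where
  "smooth_quartics = {Q \<in> forms 4. singular_points Q = {}}"

text \<open>The Zariski topology on the projective space of plane quartics: a closed set is the common
  zero locus of homogeneous polynomials in the coefficients \<open>lookup Q m\<close> of the quartic
  \<open>Q\<close>, so the variables of these polynomials are indexed by the exponent vectors \<open>m\<close>.
  Homogeneity makes such sets invariant under scaling of \<open>Q\<close>. (Variables \<open>m\<close> of degree other
  than 4 are harmless: they evaluate to 0 at every quartic.)\<close>

definition zariski_closed :: "3 mpoly set \<Rightarrow> bool" where
  "zariski_closed Z \<longleftrightarrow>
     (\<exists>\<P> :: (3 \<Rightarrow>\<^sub>0 nat) mpoly set. (\<forall>R\<in>\<P>. \<exists>d. homogeneous d R) \<and>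
        Z = {Q \<in> forms 4. \<forall>R\<in>\<P>. subst_mpoly id (Poly_Mapping.lookup Q) R = 0})"

definition zariski_open_smooth_quartics :: "3 mpoly set \<Rightarrow> bool" where
  "zariski_open_smooth_quartics U \<longleftrightarrow> (\<exists>Z. zariski_closed Z \<and> U = smooth_quartics - Z)"

section \<open>Bitangents\<close>

text \<open>Local intersection number at \<open>P\<close> of the curve \<open>F\<close> with a line \<open>l\<close> through
  \<open>P\<close>: the order of vanishing at \<open>t = 0\<close> of \<open>F(p + t v)\<close>, where \<open>p + t v\<close> parametrizes the
  line near \<open>P\<close>; it is infinite if the line is a component of the curve. It does not depend on the
  choice of \<open>p\<close> and \<open>v\<close>.\<close>

definition line_param :: "3 mpoly \<Rightarrow> (complex^3) set \<Rightarrow> (complex^3) \<times> (complex^3)" where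
  "line_param l P = (SOME (p, v). vec.span {p} = P \<and> vec.span {p, v} = {x. form_val l x = 0})"

definition intersection_number :: "3 mpoly \<Rightarrow> 3 mpoly \<Rightarrow> (complex^3) set \<Rightarrow> enat" where
  "intersection_number F l P =
     (let (p, v) = line_param l P;
          f = subst_mpoly (\<lambda>c. [:c:]) (\<lambda>i. [:p $ i, v $ i:]) F
      in if f = 0 then \<infinity> else enat (order 0 f))"

definition bitangent :: "3 mpoly \<Rightarrow> 3 mpoly \<Rightarrow> bool" where
  "bitangent Q l \<longleftrightarrow> l \<in> forms 1 \<and>
     (\<forall>P. on_curve P l \<longrightarrow> (\<exists>k. intersection_number Q l P = enat (2 * k)))"

definition tangent_at :: "3 mpoly \<Rightarrow> 3 mpoly \<Rightarrow> (complex^3) set \<Rightarrow> bool" where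
  "tangent_at Q l P \<longleftrightarrow> on_curve P Q \<and> on_curve P l \<and> intersection_number Q l P \<ge> 2"

definition true_bitangent :: "3 mpoly \<Rightarrow> 3 mpoly \<Rightarrow> bool" where
  "true_bitangent Q l \<longleftrightarrow> bitangent Q l \<and>
     (\<exists>P P'. P \<noteq> P' \<and> tangent_at Q l P \<and> tangent_at Q l P')"

definition concurrent :: "3 mpoly \<Rightarrow> 3 mpoly \<Rightarrow> 3 mpoly \<Rightarrow> bool" where
  "concurrent l l' l'' \<longleftrightarrow> (\<exists>P. on_curve P l \<and> on_curve P l' \<and> on_curve P l'')"

definition assoc_class :: "'a::comm_semiring_1 \<Rightarrow> 'a set" where
  "assoc_class a = {b. a dvd b \<and> b dvd a}"

text \<open>Lines are identified with linear forms up to scalars, that is, up to associatedness.\<close>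

definition enumerates_bitangents :: "3 mpoly \<Rightarrow> (nat \<Rightarrow> 3 mpoly) \<Rightarrow> bool" where
  "enumerates_bitangents Q L \<longleftrightarrow>
     (\<forall>i\<in>{1..28}. bitangent Q (L i)) \<and>
     bij_betw (\<lambda>i. assoc_class (L i)) {1..28} (assoc_class ` {l. bitangent Q l})"

section \<open>Combinatorics of a reduced plane curve\<close>

definition irreducible_factors :: "'a::comm_semiring_1 \<Rightarrow> 'a set set" where
  "irreducible_factors a = {assoc_class g | g. irreducible g \<and> g dvd a}"

text \<open>A basis \<open>(p, u, v)\<close> of \<open>complex^3\<close> with \<open>p\<close> spanning \<open>P\<close> gives the affine
  coordinates \<open>(s, t) \<mapsto> [p + s u + t v]\<close> centred at \<open>P\<close>. One such basis is fixed for each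
  point; another choice changes the coordinates by a projective transformation fixing the origin, so
  the notions below are independent of it.\<close>

definition frame :: "(complex^3) set \<Rightarrow> (complex^3) \<times> (complex^3) \<times> (complex^3)" where
  "frame P = (SOME (p, u, v). vec.span {p} = P \<and> vec.span {p, u, v} = UNIV)"

text \<open>The equation of \<open>F\<close> in these coordinates, as an element of the power series ring
  \<open>\<complex>[[s]][[t]] = \<complex>[[s,t]]\<close>.\<close>

definition local_equation :: "3 mpoly \<Rightarrow> (complex^3) set \<Rightarrow> complex fps fps" where
  "local_equation F P =
     (let (p, u, v) = frame P; c = (\<lambda>a. fps_const (fps_const a))
      in subst_mpoly c
           (\<lambda>i. c (p $ i) + c (u $ i) * fps_const fps_X + c (v $ i) * fps_X) F)"

definition affine_zeros :: "3 mpoly \<Rightarrow> (complex^3) set \<Rightarrow> (complex \<times> complex) set" where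
  "affine_zeros F P =
     (let (p, u, v) = frame P in {(s, t). form_val F (p + s *s u + t *s v) = 0})"

text \<open>The irreducible components are the irreducible factors of the equation, and the local
  branches at \<open>P\<close> are the irreducible factors of the local equation in \<open>\<complex>[[s,t]]\<close>.\<close>

definition components :: "3 mpoly \<Rightarrow> 3 mpoly set set" where
  "components F = irreducible_factors F"

definition branches :: "3 mpoly \<Rightarrow> (complex^3) set \<Rightarrow> complex fps fps set set" where
  "branches F P = irreducible_factors (local_equation F P)"

definition branch_of :: "(complex^3) set \<Rightarrow> complex fps fps set \<Rightarrow> 3 mpoly set \<Rightarrow> bool" where
  "branch_of P b K \<longleftrightarrow> (\<exists>g\<in>b. \<exists>G\<in>K. g dvd local_equation G P)"

text \<open>Two curve germs have the same topological type if some homeomorphism of neighbourhoods in the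
  ambient plane carries one germ to the other.\<close>

definition same_topological_type ::
  "3 mpoly \<Rightarrow> (complex^3) set \<Rightarrow> 3 mpoly \<Rightarrow> (complex^3) set \<Rightarrow> bool" where
  "same_topological_type F P F' P' \<longleftrightarrow>
     (\<exists>V V' h k. open V \<and> 0 \<in> V \<and> open V' \<and> 0 \<in> V' \<and> homeomorphism V V' h k \<and> h 0 = 0 \<and>
        h ` (V \<inter> affine_zeros F P) = V' \<inter> affine_zeros F' P')"

text \<open>Equality of combinatorics: degree-preserving bijection \<open>\<phi>\<close> of components, bijection
  \<open>\<sigma>\<close> of singular points preserving topological types, and at each singular point a bijection
  \<open>\<beta> P\<close> of local branches compatible with the assignment of branches to components.\<close>

definition same_combinatorics :: "3 mpoly \<Rightarrow> 3 mpoly \<Rightarrow> bool" where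
  "same_combinatorics F F' \<longleftrightarrow>
     (\<exists>\<phi> \<sigma> \<beta>.
        bij_betw \<phi> (components F) (components F') \<and>
        (\<forall>K\<in>components F. \<forall>G\<in>K. \<forall>G'\<in>\<phi> K. total_degree G = total_degree G') \<and>
        bij_betw \<sigma> (singular_points F) (singular_points F') \<and>
        (\<forall>P\<in>singular_points F.
           same_topological_type F P F' (\<sigma> P) \<and>
           bij_betw (\<beta> P) (branches F P) (branches F' (\<sigma> P)) \<and>
           (\<forall>b\<in>branches F P. \<forall>K\<in>components F.
              branch_of P b K \<longleftrightarrow> branch_of (\<sigma> P) (\<beta> P b) (\<phi> K))))"

end

theory Submission
  imports Defs "HOL-Computational_Algebra.Fundamental_Theorem_Algebra"
    "HOL-Computational_Algebra.Polynomial_FPS"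
begin

text \<open>The proof splits into a statement about the parameter space of quartics and a statement about one
fixed quartic.

\<^bold>\<open>Genericity.\<close> A plane quartic has 15 coefficients. Suppose that every quartic of a set stable under
scaling is the value of a polynomial map in at most 14 parameters. Then the 15 coefficients, as
polynomials in 14 variables, are algebraically dependent, simply because there are more monomials of
bounded degree in 15 variables than values needed to test the vanishing of a polynomial in 14
variables. A homogeneous part of such a relation is a nonzero form on the parameter space that
vanishes on the set (\<open>negligible_image\<close>). Four kinds of bad quartics are of this type, with 14 or 13
or 12 parameters each:
 \<^item> quartics singular at a point, \<open>Q = y\<^sup>2 A + y z B + z\<^sup>2 C\<close> with \<open>y\<close>, \<open>z\<close> linear forms through the point;
 \<^item> reducible quartics, products of forms of lower degree;
 \<^item> quartics with a line of fourfold contact, \<open>Q = m\<^sup>4 + l C\<close>;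
 \<^item> smooth quartics with three concurrent bitangents. These have the form \<open>Q = q\<^sup>2 + l\<^sub>1 l\<^sub>2 (l\<^sub>1 + l\<^sub>2) m\<close>.

The last point is the only one with a geometric idea. On each line \<open>l\<^sub>i = 0\<close> the quartic restricts to the
square of a binary quadratic form \<open>q\<^sub>i\<close>. At the common point the \<open>q\<^sub>i\<close> agree after a change of signs,
and they do not vanish there, as two tangent lines in different directions would make \<open>Q\<close> singular. So
their derivatives satisfy the same linear relation as the derivatives of \<open>Q\<close>, which is exactly what is
needed to glue them to one conic \<open>q\<close>; then \<open>Q - q\<^sup>2\<close> vanishes on all three lines
(\<open>concurrent_lines_conic\<close>). The product of all these relations is one nonzero form on the parameter
space. It defines the closed set, and every quartic outside it is good; in particular it is smooth, so the
open set of smooth quartics outside it is not empty (\<open>general_quartics_exist\<close>).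

\<^bold>\<open>Combinatorics.\<close> For a good quartic each bitangent touches \<open>Q\<close> at two points with multiplicity exactly 2,
no point of \<open>Q\<close> lies on two bitangents, and no three bitangents meet. So the singular points of
\<open>Q + L\<^sub>i\<^sub>1 + \<dots> + L\<^sub>i\<^sub>r\<close> are one point for each pair of lines and two points for each line, and any bijection
between two sets of \<open>r\<close> lines lifts to a bijection of singular points that respects incidence
(\<open>matching_fibres\<close>). It remains to see that the local structure depends only on the two components
that meet. Locally the curve is a pair of transversal lines or a line tangent to a smooth branch.
For the topological type, the germ is carried to a standard node or tacnode by an explicit map,
which is a homeomorphism by invariance of domain (\<open>tacnode_germ\<close>). For the branches,
the local equation of a component through the point has a nonzero linear part, hence is irreducible in
\<open>\<complex>[[s,t]]\<close>, and that of a line is prime because division by it is detected by restriction to the line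
(\<open>linear_fps_dvd_iff\<close>). As at least one of the two components is a line, this determines all
irreducible factors without unique factorization in \<open>\<complex>[[s,t]]\<close>; the same argument in the polynomial
ring determines the components (\<open>irreducible_divisor_of_product\<close>).\<close>

section \<open>Substitution and evaluation\<close>

abbreviation lookup where "lookup \<equiv> Poly_Mapping.lookup"
abbreviation keys where "keys \<equiv> Poly_Mapping.keys"
abbreviation single where "single \<equiv> Poly_Mapping.single"

definition mon :: "('v \<Rightarrow> 'b::comm_semiring_1) \<Rightarrow> ('v \<Rightarrow>\<^sub>0 nat) \<Rightarrow> 'b" where
  "mon x m = (\<Prod>i\<in>keys m. x i ^ lookup m i)"

lemma mon_superset:
  assumes "finite S" "keys m \<subseteq> S"
  shows "mon x m = (\<Prod>i\<in>S. x i ^ lookup m i)"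
  unfolding mon_def by (rule prod.mono_neutral_left[OF assms]) (auto simp: in_keys_iff)

lemma mon_zero [simp]: "mon x 0 = 1"
  by (simp add: mon_def)

lemma mon_single [simp]: "mon x (single i n) = x i ^ n"
  by (cases "n = 0") (simp_all add: mon_def)

lemma mon_add: "mon x (m + n) = mon x m * mon x n"
proof -
  let ?S = "keys m \<union> keys n"
  have "mon x (m + n) = (\<Prod>i\<in>?S. x i ^ lookup (m + n) i)"
    by (rule mon_superset) (use keys_add[of m n] in auto)
  also have "\<dots> = (\<Prod>i\<in>?S. x i ^ lookup m i) * (\<Prod>i\<in>?S. x i ^ lookup n i)"
    by (simp add: lookup_add power_add prod.distrib)
  also have "\<dots> = mon x m * mon x n"
    by (simp add: mon_superset[of ?S m] mon_superset[of ?S n])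
  finally show ?thesis .
qed

lemma mpoly_sum_single:
  fixes F :: "'v \<Rightarrow>\<^sub>0 'a::comm_monoid_add"
  shows "F = (\<Sum>m\<in>keys F. single m (lookup F m))"
proof (rule poly_mapping_eqI)
  fix k
  have "(\<Sum>m\<in>keys F. lookup (single m (lookup F m)) k) = (\<Sum>m\<in>keys F. if m = k then lookup F m else 0)"
    by (rule sum.cong) (auto simp: lookup_single when_def)
  also have "\<dots> = lookup F k" by (simp add: sum.delta in_keys_iff)
  finally show "lookup F k = lookup (\<Sum>m\<in>keys F. single m (lookup F m)) k"
    by (simp add: lookup_sum)
qed

definition semiring_hom :: "('a::comm_semiring_1 \<Rightarrow> 'b::comm_semiring_1) \<Rightarrow> bool" where
  "semiring_hom h \<longleftrightarrow> h 0 = 0 \<and> h 1 = 1 \<and> (\<forall>a b. h (a + b) = h a + h b) \<and> (\<forall>a b. h (a * b) = h a * h b)"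

lemma semiring_homI:
  assumes "h 0 = 0" "h 1 = 1" "\<And>a b. h (a + b) = h a + h b" "\<And>a b. h (a * b) = h a * h b"
  shows "semiring_hom h"
  using assms by (simp add: semiring_hom_def)

lemma
  assumes "semiring_hom h"
  shows hom_zero: "h 0 = 0" and hom_one: "h 1 = 1" and hom_add: "h (a + b) = h a + h b"
    and hom_mult: "h (a * b) = h a * h b"
  using assms by (auto simp: semiring_hom_def)

lemma hom_sum: "semiring_hom h \<Longrightarrow> h (\<Sum>i\<in>A. f i) = (\<Sum>i\<in>A. h (f i))"
  by (induction A rule: infinite_finite_induct) (auto simp: hom_zero hom_add)

lemma hom_prod: "semiring_hom h \<Longrightarrow> h (\<Prod>i\<in>A. f i) = (\<Prod>i\<in>A. h (f i))"
  by (induction A rule: infinite_finite_induct) (auto simp: hom_one hom_mult)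

lemma hom_power: "semiring_hom h \<Longrightarrow> h (a ^ n) = h a ^ n"
  by (induction n) (auto simp: hom_one hom_mult)

lemma hom_mon: "semiring_hom h \<Longrightarrow> h (mon x m) = mon (\<lambda>i. h (x i)) m"
  by (simp add: mon_def hom_prod hom_power)

lemma hom_minus:
  fixes h :: "'a::comm_ring_1 \<Rightarrow> 'b::comm_ring_1"
  assumes "semiring_hom h" shows "h (a - b) = h a - h b"
  using hom_add[OF assms, of "a - b" b] by (simp add: algebra_simps)

lemma hom_dvd: "semiring_hom h \<Longrightarrow> a dvd b \<Longrightarrow> h a dvd h b"
  by (auto simp: dvd_def hom_mult)

lemma hom_comp: "semiring_hom g \<Longrightarrow> semiring_hom h \<Longrightarrow> semiring_hom (\<lambda>a. g (h a))"
  by (simp add: semiring_hom_def)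

lemma semiring_hom_id: "semiring_hom id"
  by (simp add: semiring_hom_def)

lemma subst_mpoly_mon: "subst_mpoly h x F = (\<Sum>m\<in>keys F. h (lookup F m) * mon x m)"
  by (simp add: subst_mpoly_def mon_def)

lemma subst_mpoly_superset:
  assumes "semiring_hom h" "finite S" "keys F \<subseteq> S"
  shows "subst_mpoly h x F = (\<Sum>m\<in>S. h (lookup F m) * mon x m)"
  unfolding subst_mpoly_mon by (rule sum.mono_neutral_left[OF assms(2,3)])
    (auto simp: in_keys_iff hom_zero[OF assms(1)])

lemma subst_mpoly_single:
  "semiring_hom h \<Longrightarrow> subst_mpoly h x (single m c) = h c * mon x m"
  by (cases "c = 0") (simp_all add: subst_mpoly_mon hom_zero)

lemma subst_mpoly_add:
  assumes "semiring_hom h"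
  shows "subst_mpoly h x (F + G) = subst_mpoly h x F + subst_mpoly h x G"
proof -
  let ?S = "keys F \<union> keys G"
  have "subst_mpoly h x (F + G) = (\<Sum>m\<in>?S. h (lookup (F + G) m) * mon x m)"
    by (rule subst_mpoly_superset[OF assms]) (use keys_add[of F G] in auto)
  also have "\<dots> = (\<Sum>m\<in>?S. h (lookup F m) * mon x m) + (\<Sum>m\<in>?S. h (lookup G m) * mon x m)"
    by (simp add: lookup_add hom_add[OF assms] algebra_simps sum.distrib)
  also have "\<dots> = subst_mpoly h x F + subst_mpoly h x G"
    by (simp add: subst_mpoly_superset[OF assms, of ?S F] subst_mpoly_superset[OF assms, of ?S G])
  finally show ?thesis .
qed

lemma subst_mpoly_0 [simp]: "subst_mpoly h x 0 = 0"
  by (simp add: subst_mpoly_def)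

lemma subst_mpoly_sum:
  "semiring_hom h \<Longrightarrow> subst_mpoly h x (\<Sum>i\<in>A. f i) = (\<Sum>i\<in>A. subst_mpoly h x (f i))"
  by (induction A rule: infinite_finite_induct) (auto simp: subst_mpoly_add)

lemma subst_mpoly_mult:
  assumes h: "semiring_hom h"
  shows "subst_mpoly h x (F * G) = subst_mpoly h x F * subst_mpoly h x G"
proof -
  have "F * G = (\<Sum>m\<in>keys F. \<Sum>n\<in>keys G. single (m + n) (lookup F m * lookup G n))"
    by (subst (1) mpoly_sum_single[of F], subst (1) mpoly_sum_single[of G])
      (simp add: sum_product mult_single)
  then have "subst_mpoly h x (F * G) =
     (\<Sum>m\<in>keys F. \<Sum>n\<in>keys G. (h (lookup F m) * mon x m) * (h (lookup G n) * mon x n))"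
    by (simp add: subst_mpoly_sum[OF h] subst_mpoly_single[OF h] hom_mult[OF h] mon_add mult_ac)
  then show ?thesis by (simp add: subst_mpoly_mon sum_product)
qed

lemma semiring_hom_subst_mpoly: "semiring_hom h \<Longrightarrow> semiring_hom (subst_mpoly h x)"
  using subst_mpoly_single[of h x 0 1]
  by (intro semiring_homI) (auto simp: subst_mpoly_add subst_mpoly_mult hom_one)

definition Cst :: "complex \<Rightarrow> 'v mpoly" where "Cst c = single 0 c"
definition Var :: "'v \<Rightarrow> 'v mpoly" where "Var i = single (single i 1) 1"

lemma semiring_hom_Cst: "semiring_hom Cst"
  by (intro semiring_homI) (simp_all add: Cst_def single_add mult_single)

lemma subst_mpoly_Cst [simp]: "semiring_hom h \<Longrightarrow> subst_mpoly h x (Cst c) = h c"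
  by (simp add: Cst_def subst_mpoly_single)

lemma subst_mpoly_Var [simp]: "semiring_hom h \<Longrightarrow> subst_mpoly h x (Var i) = x i"
  by (simp add: Var_def subst_mpoly_single hom_one)

lemma Var_power: "Var i ^ n = single (single i n) 1"
  by (induction n) (simp_all add: Var_def mult_single single_add[symmetric])

lemma mon_Var: "mon Var m = single m 1"
proof -
  have gen: "(\<Prod>i\<in>S. Var i ^ lookup m i) = single (\<Sum>i\<in>S. single i (lookup m i)) 1" for S
    by (induction S rule: infinite_finite_induct) (auto simp: Var_power mult_single)
  show ?thesis unfolding mon_def gen mpoly_sum_single[symmetric] ..
qed

lemma single_eq_Cst_mon: "single m c = Cst c * mon Var m"
  by (simp add: mon_Var Cst_def mult_single)

text \<open>A polynomial is built from constants and variables by ring operations, so two homomorphisms that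
agree on these agree. All compatibilities between substitutions below are instances.\<close>

lemma mpoly_hom_unique:
  assumes f: "semiring_hom f" and g: "semiring_hom g"
    and "\<And>c. f (Cst c) = g (Cst c)" and "\<And>i. f (Var i) = g (Var i)"
  shows "f F = g F"
proof -
  have "f (single m c) = g (single m c)" for m c
    by (simp add: single_eq_Cst_mon hom_mult[OF f] hom_mult[OF g] hom_mon[OF f] hom_mon[OF g] assms)
  then show ?thesis
    by (subst (1 2) mpoly_sum_single[of F]) (simp add: hom_sum[OF f] hom_sum[OF g])
qed

lemma form_val_hom: "semiring_hom (\<lambda>F. form_val F x)"
  unfolding form_val_def by (rule semiring_hom_subst_mpoly[OF semiring_hom_id])

lemma form_val_0 [simp]: "form_val 0 x = 0"
  and form_val_1 [simp]: "form_val 1 x = 1"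
  and form_val_add [simp]: "form_val (F + G) x = form_val F x + form_val G x"
  and form_val_mult [simp]: "form_val (F * G) x = form_val F x * form_val G x"
  and form_val_diff [simp]: "form_val (F - G) x = form_val F x - form_val G x"
  and form_val_power [simp]: "form_val (F ^ n) x = form_val F x ^ n"
  and form_val_Cst [simp]: "form_val (Cst c) x = c"
  and form_val_Var [simp]: "form_val (Var i) x = x $ i"
  using form_val_hom[of x]
  by (auto simp: hom_zero[OF form_val_hom] hom_one[OF form_val_hom] hom_add[OF form_val_hom]
     hom_mult[OF form_val_hom] hom_minus[OF form_val_hom] hom_power[OF form_val_hom])
   (simp_all add: form_val_def semiring_hom_id)

lemma form_val_sum [simp]: "form_val (\<Sum>i\<in>A. f i) x = (\<Sum>i\<in>A. form_val (f i) x)"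
  by (rule hom_sum[OF form_val_hom])

lemma form_val_prod [simp]: "form_val (\<Prod>i\<in>A. f i) x = (\<Prod>i\<in>A. form_val (f i) x)"
  by (rule hom_prod[OF form_val_hom])

section \<open>Nonzero polynomials have nonzero values\<close>

lemma digits_unique:
  fixes a b :: "nat \<Rightarrow> nat"
  assumes "\<forall>i<n. a i < N \<and> b i < N" "(\<Sum>i<n. a i * N ^ i) = (\<Sum>i<n. b i * N ^ i)" "i < n"
  shows "a i = b i"
  using assms
proof (induction n arbitrary: a b i)
  case (Suc n)
  let ?s = "\<lambda>a. \<Sum>i<n. a (Suc i) * N ^ i"
  have s: "(\<Sum>i<Suc n. c i * N ^ i) = c 0 + N * ?s c" for c :: "nat \<Rightarrow> nat"
    by (simp only: sum.lessThan_Suc_shift) (simp add: sum_distrib_left mult_ac)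
  have eq: "a 0 + N * ?s a = b 0 + N * ?s b" using Suc.prems(2) unfolding s .
  have N: "a 0 < N" "b 0 < N" using Suc.prems(1) by auto
  have 0: "a 0 = b 0" using arg_cong[OF eq, of "\<lambda>x. x mod N"] N by simp
  then have "?s a = ?s b" using eq N by simp
  moreover have "\<forall>i<n. a (Suc i) < N \<and> b (Suc i) < N" using Suc.prems(1) by auto
  ultimately have "\<And>i. i < n \<Longrightarrow> a (Suc i) = b (Suc i)" using Suc.IH[of "\<lambda>i. a (Suc i)" "\<lambda>i. b (Suc i)"] by blast
  then show ?case using 0 Suc.prems(3) by (cases i) auto
qed simp

text \<open>Kronecker substitution: if all exponents are below \<open>N\<close>, then substituting \<open>t ^ N ^ i\<close> for the \<open>i\<close>-th
variable sends different monomials to different powers of \<open>t\<close>, since exponents are recovered as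
digits in base \<open>N\<close>. So a nonzero polynomial becomes a nonzero polynomial in \<open>t\<close>, with finitely many roots.\<close>

lemma mpoly_zero_if_vanishes:
  fixes F :: "'v mpoly"
  assumes "\<And>x. subst_mpoly id x F = 0"
  shows "F = 0"
proof (rule ccontr)
  assume "F \<noteq> 0"
  then obtain m0 where m0: "m0 \<in> keys F"
    by (metis poly_mapping_eqI lookup_zero in_keys_iff)
  define V where "V = (\<Union>m\<in>keys F. keys m)"
  have finV: "finite V" by (simp add: V_def)
  then obtain \<iota> where \<iota>: "bij_betw \<iota> {0..<card V} V" using ex_bij_betw_nat_finite by blast
  define N where "N = Suc (Max ((\<lambda>(m, v). lookup m v) ` (keys F \<times> V)))"
  have N: "lookup m v < N" if "m \<in> keys F" for m v
  proof (cases "v \<in> V")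
    case True
    then show ?thesis unfolding N_def using that finV
      by (intro le_imp_less_Suc Max_ge) auto
  next
    case False
    then have "lookup m v = 0" using that by (auto simp: V_def in_keys_iff)
    then show ?thesis by (simp add: N_def)
  qed
  define e where "e m = (\<Sum>i<card V. lookup m (\<iota> i) * N ^ i)" for m
  define w where "w v = N ^ (the_inv_into {0..<card V} \<iota> v)" for v
  have w: "w (\<iota> i) = N ^ i" if "i < card V" for i
    unfolding w_def using the_inv_into_f_f[of \<iota> "{0..<card V}" i] \<iota> that by (auto simp: bij_betw_def)
  have inj: "m = m0" if "m \<in> keys F" "e m = e m0" for m
  proof (rule poly_mapping_eqI)
    fix v
    show "lookup m v = lookup m0 v"
    proof (cases "v \<in> V")
      case True
      then have "v \<in> \<iota> ` {0..<card V}" using \<iota> by (simp add: bij_betw_def)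
      then obtain i where "i < card V" "v = \<iota> i" by auto
      then show ?thesis
        using digits_unique[of "card V" "\<lambda>i. lookup m (\<iota> i)" N "\<lambda>i. lookup m0 (\<iota> i)" i] that m0 N
        by (auto simp: e_def)
    next
      case False
      then show ?thesis using that(1) m0 by (auto simp: V_def in_keys_iff)
    qed
  qed
  have mon_e: "mon (\<lambda>v. t ^ w v) m = t ^ e m" if "m \<in> keys F" for m and t :: complex
  proof -
    have "mon (\<lambda>v. t ^ w v) m = (\<Prod>v\<in>V. (t ^ w v) ^ lookup m v)"
      by (rule mon_superset[OF finV]) (use that in \<open>auto simp: V_def\<close>)
    also have "\<dots> = (\<Prod>i\<in>{0..<card V}. (t ^ w (\<iota> i)) ^ lookup m (\<iota> i))"
      by (rule prod.reindex_bij_betw[OF \<iota>, symmetric])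
    also have "\<dots> = (\<Prod>i<card V. t ^ (lookup m (\<iota> i) * N ^ i))"
      by (intro prod.cong) (auto simp: w power_mult[symmetric] mult.commute)
    also have "\<dots> = t ^ e m" by (simp add: e_def power_sum)
    finally show ?thesis .
  qed
  define p where "p = (\<Sum>m\<in>keys F. monom (lookup F m) (e m))"
  have "poly p t = subst_mpoly id (\<lambda>v. t ^ w v) F" for t
    by (simp add: p_def poly_sum poly_monom subst_mpoly_mon mon_e)
  then have "poly p t = 0" for t using assms by simp
  then have "p = 0" using poly_all_0_iff_0 by blast
  moreover have "coeff p (e m0) = (\<Sum>m\<in>keys F. if m = m0 then lookup F m else 0)"
    unfolding p_def coeff_sum coeff_monom by (intro sum.cong) (auto dest: inj)
  then have "coeff p (e m0) = lookup F m0" using m0 by simp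
  ultimately show False using m0 by (simp add: in_keys_iff)
qed

lemma form_zero_if_vanishes:
  assumes "\<And>x. form_val F x = 0"
  shows "F = 0"
proof (rule mpoly_zero_if_vanishes)
  fix x :: "3 \<Rightarrow> complex"
  have "form_val F (\<chi> i. x i) = 0" using assms by blast
  then show "subst_mpoly id x F = 0" by (simp add: form_val_def)
qed

lemma form_eqI: "(\<And>x. form_val F x = form_val G x) \<Longrightarrow> F = G"
  using form_zero_if_vanishes[of "F - G"] by simp

section \<open>The grading by degree\<close>

text \<open>The polynomial \<open>F(T X\<^sub>1, T X\<^sub>2, \<dots>)\<close> in the new variable \<open>T\<close>: its coefficients are the homogeneous parts
of \<open>F\<close>. As this is a ring homomorphism into polynomials over a domain, facts about degrees of
products of polynomials in one variable transfer to forms.\<close>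

definition graded :: "'v mpoly \<Rightarrow> 'v mpoly poly" where
  "graded F = subst_mpoly (\<lambda>c. [:Cst c:]) (\<lambda>i. monom (Var i) 1) F"

lemma hom_const_poly: "semiring_hom h \<Longrightarrow> semiring_hom (\<lambda>c. [:h c:])"
  by (intro semiring_homI) (simp_all add: hom_zero hom_one hom_add hom_mult one_pCons mult.commute)

lemma graded_hom: "semiring_hom graded"
  unfolding graded_def by (intro semiring_hom_subst_mpoly hom_const_poly semiring_hom_Cst)

lemma mon_monom: "mon (\<lambda>i. monom (x i) 1) m = monom (mon x m) (monom_deg m)"
proof -
  have "(\<Prod>i\<in>S. monom (x i) 1 ^ lookup m i) = monom (\<Prod>i\<in>S. x i ^ lookup m i) (\<Sum>i\<in>S. lookup m i)" for S
    by (induction S rule: infinite_finite_induct) (auto simp: monom_power mult_monom)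
  then show ?thesis by (simp add: mon_def monom_deg_def)
qed

lemma lookup_coeff_graded:
  "lookup (coeff (graded F) d) m = (if monom_deg m = d then lookup F m else 0)"
proof -
  have "graded F = (\<Sum>n\<in>keys F. monom (single n (lookup F n)) (monom_deg n))"
    by (simp add: graded_def subst_mpoly_mon mon_monom mon_Var smult_monom Cst_def mult_single mon_monom[unfolded One_nat_def])
  then have "lookup (coeff (graded F) d) m =
     (\<Sum>n\<in>keys F. if n = m then (if monom_deg m = d then lookup F m else 0) else 0)"
    by (simp only: coeff_sum lookup_sum, intro sum.cong refl) (auto simp: lookup_single when_def)
  then show ?thesis by (auto simp: in_keys_iff)
qed

lemma homogeneous_iff_graded: "homogeneous d F \<longleftrightarrow> graded F = monom F d"
proof
  assume "homogeneous d F"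
  then show "graded F = monom F d"
    by (intro poly_eqI poly_mapping_eqI)
      (auto simp: lookup_coeff_graded coeff_monom homogeneous_def in_keys_iff)
next
  assume *: "graded F = monom F d"
  show "homogeneous d F" unfolding homogeneous_def
  proof
    fix m assume "m \<in> keys F"
    then have "lookup (coeff (graded F) (monom_deg m)) m \<noteq> 0"
      by (simp add: lookup_coeff_graded in_keys_iff)
    then show "monom_deg m = d" unfolding * by (auto split: if_splits)
  qed
qed

lemma graded_eq_0_iff [simp]: "graded F = 0 \<longleftrightarrow> F = 0"
proof
  assume *: "graded F = 0"
  show "F = 0"
  proof (rule poly_mapping_eqI)
    fix m
    show "lookup F m = lookup 0 m"
      using lookup_coeff_graded[of F "monom_deg m" m] * by simp
  qed
qed (simp add: hom_zero[OF graded_hom])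

lemma total_degree_eq_degree_graded: "total_degree F = degree (graded F)"
proof (rule antisym)
  show "total_degree F \<le> degree (graded F)"
    unfolding total_degree_def
  proof (rule Max.boundedI)
    fix a assume "a \<in> insert 0 (monom_deg ` keys F)"
    then consider "a = 0" | m where "m \<in> keys F" "a = monom_deg m" by auto
    then show "a \<le> degree (graded F)"
    proof cases
      case 2
      then have "lookup (coeff (graded F) a) m \<noteq> 0"
        by (simp add: lookup_coeff_graded in_keys_iff)
      then show ?thesis by (intro le_degree) auto
    qed simp
  qed auto
  show "degree (graded F) \<le> total_degree F"
  proof (rule degree_le, intro allI impI poly_mapping_eqI)
    fix i m assume i: "total_degree F < i"
    have "m \<notin> keys F \<or> monom_deg m \<noteq> i"
    proof (rule ccontr)
      assume "\<not> ?thesis"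
      then have "i \<le> total_degree F" unfolding total_degree_def by (intro Max_ge) auto
      with i show False by simp
    qed
    then show "lookup (coeff (graded F) i) m = lookup 0 m"
      by (auto simp: lookup_coeff_graded in_keys_iff)
  qed
qed

lemma total_degree_mult:
  fixes F G :: "3 mpoly"
  assumes "F \<noteq> 0" "G \<noteq> 0"
  shows "total_degree (F * G) = total_degree F + total_degree G"
  using assms by (simp add: total_degree_eq_degree_graded hom_mult[OF graded_hom] degree_mult_eq)

lemma total_degree_form: "F \<in> forms d \<Longrightarrow> total_degree F = d"
  by (simp add: forms_def homogeneous_iff_graded total_degree_eq_degree_graded degree_monom_eq)

text \<open>The degree and the order of vanishing at 0 are both additive, and they agree for a monomial; so they agree for each factor.\<close>

lemma monomial_factor:
  fixes p q :: "'a::idom poly"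
  assumes "p * q = monom c d" "c \<noteq> 0"
  shows "p = monom (lead_coeff p) (degree p)" "degree p + degree q = d"
proof -
  have nz: "p \<noteq> 0" "q \<noteq> 0" "p * q \<noteq> 0" using assms by auto
  have "degree (monom c d) = d" using assms(2) by (rule degree_monom_eq)
  then show deg: "degree p + degree q = d" using nz assms(1) degree_mult_eq[of p q] by simp
  have "order 0 (p * q) = d" using assms by (simp add: order_0_monom)
  then have "order 0 p + order 0 q = d" using order_mult[OF nz(3)] by simp
  moreover have "order 0 p \<le> degree p" "order 0 q \<le> degree q" using nz by (auto intro: order_degree)
  ultimately have "order 0 p = degree p" using deg by linarith
  then have "monom 1 (degree p) dvd p" using nz by (metis monom_1_dvd_iff order_refl)
  then have "\<forall>k<degree p. coeff p k = 0" by (simp add: monom_1_dvd_iff')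
  then show "p = monom (lead_coeff p) (degree p)"
    by (intro poly_eqI) (metis coeff_eq_0 coeff_monom linorder_neqE_nat)
qed

lemma homogeneous_factors:
  fixes G H :: "3 mpoly"
  assumes "homogeneous d (G * H)" "G * H \<noteq> 0"
  shows "homogeneous (total_degree G) G" "homogeneous (total_degree H) H"
    "total_degree G + total_degree H = d"
proof -
  have mem: "G * H \<in> forms d" using assms by (simp add: forms_def)
  then show "total_degree G + total_degree H = d"
    using total_degree_mult[of G H] assms total_degree_form[OF mem] by auto
  have gen: "homogeneous (total_degree A) A"
    if AB: "homogeneous d (A * B)" "A * B \<noteq> 0" for A B :: "3 mpoly"
  proof -
    have "graded A * graded B = monom (A * B) d"
      using AB(1) by (simp add: homogeneous_iff_graded hom_mult[OF graded_hom])
    from monomial_factor(1)[OF this AB(2)]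
    have eq: "graded A = monom (lead_coeff (graded A)) (total_degree A)"
      by (simp add: total_degree_eq_degree_graded)
    show ?thesis unfolding homogeneous_def
    proof
      fix m assume "m \<in> keys A"
      then have "lookup (coeff (graded A) (monom_deg m)) m \<noteq> 0"
        by (simp add: lookup_coeff_graded in_keys_iff)
      then show "monom_deg m = total_degree A" by (subst (asm) eq) (auto split: if_splits)
    qed
  qed
  show "homogeneous (total_degree G) G" using gen assms by blast
  show "homogeneous (total_degree H) H" using gen[of H G] assms by (simp add: mult.commute)
qed

section \<open>Forms in some of the variables, and division by a linear form\<close>

lemma monom_deg_superset: "finite S \<Longrightarrow> keys m \<subseteq> S \<Longrightarrow> monom_deg m = (\<Sum>i\<in>S. lookup m i)"
  unfolding monom_deg_def by (rule sum.mono_neutral_left) (auto simp: in_keys_iff)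

lemma monom_deg_3: "monom_deg (m :: 3 \<Rightarrow>\<^sub>0 nat) = (\<Sum>i\<in>UNIV. lookup m i)"
  by (rule monom_deg_superset) auto

lemma monom_deg_add [simp]: "monom_deg (m + n) = monom_deg m + monom_deg n"
proof -
  have "monom_deg (m + n) = (\<Sum>i\<in>keys m \<union> keys n. lookup (m + n) i)"
    by (rule monom_deg_superset) (use keys_add[of m n] in auto)
  then show ?thesis
    by (simp add: lookup_add sum.distrib monom_deg_superset[of "keys m \<union> keys n" m]
       monom_deg_superset[of "keys m \<union> keys n" n])
qed

lemma monom_deg_0 [simp]: "monom_deg 0 = 0" by (simp add: monom_deg_def)
lemma monom_deg_single [simp]: "monom_deg (single i n) = n"
  by (cases "n = 0") (simp_all add: monom_deg_def)

lemma monom_deg_eq_0_iff [simp]: "monom_deg m = 0 \<longleftrightarrow> m = 0"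
  by (auto simp: monom_deg_def in_keys_iff intro!: poly_mapping_eqI)

text \<open>The zero polynomial is included for every degree, which makes the forms of a given degree a vector space.\<close>

definition form_in :: "'v set \<Rightarrow> nat \<Rightarrow> 'v mpoly \<Rightarrow> bool" where
  "form_in W d F \<longleftrightarrow> (\<forall>m\<in>keys F. keys m \<subseteq> W \<and> monom_deg m = d)"

lemma homogeneous_form_in: "homogeneous d F \<longleftrightarrow> form_in UNIV d F"
  by (simp add: homogeneous_def form_in_def)

lemma forms_iff: "F \<in> forms d \<longleftrightarrow> F \<noteq> 0 \<and> form_in UNIV d F"
  by (simp add: forms_def homogeneous_form_in)

lemma form_in_0 [simp]: "form_in W d 0" by (simp add: form_in_def)

lemma form_in_add: "form_in W d F \<Longrightarrow> form_in W d G \<Longrightarrow> form_in W d (F + G)"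
  using keys_add[of F G] unfolding form_in_def by blast

lemma form_in_uminus: "form_in W d F \<Longrightarrow> form_in W d (- F)"
  unfolding form_in_def by (simp add: in_keys_iff)

lemma form_in_diff: "form_in W d F \<Longrightarrow> form_in W d G \<Longrightarrow> form_in W d (F - G)"
  using form_in_add[of W d F "- G"] form_in_uminus[of W d G] by simp

lemma form_in_sum: "(\<And>i. i \<in> A \<Longrightarrow> form_in W d (f i)) \<Longrightarrow> form_in W d (\<Sum>i\<in>A. f i)"
  by (induction A rule: infinite_finite_induct) (auto intro: form_in_add)

lemma form_in_mult: "form_in W d F \<Longrightarrow> form_in W e G \<Longrightarrow> form_in W (d + e) (F * G)"
  unfolding form_in_def
proof
  fix m assume FG: "\<forall>m\<in>keys F. keys m \<subseteq> W \<and> monom_deg m = d" "\<forall>m\<in>keys G. keys m \<subseteq> W \<and> monom_deg m = e"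
    and "m \<in> keys (F * G)"
  then obtain a b where "a \<in> keys F" "b \<in> keys G" "m = a + b" using keys_mult[of F G] by blast
  then show "keys m \<subseteq> W \<and> monom_deg m = d + e" using FG keys_add[of a b] by (simp, blast)
qed

lemma form_in_single: "keys m \<subseteq> W \<Longrightarrow> monom_deg m = d \<Longrightarrow> form_in W d (single m c)"
  by (auto simp: form_in_def split: if_splits)

lemma form_in_Cst [simp]: "form_in W 0 (Cst c)"
  unfolding Cst_def by (rule form_in_single) auto

lemma form_in_Var: "i \<in> W \<Longrightarrow> form_in W 1 (Var i)"
  unfolding Var_def by (rule form_in_single) auto

lemma form_in_one [simp]: "form_in W 0 1"
  by (simp add: form_in_def)

lemma form_in_power: "form_in W d F \<Longrightarrow> form_in W (n * d) (F ^ n)"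
  by (induction n) (auto intro: form_in_mult)

lemma form_in_smult: "form_in W d F \<Longrightarrow> form_in W d (Cst c * F)"
  using form_in_mult[OF form_in_Cst] by fastforce

lemma form_in_prod: "(\<And>i. i \<in> A \<Longrightarrow> form_in W (d i) (f i)) \<Longrightarrow> form_in W (\<Sum>i\<in>A. d i) (\<Prod>i\<in>A. f i)"
  by (induction A rule: infinite_finite_induct) (auto intro: form_in_mult)

lemma form_in_mono: "form_in W d F \<Longrightarrow> W \<subseteq> W' \<Longrightarrow> form_in W' d F"
  by (auto simp: form_in_def)

lemma form_in_sum_single:
  assumes "form_in W d F" "finite S" "{m. keys m \<subseteq> W \<and> monom_deg m = d} \<subseteq> S"
  shows "F = (\<Sum>m\<in>S. single m (lookup F m))"
proof -
  have "(\<Sum>m\<in>keys F. single m (lookup F m)) = (\<Sum>m\<in>S. single m (lookup F m))"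
    by (rule sum.mono_neutral_left) (use assms in \<open>auto simp: form_in_def in_keys_iff\<close>)
  then show ?thesis using mpoly_sum_single[of F] by simp
qed

lemma form_val_cong:
  assumes "form_in W d F" "\<And>i. i \<in> W \<Longrightarrow> x $ i = y $ i"
  shows "form_val F x = form_val F y"
  unfolding form_val_def subst_mpoly_mon mon_def
  using assms by (intro sum.cong prod.cong arg_cong2[where f = "(*)"] arg_cong2[where f = "(^)"] refl)
    (auto simp: form_in_def)

lemma form_val_scale:
  assumes "form_in W d F"
  shows "form_val F (c *s x) = c ^ d * form_val F x"
proof -
  have "mon (\<lambda>i. (c *s x) $ i) m = c ^ monom_deg m * mon (\<lambda>i. x $ i) m" for m
    by (simp add: mon_def monom_deg_def power_mult_distrib prod.distrib power_sum)
  then show ?thesis using assms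
    by (simp add: form_val_def subst_mpoly_mon sum_distrib_left form_in_def mult_ac cong: sum.cong)
qed

text \<open>Replacing \<open>X\<^sub>j\<close> by the linear form \<open>r\<close> in the other variables changes a polynomial by a multiple of
\<open>X\<^sub>j - r\<close>. It suffices to check this for monomials, where it is the factorization of a difference of
powers. For degree 0 the quotient is 0, so the truncated subtraction does no harm.\<close>

lemma form_division:
  assumes F: "form_in W d F" and j: "j \<in> W" and r: "form_in (W - {j}) 1 r"
  shows "\<exists>F0 G. form_in (W - {j}) d F0 \<and> form_in W (d - 1) G \<and> F = F0 + (Var j - r) * G"
proof -
  have single: "\<exists>F0 G. form_in (W - {j}) d F0 \<and> form_in W (d - 1) G \<and> single m c = F0 + (Var j - r) * G"
    if m: "keys m \<subseteq> W" "monom_deg m = d" for m c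
  proof -
    define e where "e = lookup m j"
    define m' where "m' = m - single j e"
    have lm': "lookup m' i = (if i = j then 0 else lookup m i)" for i
      by (auto simp: m'_def e_def lookup_minus lookup_single when_def)
    have mm: "m = m' + single j e"
      by (rule poly_mapping_eqI) (auto simp: lookup_add lm' lookup_single when_def e_def)
    have km': "keys m' \<subseteq> W - {j}" using m(1) by (auto simp: in_keys_iff lm' split: if_splits)
    have d: "d = monom_deg m' + e" using m(2) mm by (metis monom_deg_add monom_deg_single)
    define F0 where "F0 = single m' c * r ^ e"
    define G where "G = single m' c * (\<Sum>i<e. r ^ (e - Suc i) * Var j ^ i)"
    have "single m c = single m' c * Var j ^ e"
      by (simp add: Var_power mult_single mm)
    also have "\<dots> = F0 + single m' c * (Var j ^ e - r ^ e)" by (simp add: F0_def algebra_simps)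
    also have "Var j ^ e - r ^ e = (Var j - r) * (\<Sum>i<e. r ^ (e - Suc i) * Var j ^ i)"
      by (rule power_diff_sumr2)
    finally have eq: "single m c = F0 + (Var j - r) * G" by (simp add: G_def mult_ac)
    have "form_in (W - {j}) d F0" unfolding F0_def d
      by (intro form_in_mult form_in_single km') (use form_in_power[OF r, of e] in auto)
    moreover have "form_in W (d - 1) G"
    proof (cases "e = 0")
      case False
      have r': "form_in W 1 r" using r by (rule form_in_mono) auto
      have "form_in W (e - 1) (r ^ (e - Suc i) * Var j ^ i)" if "i < e" for i
        using form_in_mult[OF form_in_power[OF r', of "e - Suc i"] form_in_power[OF form_in_Var[OF j], of i]] that
        by simp
      then have "form_in W (e - 1) (\<Sum>i<e. r ^ (e - Suc i) * Var j ^ i)"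
        by (intro form_in_sum) auto
      moreover have "form_in W (monom_deg m') (single m' c)" using km' by (intro form_in_single) auto
      ultimately have "form_in W (monom_deg m' + (e - 1)) G" unfolding G_def by (intro form_in_mult)
      then show ?thesis using False d by simp
    qed (simp add: G_def)
    ultimately show ?thesis using eq by blast
  qed
  have "\<forall>m\<in>keys F. \<exists>F0 G. form_in (W - {j}) d F0 \<and> form_in W (d - 1) G \<and> single m (lookup F m) = F0 + (Var j - r) * G"
    using single F by (auto simp: form_in_def)
  then obtain f g where fg: "\<And>m. m \<in> keys F \<Longrightarrow> form_in (W - {j}) d (f m) \<and> form_in W (d - 1) (g m)
      \<and> single m (lookup F m) = f m + (Var j - r) * g m"
    by metis
  have "F = (\<Sum>m\<in>keys F. f m + (Var j - r) * g m)"
    by (subst mpoly_sum_single[of F]) (use fg in \<open>auto intro!: sum.cong\<close>)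
  then have "F = (\<Sum>m\<in>keys F. f m) + (Var j - r) * (\<Sum>m\<in>keys F. g m)"
    by (simp add: sum.distrib sum_distrib_left)
  moreover have "form_in (W - {j}) d (\<Sum>m\<in>keys F. f m)" "form_in W (d - 1) (\<Sum>m\<in>keys F. g m)"
    using fg by (auto intro: form_in_sum)
  ultimately show ?thesis by blast
qed

section \<open>Sets of quartics that depend on at most fourteen parameters\<close>

text \<open>A homogeneous linear system with more unknowns than equations has a nontrivial solution: one equation eliminates one unknown.\<close>

lemma linear_dependence:
  fixes a :: "'m \<Rightarrow> 'g \<Rightarrow> complex"
  assumes "finite G" "finite M" "card G < card M"
  shows "\<exists>c. (\<exists>m\<in>M. c m \<noteq> 0) \<and> (\<forall>g\<in>G. (\<Sum>m\<in>M. c m * a m g) = 0)"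
  using assms
proof (induction G arbitrary: M a rule: finite_induct)
  case empty
  then obtain m where "m \<in> M" by fastforce
  then show ?case by (intro exI[of _ "\<lambda>_. 1"]) auto
next
  case (insert g G)
  show ?case
  proof (cases "\<forall>m\<in>M. a m g = 0")
    case True
    have "card G < card M" using insert.prems insert.hyps by simp
    from insert.IH[OF insert.prems(1) this, of a] obtain c
      where "\<exists>m\<in>M. c m \<noteq> 0" "\<forall>g\<in>G. (\<Sum>m\<in>M. c m * a m g) = 0" by blast
    then show ?thesis using True by (intro exI[of _ c]) auto
  next
    case False
    then obtain m0 where m0: "m0 \<in> M" "a m0 g \<noteq> 0" by blast
    define M' where "M' = M - {m0}"
    define a' where "a' m h = a m h - a m g / a m0 g * a m0 h" for m h
    have M': "finite M'" "card G < card M'" using insert.prems insert.hyps m0 by (auto simp: M'_def)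
    from insert.IH[OF M', of a'] obtain c
      where c: "\<exists>m\<in>M'. c m \<noteq> 0" "\<forall>h\<in>G. (\<Sum>m\<in>M'. c m * a' m h) = 0" by blast
    define c' where "c' m = (if m = m0 then - (\<Sum>m\<in>M'. c m * a m g) / a m0 g else c m)" for m
    have "(\<Sum>m\<in>M. c' m * a m h) = (\<Sum>m\<in>M'. c m * a' m h)" for h
    proof -
      have "(\<Sum>m\<in>M. c' m * a m h) = c' m0 * a m0 h + (\<Sum>m\<in>M'. c' m * a m h)"
        unfolding M'_def by (rule sum.remove[OF insert.prems(1) m0(1)])
      also have "(\<Sum>m\<in>M'. c' m * a m h) = (\<Sum>m\<in>M'. c m * a m h)"
        by (intro sum.cong) (auto simp: c'_def M'_def)
      also have "c' m0 * a m0 h = - (\<Sum>m\<in>M'. c m * (a m g / a m0 g * a m0 h))"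
        by (simp add: c'_def sum_distrib_right sum_divide_distrib mult.assoc)
      finally show ?thesis by (simp add: a'_def right_diff_distrib sum_subtractf)
    qed
    moreover have "a' m g = 0" for m using m0 by (simp add: a'_def)
    moreover have "\<exists>m\<in>M. c' m \<noteq> 0" using c(1) by (auto simp: c'_def M'_def)
    ultimately show ?thesis using c(2) by (intro exI[of _ c']) auto
  qed
qed

text \<open>Being a polynomial of bounded degree in each variable separately, when the others are frozen, is all
that the test for vanishing on a grid needs; no polynomial ring in the parameters is involved.\<close>

definition sep_poly :: "'i set \<Rightarrow> nat \<Rightarrow> (('i \<Rightarrow> complex) \<Rightarrow> complex) \<Rightarrow> bool" where
  "sep_poly A N f \<longleftrightarrow> (\<forall>x. \<forall>i\<in>A. \<exists>p. degree p \<le> N \<and> (\<forall>t. f (x(i := t)) = poly p t))"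

lemma sep_poly_const: "sep_poly A N (\<lambda>_. c)"
  unfolding sep_poly_def by (intro allI ballI exI[of _ "[:c:]"]) auto

lemma sep_poly_mono: "sep_poly A N f \<Longrightarrow> N \<le> N' \<Longrightarrow> sep_poly A N' f"
  unfolding sep_poly_def using le_trans by blast

lemma sep_poly_var: "sep_poly A 1 (\<lambda>x. x j)"
  unfolding sep_poly_def
proof (intro allI ballI)
  fix x :: "'a \<Rightarrow> complex" and i
  show "\<exists>p. degree p \<le> 1 \<and> (\<forall>t. (x(i := t)) j = poly p t)"
    by (cases "i = j") (auto intro: exI[of _ "[:0, 1:]"] exI[of _ "[:x j:]"])
qed

lemma sep_poly_add:
  assumes "sep_poly A N f" "sep_poly A N g" shows "sep_poly A N (\<lambda>x. f x + g x)"
  unfolding sep_poly_def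
proof (intro allI ballI)
  fix x :: "'a \<Rightarrow> complex" and i assume "i \<in> A"
  with assms obtain p q where "degree p \<le> N" "\<forall>t. f (x(i := t)) = poly p t"
    "degree q \<le> N" "\<forall>t. g (x(i := t)) = poly q t" unfolding sep_poly_def by metis
  then show "\<exists>p. degree p \<le> N \<and> (\<forall>t. f (x(i := t)) + g (x(i := t)) = poly p t)"
    by (intro exI[of _ "p + q"]) (auto intro: degree_add_le)
qed

lemma sep_poly_mult:
  assumes "sep_poly A M f" "sep_poly A N g" shows "sep_poly A (M + N) (\<lambda>x. f x * g x)"
  unfolding sep_poly_def
proof (intro allI ballI)
  fix x :: "'a \<Rightarrow> complex" and i assume "i \<in> A"
  with assms obtain p q where "degree p \<le> M" "\<forall>t. f (x(i := t)) = poly p t"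
    "degree q \<le> N" "\<forall>t. g (x(i := t)) = poly q t" unfolding sep_poly_def by metis
  then show "\<exists>p. degree p \<le> M + N \<and> (\<forall>t. f (x(i := t)) * g (x(i := t)) = poly p t)"
    by (intro exI[of _ "p * q"]) (auto intro: order_trans[OF degree_mult_le])
qed

lemma sep_poly_sum: "(\<And>k. k \<in> K \<Longrightarrow> sep_poly A N (f k)) \<Longrightarrow> sep_poly A N (\<lambda>x. \<Sum>k\<in>K. f k x)"
  by (induction K rule: infinite_finite_induct) (auto intro: sep_poly_const sep_poly_add)

lemma sep_poly_power: "sep_poly A N f \<Longrightarrow> sep_poly A (n * N) (\<lambda>x. f x ^ n)"
  by (induction n) (auto intro: sep_poly_const sep_poly_mult)

lemma sep_poly_prod: "(\<And>k. k \<in> K \<Longrightarrow> sep_poly A N (f k)) \<Longrightarrow> sep_poly A (card K * N) (\<lambda>x. \<Prod>k\<in>K. f k x)"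
  by (induction K rule: infinite_finite_induct) (auto intro: sep_poly_const sep_poly_mult)

text \<open>The coordinates are freed one at a time: along each of them the function is a polynomial of degree at
most \<open>N\<close> with more than \<open>N\<close> zeros.\<close>

lemma sep_poly_vanishes:
  assumes "finite A" "sep_poly A N f" "finite S" "N < card S"
    and grid: "\<And>x. (\<And>i. i \<in> A \<Longrightarrow> x i \<in> S) \<Longrightarrow> (\<And>i. i \<notin> A \<Longrightarrow> x i = 0) \<Longrightarrow> f x = 0"
    and x: "\<And>i. i \<notin> A \<Longrightarrow> x i = 0"
  shows "f x = 0"
proof -
  have "\<forall>x. (\<forall>i\<in>A - B. x i \<in> S) \<and> (\<forall>i. i \<notin> A \<longrightarrow> x i = 0) \<longrightarrow> f x = 0" if "finite B" "B \<subseteq> A" for B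
    using that
  proof (induction B rule: finite_induct)
    case empty
    then show ?case using grid by auto
  next
    case (insert j B)
    show ?case
    proof (intro allI impI)
      fix x assume x: "(\<forall>i\<in>A - insert j B. x i \<in> S) \<and> (\<forall>i. i \<notin> A \<longrightarrow> x i = 0)"
      obtain p where p: "degree p \<le> N" "\<forall>t. f (x(j := t)) = poly p t"
        using assms(2) insert.prems unfolding sep_poly_def by blast
      have "poly p t = 0" if "t \<in> S" for t
        using insert.IH insert.prems x that p(2)[rule_format, of t, symmetric] by auto
      then have "S \<subseteq> {t. poly p t = 0}" by blast
      then have "card S \<le> N" if "p \<noteq> 0"
        using card_poly_roots_bound[OF that] p(1) card_mono[OF poly_roots_finite[OF that], of S] by linarith
      then have "p = 0" using assms(4) by linarith
      then show "f x = 0" using p(2)[rule_format, of "x j"] by simp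
    qed
  qed
  from this[of A] show ?thesis using assms(1) x by auto
qed

lemma finite_bounded_exponents: "finite {m :: 3 \<Rightarrow>\<^sub>0 nat. \<forall>i. lookup m i \<le> n}" (is "finite ?S")
proof (rule finite_imageD)
  have "finite ((UNIV :: 3 set) \<rightarrow>\<^sub>E {..n})" by (intro finite_PiE) auto
  moreover have "lookup ` ?S \<subseteq> (UNIV :: 3 set) \<rightarrow>\<^sub>E {..n}"
    by (rule image_subsetI) (simp add: PiE_iff)
  ultimately show "finite (lookup ` ?S)" by (rule finite_subset[rotated])
  show "inj_on lookup ?S" by (rule inj_onI) (metis poly_mapping_eq_iff)
qed

lemma finite_splits: "finite {(a, b). a + b = (k :: 3 \<Rightarrow>\<^sub>0 nat)}"
proof -
  define n where "n = Max (range (lookup k))"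
  have k: "lookup k i \<le> n" for i unfolding n_def by (rule Max_ge) auto
  let ?S = "{m :: 3 \<Rightarrow>\<^sub>0 nat. \<forall>i. lookup m i \<le> n}"
  have "{(a, b). a + b = k} \<subseteq> ?S \<times> ?S"
  proof safe
    fix a b i assume "k = a + b"
    then have "lookup a i + lookup b i \<le> n" using k[of i] by (simp add: lookup_add)
    then show "lookup a i \<le> n" "lookup b i \<le> n" by simp_all
  qed
  then show ?thesis by (rule finite_subset) (simp add: finite_bounded_exponents)
qed

lemma lookup_mult_splits:
  fixes F G :: "3 mpoly"
  shows "lookup (F * G) k = (\<Sum>(a, b)\<in>{(a, b). a + b = k}. lookup F a * lookup G b)"
proof -
  have "F * G = (\<Sum>m\<in>keys F. \<Sum>n\<in>keys G. single (m + n) (lookup F m * lookup G n))"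
    by (subst (1) mpoly_sum_single[of F], subst (1) mpoly_sum_single[of G])
      (simp add: sum_product mult_single)
  then have "lookup (F * G) k = (\<Sum>m\<in>keys F. \<Sum>n\<in>keys G. if m + n = k then lookup F m * lookup G n else 0)"
    by (simp add: lookup_sum lookup_single when_def)
  also have "\<dots> = (\<Sum>(m, n)\<in>keys F \<times> keys G. if m + n = k then lookup F m * lookup G n else 0)"
    by (simp add: sum.cartesian_product)
  also have "\<dots> = (\<Sum>(m, n)\<in>(keys F \<times> keys G) \<inter> {(a, b). a + b = k}. lookup F m * lookup G n)"
    by (rule sum.mono_neutral_cong_right) (auto split: if_splits)
  also have "\<dots> = (\<Sum>(a, b)\<in>{(a, b). a + b = k}. lookup F a * lookup G b)"
    by (rule sum.mono_neutral_left[OF finite_splits]) (auto simp: in_keys_iff)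
  finally show ?thesis .
qed

definition poly_family :: "'i set \<Rightarrow> (('i \<Rightarrow> complex) \<Rightarrow> 3 mpoly) \<Rightarrow> bool" where
  "poly_family A \<Phi> \<longleftrightarrow> (\<exists>D. \<forall>k. sep_poly A D (\<lambda>x. lookup (\<Phi> x) k))"

lemma poly_family_const: "poly_family A (\<lambda>_. F)"
  unfolding poly_family_def using sep_poly_const by blast

lemma poly_family_single: "poly_family A (\<lambda>x. single m (x i))"
proof -
  have "sep_poly A 1 (\<lambda>x. lookup (single m (x i)) k)" for k
    by (cases "m = k") (auto simp: lookup_single when_def intro: sep_poly_const sep_poly_var[unfolded One_nat_def])
  then show ?thesis unfolding poly_family_def by blast
qed

lemma poly_family_add:
  assumes "poly_family A \<Phi>" "poly_family A \<Psi>"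
  shows "poly_family A (\<lambda>x. \<Phi> x + \<Psi> x)"
proof -
  obtain D E where "\<forall>k. sep_poly A D (\<lambda>x. lookup (\<Phi> x) k)" "\<forall>k. sep_poly A E (\<lambda>x. lookup (\<Psi> x) k)"
    using assms unfolding poly_family_def by blast
  then have "sep_poly A (max D E) (\<lambda>x. lookup (\<Phi> x) k)" "sep_poly A (max D E) (\<lambda>x. lookup (\<Psi> x) k)" for k
    by (auto intro: sep_poly_mono[OF _ max.cobounded1] sep_poly_mono[OF _ max.cobounded2])
  then have "\<forall>k. sep_poly A (max D E) (\<lambda>x. lookup (\<Phi> x + \<Psi> x) k)"
    by (simp add: lookup_add sep_poly_add)
  then show ?thesis unfolding poly_family_def by blast
qed

lemma poly_family_sum: "(\<And>k. k \<in> K \<Longrightarrow> poly_family A (\<Phi> k)) \<Longrightarrow> poly_family A (\<lambda>x. \<Sum>k\<in>K. \<Phi> k x)"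
  by (induction K rule: infinite_finite_induct) (auto intro: poly_family_const poly_family_add)

lemma poly_family_mult:
  assumes "poly_family A \<Phi>" "poly_family A \<Psi>"
  shows "poly_family A (\<lambda>x. \<Phi> x * \<Psi> x)"
proof -
  obtain D E where "\<forall>k. sep_poly A D (\<lambda>x. lookup (\<Phi> x) k)" "\<forall>k. sep_poly A E (\<lambda>x. lookup (\<Psi> x) k)"
    using assms unfolding poly_family_def by blast
  then have "\<forall>k. sep_poly A (D + E) (\<lambda>x. lookup (\<Phi> x * \<Psi> x) k)"
    unfolding lookup_mult_splits case_prod_beta by (intro allI sep_poly_sum sep_poly_mult) auto
  then show ?thesis unfolding poly_family_def by blast
qed

lemma poly_family_diff:
  assumes "poly_family A \<Phi>" "poly_family A \<Psi>"
  shows "poly_family A (\<lambda>x. \<Phi> x - \<Psi> x)"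
  using poly_family_add[OF assms(1) poly_family_mult[OF poly_family_const[of A "-1"] assms(2)]] by simp

lemma poly_family_power: "poly_family A \<Phi> \<Longrightarrow> poly_family A (\<lambda>x. \<Phi> x ^ n)"
  by (induction n) (auto intro: poly_family_const poly_family_mult)

definition exps :: "3 set \<Rightarrow> nat \<Rightarrow> (3 \<Rightarrow>\<^sub>0 nat) set" where
  "exps W d = {m. keys m \<subseteq> W \<and> monom_deg m = d}"

lemma finite_exps [simp]: "finite (exps W d)"
proof (rule finite_subset[OF _ finite_bounded_exponents[of d]])
  show "exps W d \<subseteq> {m. \<forall>i. lookup m i \<le> d}"
    unfolding exps_def monom_deg_3
    by (auto intro: order_trans[OF member_le_sum[of _ UNIV]])
qed

lemma card_exps_UNIV: "card (exps UNIV d) = (\<Sum>a\<le>d. Suc (d - a))"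
proof -
  define S where "S = (SIGMA a:{..d}. {..d - a})"
  define g :: "nat \<times> nat \<Rightarrow> 3 \<Rightarrow>\<^sub>0 nat" where
    "g = (\<lambda>(a, b). single 1 a + single 2 b + single 3 (d - a - b))"
  have lg: "lookup (g (a, b)) 1 = a" "lookup (g (a, b)) 2 = b" "lookup (g (a, b)) 3 = d - a - b" for a b
    by (simp_all add: g_def lookup_add lookup_single when_def)
  have "bij_betw g S (exps UNIV d)"
  proof (rule bij_betwI')
    fix x y assume "x \<in> S" "y \<in> S"
    show "(g x = g y) = (x = y)" using lg by (metis prod.collapse)
  next
    fix x assume "x \<in> S"
    then show "g x \<in> exps UNIV d"
      by (cases x) (auto simp: S_def exps_def monom_deg_3 sum_3 lg)
  next
    fix m assume "m \<in> exps UNIV d"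
    then have d: "lookup m 1 + lookup m 2 + lookup m 3 = d" by (simp add: exps_def monom_deg_3 sum_3)
    have "m = g (lookup m 1, lookup m 2)"
    proof (rule poly_mapping_eqI)
      fix i
      show "lookup m i = lookup (g (lookup m 1, lookup m 2)) i"
        using exhaust_3[of i] d by (auto simp: lg)
    qed
    moreover have "(lookup m 1, lookup m 2) \<in> S" using d by (auto simp: S_def)
    ultimately show "\<exists>x\<in>S. m = g x" by blast
  qed
  then have "card (exps UNIV d) = card S" by (simp add: bij_betw_same_card)
  also have "\<dots> = (\<Sum>a\<le>d. Suc (d - a))" by (simp add: S_def)
  finally show ?thesis .
qed

lemma card_exps:
  "card (exps UNIV 1) = 3" "card (exps UNIV 2) = 6" "card (exps UNIV 3) = 10" "card (exps UNIV 4) = 15"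
  by (simp_all add: card_exps_UNIV eval_nat_numeral)

lemma card_exps_2: "card (exps {j, k} d) \<le> Suc d"
proof (cases "j = k")
  case False
  have "exps {j, k} d \<subseteq> (\<lambda>a. single j a + single k (d - a)) ` {..d}"
  proof
    fix m assume m: "m \<in> exps {j, k} d"
    then have d: "lookup m j + lookup m k = d" "keys m \<subseteq> {j, k}"
      using monom_deg_superset[of "{j, k}" m] False by (auto simp: exps_def)
    have "m = single j (lookup m j) + single k (d - lookup m j)"
    proof (rule poly_mapping_eqI)
      fix i
      show "lookup m i = lookup (single j (lookup m j) + single k (d - lookup m j)) i"
        using d False by (cases "i = j"; cases "i = k") (auto simp: lookup_add lookup_single when_def in_keys_iff)
    qed
    then show "m \<in> (\<lambda>a. single j a + single k (d - a)) ` {..d}" using d by auto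
  qed
  then show ?thesis by (metis card_atMost card_image_le card_mono finite_atMost finite_imageI le_trans)
next
  case True
  have "exps {j, k} d \<subseteq> {single j d}"
  proof
    fix m assume m: "m \<in> exps {j, k} d"
    then have d: "lookup m j = d" "keys m \<subseteq> {j}"
      using monom_deg_superset[of "{j}" m] True by (auto simp: exps_def)
    then have "m = single j d" by (intro poly_mapping_eqI) (auto simp: lookup_single when_def in_keys_iff)
    then show "m \<in> {single j d}" by simp
  qed
  then have "card (exps {j, k} d) \<le> card {single j d}" by (intro card_mono) auto
  then show ?thesis by simp
qed

text \<open>The sets on which some nonzero homogeneous polynomial in the 15 coefficients of quartics vanishes,
that is, the sets contained in a hypersurface of the parameter space. Finite unions of such sets are of
this kind, because the polynomial ring is a domain.\<close>

definition negligible :: "3 mpoly set \<Rightarrow> bool" where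
  "negligible S \<longleftrightarrow> (\<exists>R d. R \<noteq> 0 \<and> form_in (exps UNIV 4) d R \<and> (\<forall>Q\<in>S. subst_mpoly id (lookup Q) R = 0))"

lemma negligible_empty [simp]: "negligible {}"
  unfolding negligible_def by (intro exI[of _ 1] exI[of _ 0]) simp

lemma negligible_Un:
  assumes "negligible S" "negligible T" shows "negligible (S \<union> T)"
proof -
  obtain R1 d1 R2 d2 where "R1 \<noteq> 0" "form_in (exps UNIV 4) d1 R1" "\<forall>Q\<in>S. subst_mpoly id (lookup Q) R1 = 0"
     "R2 \<noteq> 0" "form_in (exps UNIV 4) d2 R2" "\<forall>Q\<in>T. subst_mpoly id (lookup Q) R2 = 0"
    using assms unfolding negligible_def by metis
  then show ?thesis unfolding negligible_def
    by (intro exI[of _ "R1 * R2"] exI[of _ "d1 + d2"])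
      (auto simp: form_in_mult subst_mpoly_mult[OF semiring_hom_id])
qed

lemma negligible_UN: "finite I \<Longrightarrow> (\<And>i. i \<in> I \<Longrightarrow> negligible (S i)) \<Longrightarrow> negligible (\<Union>i\<in>I. S i)"
  by (induction I rule: finite_induct) (auto intro: negligible_Un)

lemma lookup_Cst_mult: "lookup (Cst t * Q) m = t * lookup Q m"
  unfolding Cst_def mult_map_scale_conv_mult[symmetric] by (simp add: Poly_Mapping.map.rep_eq when_def)

text \<open>A relation that holds at all multiples \<open>t Q\<close> is a polynomial in \<open>t\<close> that vanishes identically, and its coefficients are the values at \<open>Q\<close> of the homogeneous parts.\<close>

lemma homogeneous_part_vanishes:
  fixes R :: "(3 \<Rightarrow>\<^sub>0 nat) mpoly"
  assumes "\<And>t. t \<noteq> 0 \<Longrightarrow> subst_mpoly id (lookup (Cst t * Q)) R = 0"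
  shows "subst_mpoly id (lookup Q) (coeff (graded R) d) = 0"
proof -
  define q where "q = (\<Sum>m\<in>keys R. monom (lookup R m * mon (lookup Q) m) (monom_deg m))"
  have "mon (lookup (Cst t * Q)) m = t ^ monom_deg m * mon (lookup Q) m" for t m
    by (simp add: mon_def monom_deg_def lookup_Cst_mult power_mult_distrib prod.distrib power_sum)
  then have "poly q t = subst_mpoly id (lookup (Cst t * Q)) R" for t
    by (simp add: q_def subst_mpoly_mon poly_sum poly_monom mult_ac)
  then have "UNIV - {0} \<subseteq> {t. poly q t = 0}" using assms by auto
  moreover have "infinite (UNIV - {0 :: complex})" by (simp add: infinite_UNIV_char_0)
  ultimately have "infinite {t. poly q t = 0}" using finite_subset by blast
  then have "q = 0" using poly_roots_finite by blast
  have sub: "keys (coeff (graded R) d) \<subseteq> keys R" by (auto simp: in_keys_iff lookup_coeff_graded split: if_splits)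
  have "subst_mpoly id (lookup Q) (coeff (graded R) d)
     = (\<Sum>m\<in>keys R. id (lookup (coeff (graded R) d) m) * mon (lookup Q) m)"
    by (rule subst_mpoly_superset[OF semiring_hom_id finite_keys sub])
  also have "\<dots> = coeff q d"
    unfolding q_def coeff_sum by (intro sum.cong) (auto simp: lookup_coeff_graded)
  finally show ?thesis using \<open>q = 0\<close> by simp
qed

text \<open>Dimension count. Consider the monomials in the 15 coefficients with all exponents at most \<open>d\<close>, evaluated
along the family. They are polynomials of degree at most \<open>N = 15 d D\<close> in each of at most 14
parameters, so they are determined by their values on a grid of \<open>(N + 1) ^ 14\<close> points. This number is
smaller than the number \<open>(d + 1) ^ 15\<close> of monomials once \<open>d\<close> is large, and then a nontrivial linear
combination of them vanishes on the whole family. As the set is stable under scaling, so do its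
homogeneous parts.\<close>

lemma negligible_image:
  fixes \<Phi> :: "('i \<Rightarrow> complex) \<Rightarrow> 3 mpoly"
  assumes A: "finite A" "card A \<le> 14" and fam: "poly_family A \<Phi>"
    and scale: "\<And>Q t. Q \<in> S \<Longrightarrow> t \<noteq> 0 \<Longrightarrow> Cst t * Q \<in> S"
    and img: "\<And>Q. Q \<in> S \<Longrightarrow> \<exists>x. (\<forall>i. i \<notin> A \<longrightarrow> x i = 0) \<and> Q = \<Phi> x"
  shows "negligible S"
proof -
  obtain D0 where D0: "\<forall>k. sep_poly A D0 (\<lambda>x. lookup (\<Phi> x) k)"
    using fam unfolding poly_family_def by blast
  define D where "D = Suc D0"
  have D: "sep_poly A D (\<lambda>x. lookup (\<Phi> x) k)" for k
    using D0 sep_poly_mono unfolding D_def by (metis le_SucI order_refl)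
  define V where "V = exps UNIV 4"
  have V: "finite V" "card V = 15" by (simp_all add: V_def card_exps)
  \<comment> \<open>With this choice, \<open>(N + 1) ^ 14 \<le> (15 D) ^ 14 (d + 1) ^ 14 < (d + 1) ^ 15\<close>.\<close>
  define d where "d = (15 * D) ^ 14"
  define N where "N = 15 * (d * D)"
  define E where "E = V \<rightarrow>\<^sub>E {..d}"
  have E: "finite E" "card E = (d + 1) ^ 15" unfolding E_def using V by (auto intro: finite_PiE simp: card_PiE)
  define T :: "complex set" where "T = of_nat ` {..N}"
  have T: "finite T" "card T = N + 1" by (auto simp: T_def card_image inj_on_def)
  define G where "G = {x. (\<forall>i\<in>A. x i \<in> T) \<and> (\<forall>i. i \<notin> A \<longrightarrow> x i = 0)}"
  have Gsub: "G \<subseteq> (\<lambda>f i. if i \<in> A then f i else 0) ` (A \<rightarrow>\<^sub>E T)"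
  proof
    fix x assume x: "x \<in> G"
    then have "x = (\<lambda>i. if i \<in> A then restrict x A i else 0)" by (auto simp: G_def)
    moreover have "restrict x A \<in> A \<rightarrow>\<^sub>E T" using x by (auto simp: G_def)
    ultimately show "x \<in> (\<lambda>f i. if i \<in> A then f i else 0) ` (A \<rightarrow>\<^sub>E T)" by blast
  qed
  have finP: "finite (A \<rightarrow>\<^sub>E T)" using A T by (intro finite_PiE) auto
  have G: "finite G" using Gsub finP by (meson finite_imageI finite_subset)
  have "card G \<le> card (A \<rightarrow>\<^sub>E T)"
    using Gsub finP by (meson card_image_le card_mono finite_imageI le_trans)
  also have "\<dots> = (N + 1) ^ card A" using A T by (simp add: card_PiE)
  also have "\<dots> \<le> (N + 1) ^ 14" using A(2) by (intro power_increasing) auto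
  also have "\<dots> \<le> (15 * D * (d + 1)) ^ 14"
    by (intro power_mono) (auto simp: N_def D_def algebra_simps)
  also have "\<dots> = d * (d + 1) ^ 14" unfolding d_def by (rule power_mult_distrib)
  also have "\<dots> < (d + 1) * (d + 1) ^ 14" by (intro mult_strict_right_mono) auto
  also have "\<dots> = card E" by (simp only: E(2) power_Suc[symmetric]) simp
  finally have card: "card G < card E" .
  define a where "a f x = (\<Prod>v\<in>V. lookup (\<Phi> x) v ^ f v)" for f x
  obtain c where c: "\<exists>f\<in>E. c f \<noteq> 0" "\<forall>x\<in>G. (\<Sum>f\<in>E. c f * a f x) = 0"
    using linear_dependence[OF G E(1) card, of a] by blast
  define ex where "ex f = Abs_poly_mapping (\<lambda>v. if v \<in> V then f v else (0::nat))" for f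
  have lex: "lookup (ex f) v = (if v \<in> V then f v else 0)" for f v
  proof -
    have "finite {v. (if v \<in> V then f v else 0) \<noteq> 0}" using V(1) by (rule finite_subset[rotated]) auto
    then show ?thesis unfolding ex_def by (subst lookup_Abs_poly_mapping) auto
  qed
  have inj: "f = g" if "f \<in> E" "g \<in> E" "ex f = ex g" for f g
  proof
    fix v show "f v = g v"
      using that lex[of f v] lex[of g v] by (cases "v \<in> V") (auto simp: E_def PiE_def extensional_def)
  qed
  have kex: "keys (ex f) \<subseteq> V" for f by (auto simp: in_keys_iff lex split: if_splits)
  define R where "R = (\<Sum>f\<in>E. single (ex f) (c f))"
  have lR: "lookup R (ex f) = c f" if "f \<in> E" for f
  proof -
    have "lookup R (ex f) = (\<Sum>g\<in>E. if g = f then c f else 0)"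
      unfolding R_def lookup_sum using that by (intro sum.cong) (auto simp: lookup_single when_def dest: inj)
    then show ?thesis using that E(1) by simp
  qed
  have keysR: "keys m \<subseteq> V" if "m \<in> keys R" for m
  proof -
    have "lookup R m \<noteq> 0" using that by (simp add: in_keys_iff)
    then obtain f where "lookup (single (ex f) (c f)) m \<noteq> 0"
      unfolding R_def lookup_sum by (meson sum.neutral)
    then have "m = ex f" by (auto simp: lookup_single when_def split: if_splits)
    then show ?thesis using kex by simp
  qed
  have val: "subst_mpoly id (lookup (\<Phi> x)) R = (\<Sum>f\<in>E. c f * a f x)" for x
    by (simp add: R_def subst_mpoly_sum[OF semiring_hom_id] subst_mpoly_single[OF semiring_hom_id]
       mon_superset[OF V(1) kex] a_def lex)
  have "sep_poly A N (a f)" if "f \<in> E" for f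
  proof -
    have "sep_poly A (d * D) (\<lambda>x. lookup (\<Phi> x) v ^ f v)" if "v \<in> V" for v
    proof (rule sep_poly_mono[OF sep_poly_power[OF D]])
      have "f v \<le> d" using \<open>f \<in> E\<close> that by (auto simp: E_def)
      then show "f v * D \<le> d * D" by simp
    qed
    then have "sep_poly A (card V * (d * D)) (\<lambda>x. \<Prod>v\<in>V. lookup (\<Phi> x) v ^ f v)"
      by (rule sep_poly_prod)
    then show ?thesis by (simp add: V N_def a_def[abs_def])
  qed
  then have "sep_poly A N (\<lambda>x. \<Sum>f\<in>E. c f * a f x)"
    by (intro sep_poly_sum) (use sep_poly_mult[OF sep_poly_const[of A 0]] in fastforce)
  then have van: "subst_mpoly id (lookup (\<Phi> x)) R = 0" if "\<forall>i. i \<notin> A \<longrightarrow> x i = 0" for x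
    unfolding val by (rule sep_poly_vanishes[OF A(1) _ T(1)]) (use that c(2) T in \<open>auto simp: G_def\<close>)
  obtain f where f: "f \<in> E" "c f \<noteq> 0" using c(1) by blast
  define e where "e = monom_deg (ex f)"
  define R' where "R' = coeff (graded R) e"
  have "lookup R' (ex f) \<noteq> 0" using f lR by (simp add: R'_def lookup_coeff_graded e_def)
  then have "R' \<noteq> 0" by auto
  moreover have "form_in V e R'"
    unfolding form_in_def
  proof
    fix m assume "m \<in> keys R'"
    then have "m \<in> keys R" "monom_deg m = e"
      by (auto simp: R'_def in_keys_iff lookup_coeff_graded split: if_splits)
    then show "keys m \<subseteq> V \<and> monom_deg m = e" using keysR by blast
  qed
  moreover have "subst_mpoly id (lookup Q) R' = 0" if "Q \<in> S" for Q
    unfolding R'_def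
  proof (rule homogeneous_part_vanishes)
    fix t :: complex assume "t \<noteq> 0"
    from img[OF scale[OF that this]] van show "subst_mpoly id (lookup (Cst t * Q)) R = 0" by auto
  qed
  ultimately show ?thesis unfolding negligible_def V_def by blast
qed

text \<open>One further factor, a coefficient of the quartic, is multiplied to the relation so that the quartic where the product does not vanish is not the zero form.\<close>

lemma negligible_avoid:
  assumes "negligible S"
  shows "\<exists>Z. zariski_closed Z \<and> S \<inter> forms 4 \<subseteq> Z \<and> (\<exists>Q\<in>forms 4. Q \<notin> Z)"
proof -
  define V where "V = exps UNIV 4"
  obtain R d where R: "R \<noteq> 0" "form_in V d R" "\<forall>Q\<in>S. subst_mpoly id (lookup Q) R = 0"
    using assms unfolding negligible_def V_def by blast
  define Z where "Z = {Q \<in> forms 4. \<forall>R\<in>{R}. subst_mpoly id (lookup Q) R = 0}"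
  have "homogeneous d R" using R(2) by (auto simp: homogeneous_def form_in_def)
  then have "zariski_closed Z" unfolding zariski_closed_def Z_def by blast
  moreover have "S \<inter> forms 4 \<subseteq> Z" using R(3) by (auto simp: Z_def)
  moreover have "\<exists>Q\<in>forms 4. Q \<notin> Z"
  proof -
    obtain v where v: "v \<in> V" using card_exps(4) unfolding V_def by fastforce
    have "Var v \<noteq> (0 :: (3 \<Rightarrow>\<^sub>0 nat) mpoly)" unfolding Var_def
      by (metis lookup_single_eq lookup_zero zero_neq_one)
    then have "R * Var v \<noteq> 0" using R(1) by simp
    then obtain x where "subst_mpoly id x (R * Var v) \<noteq> 0" using mpoly_zero_if_vanishes by blast
    then have x: "subst_mpoly id x R \<noteq> 0" "x v \<noteq> 0"
      by (auto simp: subst_mpoly_mult[OF semiring_hom_id] semiring_hom_id)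
    define Q where "Q = (\<Sum>m\<in>V. single m (x m))"
    have lQ: "lookup Q m = (if m \<in> V then x m else 0)" for m
      unfolding Q_def lookup_sum lookup_single when_def by (simp add: V_def)
    have "Q \<noteq> 0" using x(2) v lQ[of v] by auto
    moreover have "homogeneous 4 Q"
      by (auto simp: homogeneous_def in_keys_iff lQ V_def exps_def split: if_splits)
    ultimately have "Q \<in> forms 4" by (simp add: forms_def)
    moreover have "subst_mpoly id (lookup Q) R = subst_mpoly id x R"
      unfolding subst_mpoly_def using R(2)
      by (intro sum.cong prod.cong arg_cong2[where f = "(*)"] arg_cong2[where f = "(^)"] refl)
        (auto simp: form_in_def lQ)
    ultimately have "Q \<in> forms 4 \<and> Q \<notin> Z" using x(1) by (simp add: Z_def)
    then show ?thesis by blast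
  qed
  ultimately show ?thesis by blast
qed

section \<open>Restriction to parametrized lines, and gradients\<close>

lemma mpoly_induct [case_names const var add mult]:
  assumes const: "\<And>c. P (Cst c)" and var: "\<And>i. P (Var i)"
    and add: "\<And>F G. P F \<Longrightarrow> P G \<Longrightarrow> P (F + G)" and mult: "\<And>F G. P F \<Longrightarrow> P G \<Longrightarrow> P (F * G)"
  shows "P F"
proof -
  have one: "P 1" using const[of 1] by (simp add: hom_one[OF semiring_hom_Cst])
  have zero: "P 0" using const[of 0] by (simp add: hom_zero[OF semiring_hom_Cst])
  have power: "P G \<Longrightarrow> P (G ^ n)" for G n by (induction n) (auto intro: one mult)
  have prod: "P (\<Prod>i\<in>S. Var i ^ lookup m i)" for S m
    by (induction S rule: infinite_finite_induct) (auto intro: one mult power var)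
  have sum: "(\<And>i. i \<in> S \<Longrightarrow> P (f i)) \<Longrightarrow> P (\<Sum>i\<in>S. f i)" for S and f :: "_ \<Rightarrow> _ mpoly"
    by (induction S rule: infinite_finite_induct) (auto intro: zero add)
  have "P (\<Sum>m\<in>keys F. single m (lookup F m))"
    by (rule sum) (simp add: single_eq_Cst_mon mon_def mult const prod)
  then show ?thesis by (simp add: mpoly_sum_single[symmetric])
qed

text \<open>The polynomial \<open>F(p + t v)\<close> in \<open>t\<close>. It carries the intersection number of \<open>F\<close> with the line through \<open>p\<close> and
\<open>v\<close> (its order at 0) and the derivative of \<open>F\<close> at \<open>p\<close> in the direction \<open>v\<close> (its linear coefficient).\<close>

definition line_poly :: "3 mpoly \<Rightarrow> complex^3 \<Rightarrow> complex^3 \<Rightarrow> complex poly" where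
  "line_poly F p v = subst_mpoly (\<lambda>c. [:c:]) (\<lambda>i. [:p $ i, v $ i:]) F"

lemma const_poly_hom: "semiring_hom (\<lambda>c::complex. [:c:])"
  using hom_const_poly[OF semiring_hom_id, where 'b = complex] by simp

lemma line_poly_hom: "semiring_hom (\<lambda>F. line_poly F p v)"
  using semiring_hom_subst_mpoly[OF const_poly_hom] by (simp add: line_poly_def)

lemma line_poly_Cst [simp]: "line_poly (Cst c) p v = [:c:]"
  and line_poly_Var [simp]: "line_poly (Var i) p v = [:p $ i, v $ i:]"
  by (simp_all add: line_poly_def const_poly_hom)

lemma line_poly_add [simp]: "line_poly (F + G) p v = line_poly F p v + line_poly G p v"
  and line_poly_mult [simp]: "line_poly (F * G) p v = line_poly F p v * line_poly G p v"
  by (rule hom_add[OF line_poly_hom], rule hom_mult[OF line_poly_hom])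

lemma poly_line_poly: "poly (line_poly F p v) t = form_val F (p + t *s v)"
  by (induction F rule: mpoly_induct) auto

lemma coeff_0_line_poly [simp]: "coeff (line_poly F p v) 0 = form_val F p"
  using poly_line_poly[of F p v 0] by (simp add: poly_0_coeff_0)

definition grad :: "3 mpoly \<Rightarrow> complex^3 \<Rightarrow> complex^3 \<Rightarrow> complex" where
  "grad F p v = coeff (line_poly F p v) 1"

lemma grad_Cst [simp]: "grad (Cst c) p v = 0"
  and grad_Var [simp]: "grad (Var i) p v = v $ i"
  and grad_add [simp]: "grad (F + G) p v = grad F p v + grad G p v"
  and grad_mult [simp]: "grad (F * G) p v = form_val F p * grad G p v + form_val G p * grad F p v"
  by (simp_all add: grad_def coeff_mult mult.commute)

lemma grad_linear: "\<exists>g. \<forall>v. grad F p v = (\<Sum>i\<in>UNIV. g i * v $ i)"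
proof (induction F rule: mpoly_induct)
  case (const c)
  then show ?case by (intro exI[of _ "\<lambda>_. 0"]) simp
next
  case (var i)
  have "(\<Sum>j\<in>UNIV. (if j = i then 1 else 0) * v $ j) = v $ i" for v :: "complex^3"
    by (simp add: if_distrib[of "\<lambda>x. x * _"] sum.delta cong: if_cong)
  then show ?case by (intro exI[of _ "\<lambda>j. if j = i then 1 else 0"]) simp
next
  case (add F G)
  then obtain f g where "\<forall>v. grad F p v = (\<Sum>i\<in>UNIV. f i * v $ i)" "\<forall>v. grad G p v = (\<Sum>i\<in>UNIV. g i * v $ i)"
    by blast
  then show ?case by (intro exI[of _ "\<lambda>i. f i + g i"]) (simp add: sum.distrib algebra_simps)
next
  case (mult F G)
  then obtain f g where "\<forall>v. grad F p v = (\<Sum>i\<in>UNIV. f i * v $ i)" "\<forall>v. grad G p v = (\<Sum>i\<in>UNIV. g i * v $ i)"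
    by blast
  then show ?case by (intro exI[of _ "\<lambda>i. form_val F p * g i + form_val G p * f i"])
     (simp add: sum.distrib algebra_simps sum_distrib_left)
qed

lemma grad_plus: "grad F p (v + w) = grad F p v + grad F p w"
  and grad_scale: "grad F p (c *s v) = c * grad F p v"
  using grad_linear[of F p] by (auto simp: sum.distrib algebra_simps sum_distrib_left)

lemma form_val_has_derivative: "(form_val F has_derivative grad F x) (at x)"
proof (induction F rule: mpoly_induct)
  case (const c)
  have "form_val (Cst c) = (\<lambda>_. c)" "grad (Cst c) x = (\<lambda>_. 0)" by auto
  then show ?case by simp
next
  case (var i)
  have "form_val (Var i) = (\<lambda>x. x $ i)" "grad (Var i) x = (\<lambda>v. v $ i)" by auto
  then show ?case by (simp add: bounded_linear_imp_has_derivative bounded_linear_vec_nth)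
next
  case (add F G)
  have "form_val (F + G) = (\<lambda>x. form_val F x + form_val G x)" "grad (F + G) x = (\<lambda>v. grad F x v + grad G x v)" by auto
  then show ?case using has_derivative_add[OF add] by simp
next
  case (mult F G)
  have "form_val (F * G) = (\<lambda>x. form_val F x * form_val G x)"
    "grad (F * G) x = (\<lambda>v. form_val F x * grad G x v + grad F x v * form_val G x)" by (auto simp: mult.commute)
  then show ?case using has_derivative_mult[OF mult] by simp
qed

lemma continuous_on_form_val: "continuous_on S (form_val F)"
  by (intro continuous_at_imp_continuous_on ballI has_derivative_continuous[OF form_val_has_derivative])

lemma degree_line_poly:
  assumes "form_in W d F" shows "degree (line_poly F p v) \<le> d"
proof -
  have "degree ([:c:] * mon (\<lambda>i. [:p $ i, v $ i:]) m) \<le> d" if m: "monom_deg m = d" for c m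
  proof -
    have "degree (mon (\<lambda>i. [:p $ i, v $ i:]) m) \<le> sum (degree \<circ> (\<lambda>i. [:p $ i, v $ i:] ^ lookup m i)) (keys m)"
      unfolding mon_def by (rule degree_prod_sum_le) simp
    also have "\<dots> \<le> (\<Sum>i\<in>keys m. lookup m i)"
    proof (rule sum_mono)
      fix i
      have "degree ([:p $ i, v $ i:] ^ lookup m i) \<le> degree [:p $ i, v $ i:] * lookup m i"
        by (rule degree_power_le)
      also have "\<dots> \<le> lookup m i" by simp
      finally show "(degree \<circ> (\<lambda>i. [:p $ i, v $ i:] ^ lookup m i)) i \<le> lookup m i" by simp
    qed
    finally show ?thesis using m by (auto simp: monom_deg_def intro: order_trans[OF degree_smult_le])
  qed
  then show ?thesis unfolding line_poly_def subst_mpoly_mon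
    using assms by (intro degree_sum_le) (auto simp: form_in_def)
qed

lemma poly_as_sum_le: "degree p \<le> d \<Longrightarrow> poly p (x::complex) = (\<Sum>j\<le>d. coeff p j * x ^ j)"
  unfolding poly_altdef by (rule sum.mono_neutral_left) (auto intro: coeff_eq_0)

lemma poly_eq_off_zero:
  fixes p q :: "complex poly"
  assumes "\<And>t. t \<notin> S \<Longrightarrow> poly p t = poly q t" "finite S"
  shows "p = q"
proof -
  have "UNIV - S \<subseteq> {t. poly (p - q) t = 0}" using assms by auto
  moreover have "infinite (UNIV - S)" using assms(2) by (simp add: infinite_UNIV_char_0)
  ultimately have "infinite {t. poly (p - q) t = 0}" using finite_subset by blast
  then have "p - q = 0" using poly_roots_finite by blast
  then show ?thesis by simp
qed

text \<open>The homogenization of \<open>F(v + t p)\<close> is \<open>F(x v + y p)\<close>. For nonzero \<open>x\<close> this is scaling; the value at \<open>x = 0\<close>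
follows because both sides are polynomials in \<open>x\<close>.\<close>

lemma form_val_on_line:
  assumes F: "form_in W d F"
  shows "form_val F (x *s v + y *s p) = (\<Sum>j\<le>d. coeff (line_poly F v p) j * x ^ (d - j) * y ^ j)"
proof -
  let ?c = "coeff (line_poly F v p)"
  define g where "g = (\<Sum>j\<le>d. monom (?c j * y ^ j) (d - j))"
  have "poly (line_poly F (y *s p) v) t = poly g t" if "t \<notin> {0}" for t
  proof -
    have t: "t \<noteq> 0" using that by simp
    have "y *s p + t *s v = t *s (v + (y / t) *s p)"
      using t by (simp add: vector_add_ldistrib)
    then have "form_val F (y *s p + t *s v) = t ^ d * poly (line_poly F v p) (y / t)"
      by (simp only: form_val_scale[OF F] poly_line_poly)
    also have "poly (line_poly F v p) (y / t) = (\<Sum>j\<le>d. ?c j * (y / t) ^ j)"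
      by (rule poly_as_sum_le[OF degree_line_poly[OF F]])
    also have "t ^ d * (\<Sum>j\<le>d. ?c j * (y / t) ^ j) = (\<Sum>j\<le>d. ?c j * y ^ j * t ^ (d - j))"
      unfolding sum_distrib_left using t
      by (intro sum.cong refl) (simp add: power_divide power_diff field_simps)
    finally show ?thesis by (simp add: poly_line_poly g_def poly_sum poly_monom)
  qed
  then have "line_poly F (y *s p) v = g" by (rule poly_eq_off_zero[where S = "{0}"]) simp_all
  then have "form_val F (y *s p + x *s v) = poly g x" by (simp add: poly_line_poly[symmetric])
  then show ?thesis by (simp add: g_def poly_sum poly_monom add.commute mult_ac)
qed

section \<open>Linear forms and the planes they define\<close>

lemma linear_form_combination:
  assumes "form_in W 1 l"
  shows "form_val l (x *s v + y *s p) = x * form_val l v + y * form_val l p"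
proof -
  have *: "form_val l (x *s v + y *s p) = form_val l v * x + coeff (line_poly l v p) 1 * y" for x y
    using form_val_on_line[OF assms, of x v y p] by simp
  have "form_val l p = coeff (line_poly l v p) 1" using *[of 0 1] by simp
  then show ?thesis using * by (simp add: mult.commute)
qed

lemma linear_form_add: "form_in W 1 l \<Longrightarrow> form_val l (v + p) = form_val l v + form_val l p"
  using linear_form_combination[of W l 1 v 1 p] by simp

lemma linear_form_scale: "form_in W 1 l \<Longrightarrow> form_val l (c *s p) = c * form_val l p"
  using linear_form_combination[of W l c p 0 p] by simp

lemma linear_form_diff: "form_in W 1 l \<Longrightarrow> form_val l (v - p) = form_val l v - form_val l p"
  using linear_form_combination[of W l 1 v "-1" p] by simp

lemma linear_form_sum: "form_in W 1 l \<Longrightarrow> form_val l (\<Sum>i\<in>A. f i) = (\<Sum>i\<in>A. form_val l (f i))"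
proof (induction A rule: infinite_finite_induct)
  case empty
  then show ?case using linear_form_scale[of W l 0 0] by simp
next
  case (infinite A)
  then show ?case using linear_form_scale[of W l 0 0] by simp
qed (simp add: linear_form_add)

definition lin :: "complex^3 \<Rightarrow> 3 mpoly" where
  "lin a = (\<Sum>i\<in>UNIV. Cst (a $ i) * Var i)"

lemma form_in_lin: "form_in {i. a $ i \<noteq> 0} 1 (lin a)"
  unfolding lin_def
proof (rule form_in_sum)
  fix i
  show "form_in {i. a $ i \<noteq> 0} 1 (Cst (a $ i) * Var i)"
  proof (cases "a $ i = 0")
    case False
    then show ?thesis by (intro form_in_smult form_in_Var) simp
  qed (simp add: hom_zero[OF semiring_hom_Cst])
qed

lemma form_in_lin_UNIV [simp]: "form_in UNIV 1 (lin a)"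
  by (rule form_in_mono[OF form_in_lin]) auto

lemma form_val_lin: "form_val (lin a) x = (\<Sum>i\<in>UNIV. a $ i * x $ i)"
  by (simp add: lin_def)

lemma linear_form_eq_lin:
  assumes "form_in W 1 l" shows "l = lin (\<chi> i. form_val l (axis i 1))"
proof (rule form_eqI)
  fix x :: "complex^3"
  have "form_val l x = form_val l (\<Sum>i\<in>UNIV. x $ i *s axis i 1)" by (simp add: basis_expansion)
  also have "\<dots> = (\<Sum>i\<in>UNIV. form_val l (axis i 1) * x $ i)"
    by (simp add: linear_form_sum[OF assms] linear_form_scale[OF assms] mult.commute)
  finally show "form_val l x = form_val (lin (\<chi> i. form_val l (axis i 1))) x" by (simp add: form_val_lin)
qed

lemma coordinates_3:
  obtains j k :: 3 where "i \<noteq> j" "i \<noteq> k" "j \<noteq> k" "UNIV = {i, j, k}" "UNIV - {i} = {j, k}"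
proof -
  have ne: "i \<noteq> i + 1" "i \<noteq> i + 2" "i + 1 \<noteq> i + 2" by simp_all
  then have "card {i, i + 1, i + 2} = CARD(3)" by simp
  then have U: "{i, i + 1, i + 2} = UNIV" by (intro card_subset_eq) auto
  moreover have "UNIV - {i} = {i + 1, i + 2}" unfolding U[symmetric] using ne by auto
  ultimately show ?thesis using that ne by metis
qed

text \<open>Every line has, up to a scalar, an equation \<open>X\<^sub>i = r\<close> with \<open>r\<close> in the other two variables. This saves the one parameter that makes the dimension counts work.\<close>

lemma linear_form_normalised:
  assumes "l \<in> forms 1"
  obtains i j k a r where "i \<noteq> j" "i \<noteq> k" "j \<noteq> k" "UNIV = {i, j, k}" "UNIV - {i} = {j, k}" "a \<noteq> 0"
    "form_in {j, k} 1 r" "l = Cst a * (Var i - r)"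
proof -
  have l: "form_in UNIV 1 l" "l \<noteq> 0" using assms by (auto simp: forms_iff)
  define b :: "complex^3" where "b = (\<chi> i. form_val l (axis i 1))"
  have lb: "l = lin b" unfolding b_def by (rule linear_form_eq_lin[OF l(1)])
  have "b \<noteq> 0"
  proof
    assume "b = 0"
    then have "l = 0" by (intro form_zero_if_vanishes) (simp add: lb form_val_lin)
    then show False using l by simp
  qed
  then obtain i where i: "b $ i \<noteq> 0" by (auto simp: vec_eq_iff)
  obtain j k where ijk: "i \<noteq> j" "i \<noteq> k" "j \<noteq> k" "UNIV = {i, j, k}" "UNIV - {i} = {j, k}"
    by (rule coordinates_3[of i])
  define r where "r = lin (\<chi> m. if m = i then 0 else - b $ m / b $ i)"
  have "form_in {j, k} 1 r" unfolding r_def by (rule form_in_mono[OF form_in_lin]) (use ijk(5) in auto)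
  moreover have "l = Cst (b $ i) * (Var i - r)"
  proof (rule form_eqI)
    fix x :: "complex^3"
    have s: "(\<Sum>m\<in>UNIV. f m) = f i + f j + f k" for f :: "3 \<Rightarrow> complex"
      unfolding ijk(4) using ijk(1-3) by simp
    show "form_val l x = form_val (Cst (b $ i) * (Var i - r)) x"
      using i ijk(1-3) by (simp add: lb r_def form_val_lin s field_simps)
  qed
  ultimately show ?thesis using that[OF ijk i] by simp
qed

lemma plane_dim_2:
  assumes "l \<in> forms 1"
  shows "\<not> {x. form_val l x = 0} \<subseteq> vec.span {p}"
proof
  assume sub: "{x. form_val l x = 0} \<subseteq> vec.span {p}"
  obtain i j k a r where l: "i \<noteq> j" "i \<noteq> k" "j \<noteq> k" "UNIV = {i, j, k}" "UNIV - {i} = {j, k}" "a \<noteq> 0"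
    "form_in {j, k} 1 r" "l = Cst a * (Var i - r)"
    by (rule linear_form_normalised[OF assms])
  note l = l(1-3,7,8)
  define e where "e m = axis m 1 + form_val r (axis m 1) *s axis i (1::complex)" for m
  have "form_val r (axis i 1) = form_val r 0" by (rule form_val_cong[OF l(4)]) (use l(1,2) in \<open>auto simp: axis_def\<close>)
  then have r: "form_val r (axis i 1) = 0" using linear_form_scale[OF l(4), of 0 0] by simp
  have "e m \<in> vec.span {p}" if "m \<in> {j, k}" for m
  proof -
    have "form_val l (e m) = 0"
      using that l(1,2) by (auto simp: l(5) e_def linear_form_add[OF l(4)] linear_form_scale[OF l(4)] r) (auto simp: axis_def)
    then show ?thesis using sub by auto
  qed
  then have "e j \<in> range (\<lambda>c. c *s p)" "e k \<in> range (\<lambda>c. c *s p)" by (simp_all add: vec.span_singleton)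
  then obtain c c' where "e j = c *s p" "e k = c' *s p" by blast
  then have "e j $ j = c * p $ j" "e j $ k = c * p $ k" "e k $ k = c' * p $ k" by auto
  then show False using l(1-3) by (auto simp: e_def axis_def)
qed

lemma span_pair: "x \<in> vec.span {p, v} \<longleftrightarrow> (\<exists>a b. x = a *s p + b *s (v :: complex^3))"
proof
  assume "x \<in> vec.span {p, v}"
  then show "\<exists>a b. x = a *s p + b *s v"
    by (auto simp: vec.span_breakdown_eq vec.span_singleton) (metis add.commute diff_add_cancel)
next
  assume "\<exists>a b. x = a *s p + b *s v"
  then show "x \<in> vec.span {p, v}" by (metis insertCI vec.span_add vec.span_base vec.span_scale)
qed

lemma exists_plane_basis:
  assumes "l \<in> forms 1"
  obtains p v where "{x. form_val l x = 0} = vec.span {p, v}" "p \<noteq> 0" "v \<notin> vec.span {p}"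
proof -
  obtain i j k a r where l: "i \<noteq> j" "i \<noteq> k" "j \<noteq> k" "UNIV = {i, j, k}" "UNIV - {i} = {j, k}" "a \<noteq> 0"
    "form_in {j, k} 1 r" "l = Cst a * (Var i - r)"
    by (rule linear_form_normalised[OF assms])
  note l = l(1-4,6-8)
  define e where "e m = axis m 1 + form_val r (axis m 1) *s axis i (1::complex)" for m
  have "form_val r (axis i 1) = form_val r 0" by (rule form_val_cong[OF l(6)]) (use l(1,2) in \<open>auto simp: axis_def\<close>)
  then have r: "form_val r (axis i 1) = 0" using linear_form_scale[OF l(6), of 0 0] by simp
  have e0: "form_val l (e m) = 0" if "m \<in> {j, k}" for m
    using that l(1,2) by (auto simp: l(7) e_def linear_form_add[OF l(6)] linear_form_scale[OF l(6)] r) (auto simp: axis_def)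
  have lf: "form_in UNIV 1 l" using assms by (simp add: forms_iff)
  have "{x. form_val l x = 0} = vec.span {e j, e k}"
  proof (rule set_eqI, rule iffI)
    fix x assume "x \<in> {x. form_val l x = 0}"
    then have x: "form_val l x = 0" by simp
    define y where "y = x - (x $ j *s e j + x $ k *s e k)"
    have "form_val l (x $ j *s e j + x $ k *s e k) = 0"
      using linear_form_combination[OF lf] e0 by simp
    then have "form_val l y = 0" unfolding y_def using linear_form_diff[OF lf] x by simp
    moreover have y: "y $ j = 0" "y $ k = 0" using l(1-3) by (simp_all add: y_def e_def axis_def)
    moreover have "form_val r y = form_val r 0" by (rule form_val_cong[OF l(6)]) (use y in auto)
    ultimately have "y $ i = 0" using l(5) linear_form_scale[OF l(6), of 0 0] by (simp add: l(7))
    moreover have "m = i \<or> m = j \<or> m = k" for m using l(4) by blast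
    ultimately have "y $ m = 0" for m using y by metis
    then have "y = 0" by (simp add: vec_eq_iff)
    then have "x = x $ j *s e j + x $ k *s e k" by (simp add: y_def)
    then show "x \<in> vec.span {e j, e k}" unfolding span_pair by blast
  next
    fix x assume "x \<in> vec.span {e j, e k}"
    then obtain c d where "x = c *s e j + d *s e k" unfolding span_pair by blast
    then show "x \<in> {x. form_val l x = 0}" using linear_form_combination[OF lf] e0 by simp
  qed
  moreover have "e j $ j = 1" "e j $ k = 0" "e k $ j = 0" "e k $ k = 1"
    using l(1-3) by (simp_all add: e_def axis_def)
  then have "e j \<noteq> 0" "e k \<notin> vec.span {e j}"
    by (auto simp: vec.span_singleton)
  ultimately show ?thesis using that by blast
qed

lemma plane_basis_complete:
  assumes l: "l \<in> forms 1" and p: "p \<noteq> 0" "form_val l p = 0" and v: "form_val l v = 0" "v \<notin> vec.span {p}"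
  shows "{x. form_val l x = 0} = vec.span {p, v}"
proof -
  obtain e f where ef: "{x. form_val l x = 0} = vec.span {e, f}" using exists_plane_basis[OF l] by metis
  have pv: "p \<noteq> v" using v(2) vec.span_base[of v "{v}"] by auto
  have "vec.independent {v, p}"
    unfolding vec.independent_insert using pv p(1) v(2) by (simp add: vec.independent_empty)
  then have "vec.independent {p, v}" by (simp add: insert_commute)
  with pv have "vec.dim (vec.span {p, v}) = 2" by (simp add: vec.dim_eq_card_independent vec.dim_span)
  moreover have "vec.dim (vec.span {e, f}) \<le> card {e, f}" by (rule vec.dim_le_card) auto
  moreover have "card {e, f} \<le> 2" by (simp add: card_insert_if)
  moreover have "vec.span {p, v} \<subseteq> vec.span {e, f}"
  proof (rule vec.span_minimal)
    show "{p, v} \<subseteq> vec.span {e, f}" using p v ef by auto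
  qed (rule vec.subspace_span)
  ultimately have "vec.span {p, v} = vec.span {e, f}"
    by (intro vec.subspace_dim_equal vec.subspace_span) auto
  then show ?thesis using ef by simp
qed

text \<open>For a linear form \<open>l\<close> this is divisibility by \<open>l\<close>, but as a condition on values it is easier to verify. The
next lemmas show the equivalence and that linear forms are prime, for products of forms.\<close>

definition vanishes_on :: "3 mpoly \<Rightarrow> 3 mpoly \<Rightarrow> bool" where
  "vanishes_on l F \<longleftrightarrow> (\<forall>x. form_val l x = 0 \<longrightarrow> form_val F x = 0)"

lemma linear_form_division:
  assumes "l \<in> forms 1" "form_in UNIV d F"
  obtains W F0 G where "\<forall>x. \<exists>y. form_val l y = 0 \<and> (\<forall>m\<in>W. y $ m = x $ m)" "form_in W d F0"
     "form_in UNIV (d - 1) G" "F = F0 + l * G"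
proof -
  obtain i j k a r where l: "i \<noteq> j" "i \<noteq> k" "j \<noteq> k" "UNIV = {i, j, k}" "UNIV - {i} = {j, k}" "a \<noteq> 0"
    "form_in {j, k} 1 r" "l = Cst a * (Var i - r)"
    by (rule linear_form_normalised[OF assms(1)])
  note l = l(5-8)
  have r: "form_in (UNIV - {i}) 1 r" using l by simp
  obtain F0 G where F: "form_in (UNIV - {i}) d F0" "form_in UNIV (d - 1) G" "F = F0 + (Var i - r) * G"
    using form_division[OF assms(2) UNIV_I r] by blast
  have "Cst a * Cst (1 / a) = (1 :: 3 mpoly)"
    using l(2) by (simp add: hom_mult[OF semiring_hom_Cst, symmetric] hom_one[OF semiring_hom_Cst])
  moreover have "l * (Cst (1 / a) * G) = (Cst a * Cst (1 / a)) * ((Var i - r) * G)"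
    unfolding l(4) by (simp only: mult_ac)
  ultimately have "l * (Cst (1 / a) * G) = (Var i - r) * G" by (simp only: mult_1_left)
  then have "F = F0 + l * (Cst (1 / a) * G)" by (simp only: F(3))
  moreover have "form_in UNIV (d - 1) (Cst (1 / a) * G)" by (rule form_in_smult[OF F(2)])
  moreover have "\<exists>y. form_val l y = 0 \<and> (\<forall>m\<in>UNIV - {i}. y $ m = x $ m)" for x
  proof -
    define y where "y = (\<chi> m. if m = i then form_val r x else x $ m)"
    have "form_val r y = form_val r x" by (rule form_val_cong[OF r]) (auto simp: y_def)
    then have "form_val l y = 0" by (simp add: l(4) y_def)
    then show ?thesis by (intro exI[of _ y]) (auto simp: y_def)
  qed
  ultimately show ?thesis using that[of "UNIV - {i}" F0 "Cst (1 / a) * G"] F(1) by simp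
qed

lemma vanishes_on_dvd:
  assumes "l \<in> forms 1" "form_in UNIV d F" "vanishes_on l F"
  obtains G where "form_in UNIV (d - 1) G" "F = l * G"
proof -
  obtain W F0 G where F: "\<forall>x. \<exists>y. form_val l y = 0 \<and> (\<forall>m\<in>W. y $ m = x $ m)" "form_in W d F0"
     "form_in UNIV (d - 1) G" "F = F0 + l * G"
    by (rule linear_form_division[OF assms(1,2)])
  have "form_val F0 x = 0" for x
  proof -
    obtain y where y: "form_val l y = 0" "\<forall>m\<in>W. y $ m = x $ m" using F(1) by blast
    have "form_val F0 x = form_val F0 y" using y by (intro form_val_cong[OF F(2)]) auto
    also have "\<dots> = form_val F y" using y by (simp add: F(4))
    finally show ?thesis using assms(3) y by (simp add: vanishes_on_def)
  qed
  then have "F0 = 0" by (rule form_zero_if_vanishes)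
  then show ?thesis using that F by simp
qed

lemma dvd_vanishes_on: "l dvd F \<Longrightarrow> vanishes_on l F"
  by (auto simp: vanishes_on_def dvd_def)

text \<open>Modulo \<open>l\<close> both forms can be written in the two variables that are free on the plane \<open>l = 0\<close>; then their product is zero as a polynomial.\<close>

lemma vanishes_on_mult:
  assumes l: "l \<in> forms 1" and F: "form_in UNIV d F" and G: "form_in UNIV e G" and FG: "vanishes_on l (F * G)"
  shows "vanishes_on l F \<or> vanishes_on l G"
proof -
  obtain i j k a r where lr: "i \<noteq> j" "i \<noteq> k" "j \<noteq> k" "UNIV = {i, j, k}" "UNIV - {i} = {j, k}" "a \<noteq> 0"
    "form_in {j, k} 1 r" "l = Cst a * (Var i - r)"
    by (rule linear_form_normalised[OF l])
  note lr = lr(5-8)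
  have r: "form_in (UNIV - {i}) 1 r" using lr by simp
  obtain F0 F1 where F1: "form_in (UNIV - {i}) d F0" "F = F0 + (Var i - r) * F1"
    using form_division[OF F UNIV_I r] by blast
  obtain G0 G1 where G1: "form_in (UNIV - {i}) e G0" "G = G0 + (Var i - r) * G1"
    using form_division[OF G UNIV_I r] by blast
  have on: "form_val F y = form_val F0 y" "form_val G y = form_val G0 y" if "form_val l y = 0" for y
    using that lr by (auto simp: F1 G1)
  have "form_val (F0 * G0) x = 0" for x
  proof -
    define y where "y = (\<chi> m. if m = i then form_val r x else x $ m)"
    have "form_val r y = form_val r x" "form_val F0 y = form_val F0 x" "form_val G0 y = form_val G0 x"
      by (auto intro!: form_val_cong[OF r] form_val_cong[OF F1(1)] form_val_cong[OF G1(1)] simp: y_def split: if_splits)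
    moreover from this have "form_val l y = 0" by (simp add: lr y_def)
    ultimately show ?thesis using FG on[of y] by (auto simp: vanishes_on_def)
  qed
  then have "F0 * G0 = 0" by (rule form_zero_if_vanishes)
  then have "F0 = 0 \<or> G0 = 0" by simp
  then show ?thesis using on by (auto simp: vanishes_on_def)
qed

lemma linear_forms_proportional:
  assumes l: "l \<in> forms 1" "l' \<in> forms 1" and "vanishes_on l l'"
  obtains c where "c \<noteq> 0" "l' = Cst c * l"
proof -
  obtain G where G: "form_in UNIV (1 - 1) G" "l' = l * G"
    using vanishes_on_dvd[OF l(1) _ assms(3), of 1] l(2) by (auto simp: forms_iff)
  have "keys G \<subseteq> {0}" using G(1) by (auto simp: form_in_def)
  then have "G = Cst (lookup G 0)"
    unfolding Cst_def by (intro poly_mapping_eqI) (auto simp: lookup_single when_def in_keys_iff)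
  moreover have "lookup G 0 \<noteq> 0"
  proof
    assume "lookup G 0 = 0"
    then have "l' = 0" using G(2) \<open>G = _\<close> by (simp add: hom_zero[OF semiring_hom_Cst])
    then show False using l(2) by (simp add: forms_def)
  qed
  ultimately show ?thesis using that[of "lookup G 0"] G(2) by (metis mult.commute)
qed

section \<open>Singular points and intersection numbers\<close>

lemma span_1: "x \<in> vec.span {p} \<longleftrightarrow> (\<exists>c. x = c *s (p :: complex^3))"
  by (auto simp: vec.span_singleton)

lemma proj_plane_E:
  assumes "P \<in> proj_plane" obtains p where "p \<noteq> 0" "P = vec.span {p}"
  using assms by (auto simp: proj_plane_def)

lemma span_in_proj_plane: "p \<noteq> 0 \<Longrightarrow> vec.span {p} \<in> proj_plane"
  by (auto simp: proj_plane_def)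

lemma span_eq_iff:
  assumes "p \<noteq> 0" "q \<noteq> (0 :: complex^3)"
  shows "vec.span {p} = vec.span {q} \<longleftrightarrow> (\<exists>c. c \<noteq> 0 \<and> q = c *s p)"
proof
  assume "vec.span {p} = vec.span {q}"
  then have "q \<in> vec.span {p}" by (simp add: vec.span_base)
  then obtain c where "q = c *s p" by (auto simp: span_1)
  then show "\<exists>c. c \<noteq> 0 \<and> q = c *s p" using assms by (intro exI[of _ c]) auto
next
  assume "\<exists>c. c \<noteq> 0 \<and> q = c *s p"
  then obtain c where c: "c \<noteq> 0" "q = c *s p" by blast
  show "vec.span {p} = vec.span {q}"
  proof (intro set_eqI iffI)
    fix x assume "x \<in> vec.span {p}"
    then obtain d where "x = d *s p" by (auto simp: span_1)
    then have "x = (d / c) *s q" using c by simp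
    then show "x \<in> vec.span {q}" by (auto simp: span_1)
  next
    fix x assume "x \<in> vec.span {q}"
    then obtain d where "x = d *s q" by (auto simp: span_1)
    then have "x = (d * c) *s p" using c by simp
    then show "x \<in> vec.span {p}" by (auto simp: span_1)
  qed
qed

lemma on_curve_span:
  assumes "p \<noteq> 0" "form_in W d F"
  shows "on_curve (vec.span {p}) F \<longleftrightarrow> form_val F p = 0"
proof
  assume "on_curve (vec.span {p}) F"
  then show "form_val F p = 0" using vec.span_base[of p "{p}"] by (auto simp: on_curve_def)
next
  assume "form_val F p = 0"
  then show "on_curve (vec.span {p}) F"
    using assms by (auto simp: on_curve_def span_in_proj_plane span_1 form_val_scale)
qed

lemma line_poly_eqI: "(\<And>t. form_val F (p + t *s v) = poly f t) \<Longrightarrow> line_poly F p v = f"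
  by (rule poly_eq_off_zero[where S = "{}"]) (simp_all add: poly_line_poly)

lemma grad_scale_point:
  assumes F: "form_in W d F" and c: "c \<noteq> 0"
  shows "grad F (c *s p) v = c ^ d * grad F p ((1 / c) *s v)"
proof -
  have "line_poly F (c *s p) v = smult (c ^ d) (line_poly F p ((1 / c) *s v))"
  proof (rule line_poly_eqI)
    fix t
    have "c *s p + t *s v = c *s (p + t *s ((1 / c) *s v))" using c by (simp add: vector_add_ldistrib)
    then show "form_val F (c *s p + t *s v) = poly (smult (c ^ d) (line_poly F p ((1 / c) *s v))) t"
      by (simp only: form_val_scale[OF F] poly_line_poly poly_smult)
  qed
  then show ?thesis by (simp add: grad_def)
qed

lemma singular_points_span:
  assumes p: "p \<noteq> 0" and F: "form_in W d F"
  shows "vec.span {p} \<in> singular_points F \<longleftrightarrow> form_val F p = 0 \<and> (\<forall>v. grad F p v = 0)"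
proof
  assume "vec.span {p} \<in> singular_points F"
  then have "form_val F p = 0" "(form_val F has_derivative (\<lambda>_. 0)) (at p)"
    using on_curve_span[OF p F] p by (auto simp: singular_points_def vec.span_base)
  then show "form_val F p = 0 \<and> (\<forall>v. grad F p v = 0)"
    using has_derivative_unique[OF form_val_has_derivative] by metis
next
  assume *: "form_val F p = 0 \<and> (\<forall>v. grad F p v = 0)"
  have "(form_val F has_derivative (\<lambda>_. 0)) (at x)" if x: "x \<in> vec.span {p} - {0}" for x
  proof -
    obtain c where c: "x = c *s p" using x by (auto simp: span_1)
    then have "c \<noteq> 0" using x by auto
    then have "grad F x = (\<lambda>_. 0)" using c * by (auto simp: grad_scale_point[OF F])
    then show ?thesis using form_val_has_derivative[of F x] by simp
  qed
  then show "vec.span {p} \<in> singular_points F"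
    using * on_curve_span[OF p F] by (simp add: singular_points_def)
qed

lemma smooth_quartic_form: "Q \<in> smooth_quartics \<Longrightarrow> form_in UNIV 4 Q \<and> Q \<noteq> 0"
  by (simp add: smooth_quartics_def forms_iff)

lemma smooth_quartic_grad:
  assumes "Q \<in> smooth_quartics" "p \<noteq> 0" "form_val Q p = 0"
  shows "\<exists>v. grad Q p v \<noteq> 0"
  using singular_points_span[of p UNIV 4 Q] assms smooth_quartic_form[OF assms(1)]
  by (auto simp: smooth_quartics_def)

lemma grad_euler:
  assumes F: "form_in W d F" and "form_val F p = 0"
  shows "grad F p p = 0"
proof -
  have "line_poly F p p = 0"
  proof (rule line_poly_eqI)
    fix t
    have "p + t *s p = (1 + t) *s p" by (simp add: vector_sadd_rdistrib)
    then show "form_val F (p + t *s p) = poly 0 t"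
      using assms(2) by (simp only: form_val_scale[OF F]) simp
  qed
  then show ?thesis by (simp add: grad_def)
qed

lemma order_eqI:
  fixes f g :: "complex poly"
  assumes "f = [:- a, 1:] ^ n * g" "poly g a \<noteq> 0"
  shows "f \<noteq> 0" "order a f = n"
proof -
  have g: "g \<noteq> 0" using assms(2) by auto
  then show f: "f \<noteq> 0" using assms(1) by simp
  show "order a f = n" using order_mult[of "[:- a, 1:] ^ n" g a] f assms
    by (simp add: order_power_n_n order_0I)
qed

text \<open>Independence of the order at a point of the parametrization of the line. If \<open>F(x p + y v) = \<Sum> c\<^sub>j x\<^sup>d\<^sup>-\<^sup>j y\<^sup>j\<close>, then
the new polynomial is \<open>\<Sum> c\<^sub>j (\<alpha> + \<beta> t)\<^sup>d\<^sup>-\<^sup>j (\<gamma> t)\<^sup>j\<close>, whose lowest term is a nonzero multiple of the lowest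
nonzero \<open>c\<^sub>j\<close>.\<close>

lemma order_line_poly_change:
  fixes p v :: "complex^3" and \<beta> :: complex
  assumes F: "form_in W d F" and al: "\<alpha> \<noteq> 0" "\<gamma> \<noteq> 0"
  defines "f \<equiv> line_poly F p v" and "f' \<equiv> line_poly F (\<alpha> *s p) (\<beta> *s p + \<gamma> *s v)"
  shows "f' = 0 \<longleftrightarrow> f = 0" "order 0 f' = order 0 f"
proof -
  have eq: "f' = (\<Sum>j\<le>d. smult (coeff f j * \<gamma> ^ j) ([:\<alpha>, \<beta>:] ^ (d - j) * monom 1 j))"
    unfolding f'_def
  proof (rule line_poly_eqI)
    fix t
    have "\<alpha> *s p + t *s (\<beta> *s p + \<gamma> *s v) = (\<alpha> + t * \<beta>) *s p + (t * \<gamma>) *s v"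
      by (simp add: vector_add_ldistrib vector_sadd_rdistrib)
    then have "form_val F (\<alpha> *s p + t *s (\<beta> *s p + \<gamma> *s v))
        = (\<Sum>j\<le>d. coeff f j * (\<alpha> + t * \<beta>) ^ (d - j) * (t * \<gamma>) ^ j)"
      by (simp only: form_val_on_line[OF F] f_def)
    then show "form_val F (\<alpha> *s p + t *s (\<beta> *s p + \<gamma> *s v)) =
        poly (\<Sum>j\<le>d. smult (coeff f j * \<gamma> ^ j) ([:\<alpha>, \<beta>:] ^ (d - j) * monom 1 j)) t"
      by (simp add: poly_sum poly_monom power_mult_distrib mult_ac)
  qed
  have "f' \<noteq> 0 \<and> order 0 f' = order 0 f" if nz: "f \<noteq> 0"
  proof -
    define e where "e = order 0 f"
    obtain g where g: "f = [:0, 1:] ^ e * g" "\<not> [:0, 1:] dvd g"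
      using order_decomp[OF nz, of 0] by (auto simp: e_def)
    have fg: "f = monom 1 e * g" using g(1) by (simp add: monom_altdef)
    have g0: "coeff g 0 \<noteq> 0" using g(2) poly_eq_0_iff_dvd[of g 0] by (simp add: poly_0_coeff_0)
    have cf: "coeff f j = (if j < e then 0 else coeff g (j - e))" for j
      by (simp add: fg coeff_monom_mult)
    have "coeff f e \<noteq> 0" using g0 by (simp add: cf)
    then have ed: "e \<le> d" using degree_line_poly[OF F, of p v] le_degree[of f e] by (simp add: f_def)
    define h where "h = (\<Sum>j\<in>{e..d}. smult (coeff f j * \<gamma> ^ j) ([:\<alpha>, \<beta>:] ^ (d - j) * monom 1 (j - e)))"
    have "f' = (\<Sum>j\<in>{e..d}. smult (coeff f j * \<gamma> ^ j) ([:\<alpha>, \<beta>:] ^ (d - j) * monom 1 j))"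
      unfolding eq by (rule sum.mono_neutral_right) (auto simp: cf)
    also have "\<dots> = monom 1 e * h"
      unfolding h_def sum_distrib_left
      by (intro sum.cong refl) (simp add: mult_monom mult.left_commute[of "monom 1 e"])
    also have "\<dots> = [:- 0, 1:] ^ e * h" by (simp add: monom_altdef)
    finally have 1: "f' = [:- 0, 1:] ^ e * h" .
    have "poly h 0 = (\<Sum>j\<in>{e..d}. if j = e then coeff f e * \<gamma> ^ e * \<alpha> ^ (d - e) else 0)"
      unfolding h_def poly_sum by (intro sum.cong) (auto simp: poly_monom)
    then have "poly h 0 \<noteq> 0" using ed al \<open>coeff f e \<noteq> 0\<close> by simp
    from order_eqI[OF 1 this] show ?thesis by (simp add: e_def)
  qed
  moreover have "f' = 0" if "f = 0" unfolding eq that by simp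
  ultimately show "f' = 0 \<longleftrightarrow> f = 0" "order 0 f' = order 0 f" by (cases "f = 0"; simp)+
qed

text \<open>The intersection number is defined by an arbitrary choice of a basis of the plane; every basis whose first vector spans the point gives the same order.\<close>

lemma intersection_number_basis:
  assumes F: "form_in W d F" and l: "l \<in> forms 1" and p: "p \<noteq> 0"
    and pv: "{x. form_val l x = 0} = vec.span {p, v}"
  shows "intersection_number F l (vec.span {p}) =
     (if line_poly F p v = 0 then \<infinity> else enat (order 0 (line_poly F p v)))"
proof -
  let ?good = "\<lambda>(p', v'). vec.span {p'} = vec.span {p} \<and> vec.span {p', v'} = {x. form_val l x = 0}"
  obtain p' v' where lp: "line_param l (vec.span {p}) = (p', v')" by (cases "line_param l (vec.span {p})")
  have "?good (p, v)" using pv by simp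
  then have "?good (line_param l (vec.span {p}))" unfolding line_param_def by (rule someI)
  then have good: "vec.span {p'} = vec.span {p}" "vec.span {p', v'} = vec.span {p, v}" using lp pv by auto
  have "p' \<noteq> 0"
  proof
    assume "p' = 0"
    then have "vec.span {p} = {0}" using good(1) by simp
    then show False using p vec.span_base[of p "{p}"] by simp
  qed
  then obtain \<alpha> where al: "\<alpha> \<noteq> 0" "p' = \<alpha> *s p" using span_eq_iff[OF p, of p'] good(1) by auto
  have "v' \<in> vec.span {p, v}" using good(2) vec.span_base[of v' "{p', v'}"] by simp
  then obtain \<beta> \<gamma> where v': "v' = \<beta> *s p + \<gamma> *s v" by (auto simp: span_pair)
  have ga: "\<gamma> \<noteq> 0"
  proof
    assume "\<gamma> = 0"
    then have "v' \<in> vec.span {p}" "p' \<in> vec.span {p}" using v' al by (auto simp: span_1)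
    then have "vec.span {p', v'} \<subseteq> vec.span {p}" by (intro vec.span_minimal vec.subspace_span) auto
    then show False using plane_dim_2[OF l, of p] pv good(2) by simp
  qed
  show ?thesis
    unfolding intersection_number_def lp
    by (simp add: al(2) v' line_poly_def[symmetric] Let_def order_line_poly_change[OF F al(1) ga])
qed

lemma linear_form_prescribed:
  assumes "v \<noteq> 0" "p \<notin> vec.span {v}"
  obtains m where "form_in UNIV 1 m" "form_val m v = \<alpha>" "form_val m p = \<beta>"
proof -
  obtain i where i: "v $ i \<noteq> 0" using assms(1) by (auto simp: vec_eq_iff)
  define z where "z = Cst (1 / v $ i) * Var i"
  have z: "form_in UNIV 1 z" unfolding z_def by (intro form_in_smult form_in_Var UNIV_I)
  have zv: "form_val z v = 1" using i by (simp add: z_def)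
  have "p - form_val z p *s v \<noteq> 0"
    using assms(2) by (auto simp: span_1)
  then obtain k where k: "p $ k - form_val z p * v $ k \<noteq> 0" by (auto simp: vec_eq_iff)
  define w where "w = Var k - Cst (v $ k) * z"
  have w: "form_in UNIV 1 w" unfolding w_def by (intro form_in_diff form_in_smult form_in_Var UNIV_I z)
  have wv: "form_val w v = 0" "form_val w p \<noteq> 0" using zv k by (simp_all add: w_def mult.commute)
  define m where "m = Cst \<alpha> * z + Cst ((\<beta> - \<alpha> * form_val z p) / form_val w p) * w"
  have "form_in UNIV 1 m" unfolding m_def by (intro form_in_add form_in_smult z w)
  moreover have "form_val m v = \<alpha>" "form_val m p = \<beta>" unfolding m_def using zv wv by simp_all
  ultimately show ?thesis using that by blast
qed

section \<open>Bitangents\<close>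

lemma plane_basis_independent:
  assumes l: "l \<in> forms 1" and "{x. form_val l x = 0} \<subseteq> vec.span {a, b}"
  shows "a \<noteq> 0" "b \<noteq> 0" "a \<notin> vec.span {b}" "b \<notin> vec.span {a}"
proof -
  have no: "\<not> {a, b} \<subseteq> vec.span {c}" for c
    using vec.span_minimal[OF _ vec.subspace_span, of "{a, b}" "{c}"] plane_dim_2[OF l, of c] assms(2) by blast
  show "a \<noteq> 0" "b \<noteq> 0" using no[of b] no[of a] by (auto simp: vec.span_zero vec.span_base)
  show "a \<notin> vec.span {b}" "b \<notin> vec.span {a}" using no[of b] no[of a] by (auto simp: vec.span_base)
qed

lemma even_order_quartic:
  fixes f :: "complex poly"
  assumes deg: "degree f = 4" and ev: "\<And>t. even (order t f)"
  obtains c s t where "c \<noteq> 0" "f = smult c (([:- s, 1:] * [:- t, 1:]) ^ 2)"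
proof -
  have f0: "f \<noteq> 0" using deg by auto
  have root: "\<exists>z. poly h z = 0" if "degree h > 0" for h :: "complex poly"
    using fundamental_theorem_of_algebra[of h] that by (simp add: constant_degree)
  have ge2: "2 \<le> n" if "even n" "n \<noteq> 0" for n :: nat using that by presburger
  obtain s where s: "poly f s = 0" using root deg by fastforce
  then have "order s f \<noteq> 0" using f0 order_root by blast
  then have "2 \<le> order s f" using ev ge2 by blast
  then have "[:- s, 1:] ^ 2 dvd f" using order_divides f0 by blast
  then obtain g where g: "f = [:- s, 1:] ^ 2 * g" by blast
  then have g0: "g \<noteq> 0" using f0 by auto
  have "degree f = 2 + degree g" unfolding g using g0 by (simp add: degree_mult_eq degree_power_eq)
  then have dg: "degree g = 2" using deg by simp
  obtain t where t: "poly g t = 0" using root dg by fastforce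
  have "order t f = order t ([:- s, 1:] ^ 2) + order t g" using order_mult f0 g by metis
  moreover have "even (order t ([:- s, 1:] ^ 2))"
  proof (cases "s = t")
    case True then show ?thesis by (simp add: order_power_n_n)
  next
    case False then show ?thesis by (simp add: order_0I)
  qed
  ultimately have "even (order t g)" using ev[of t] by simp
  moreover have "order t g \<noteq> 0" using t g0 order_root by blast
  ultimately have "2 \<le> order t g" using ge2 by blast
  then have "[:- t, 1:] ^ 2 dvd g" using order_divides g0 by blast
  then obtain h where h: "g = [:- t, 1:] ^ 2 * h" by blast
  then have h0: "h \<noteq> 0" using g0 by auto
  have "degree g = 2 + degree h" unfolding h using h0 by (simp add: degree_mult_eq degree_power_eq)
  then obtain c where c: "h = [:c:]" using dg by (auto elim: degree_eq_zeroE)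
  have "f = smult c (([:- s, 1:] * [:- t, 1:]) ^ 2)" unfolding g h c
    by (simp only: power_mult_distrib) (simp add: mult_ac)
  moreover have "c \<noteq> 0" using c h0 by auto
  ultimately show ?thesis using that by blast
qed

text \<open>On a bitangent the quartic restricts to a constant times the square of a product of two linear forms,
because all its roots on the line have even multiplicity.\<close>

lemma bitangent_on_line:
  assumes Q: "form_in UNIV 4 Q" and b: "bitangent Q l"
  obtains v p c s t where "{x. form_val l x = 0} = vec.span {v, p}" "v \<noteq> 0" "p \<notin> vec.span {v}" "c \<noteq> 0"
    "\<forall>x y. form_val Q (x *s v + y *s p) = c * ((y - s * x) * (y - t * x)) ^ 2"
proof -
  have l: "l \<in> forms 1" using b by (simp add: bitangent_def)
  then have lf: "form_in UNIV 1 l" by (simp add: forms_iff)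
  have even_int: "\<exists>k. (if line_poly Q p v = 0 then \<infinity> else enat (order 0 (line_poly Q p v))) = enat (2 * k)"
    if "p \<noteq> 0" "{x. form_val l x = 0} = vec.span {p, v}" for p v
  proof -
    have "form_val l p = 0" using that(2) vec.span_base[of p "{p, v}"] by auto
    then have "on_curve (vec.span {p}) l" using on_curve_span[OF that(1) lf] by simp
    then show ?thesis
      using b intersection_number_basis[OF Q l that] unfolding bitangent_def by metis
  qed
  obtain e f where ef: "{x. form_val l x = 0} = vec.span {e, f}" "e \<noteq> 0" "f \<notin> vec.span {e}"
    by (rule exists_plane_basis[OF l])
  have "line_poly Q e f \<noteq> 0" using even_int[OF ef(2,1)] by (auto split: if_splits)
  then obtain \<tau> where \<tau>: "poly (line_poly Q e f) \<tau> \<noteq> 0" using poly_all_0_iff_0 by blast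
  \<comment> \<open>With \<open>p\<close> off the quartic, the affine coordinate on the line has its point at infinity off the quartic, and no root is lost.\<close>
  define p where "p = e + \<tau> *s f"
  have Qp: "form_val Q p \<noteq> 0" using \<tau> by (simp add: p_def poly_line_poly)
  have p0: "p \<noteq> 0" using Qp form_val_scale[OF Q, of 0 p] by auto
  have f0: "f \<noteq> 0" using ef(3) vec.span_zero by blast
  have lef: "form_val l e = 0" "form_val l f = 0"
    using ef(1) vec.span_base[of e "{e, f}"] vec.span_base[of f "{e, f}"] by auto
  have lp: "form_val l p = 0" using lef by (simp add: p_def linear_form_add[OF lf] linear_form_scale[OF lf])
  have pf: "p \<notin> vec.span {f}"
  proof
    assume "p \<in> vec.span {f}"
    then have "p - \<tau> *s f \<in> vec.span {f}" by (intro vec.span_diff vec.span_scale) (simp_all add: vec.span_base)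
    then show False using plane_basis_independent(3)[OF l, of e f] ef(1) by (simp add: p_def)
  qed
  have fp: "{x. form_val l x = 0} = vec.span {f, p}" by (rule plane_basis_complete[OF l f0 lef(2) lp pf])
  define g where "g = line_poly Q f p"
  have c4: "coeff g 4 = form_val Q p"
    using form_val_on_line[OF Q, of 0 f 1 p] by (simp add: g_def eval_nat_numeral)
  have deg: "degree g = 4"
    using degree_line_poly[OF Q, of f p] le_degree[of g 4] c4 Qp by (auto simp: g_def)
  have "even (order t g)" for t
  proof -
    have g0: "g \<noteq> 0" using deg by auto
    obtain h where h: "g = [:- t, 1:] ^ order t g * h" "\<not> [:- t, 1:] dvd h"
      using order_decomp[OF g0, of t] by auto
    have np: "p \<notin> vec.span {f + t *s p}"
    proof
      assume p: "p \<in> vec.span {f + t *s p}"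
      then have "f + t *s p - t *s p \<in> vec.span {f + t *s p}"
        by (intro vec.span_diff vec.span_scale) (simp_all add: vec.span_base)
      then have "vec.span {f, p} \<subseteq> vec.span {f + t *s p}" using p by (intro vec.span_minimal vec.subspace_span) auto
      then show False using plane_dim_2[OF l] fp by simp
    qed
    have nz: "f + t *s p \<noteq> 0"
    proof
      assume "f + t *s p = 0"
      then have "f = (- t) *s p" by (simp add: eq_neg_iff_add_eq_0)
      then have "f \<in> vec.span {p}" unfolding span_1 by blast
      then show False using plane_basis_independent(3)[OF l, of f p] fp by simp
    qed
    have "form_val l (f + t *s p) = 0" using lef lp by (simp add: linear_form_add[OF lf] linear_form_scale[OF lf])
    then have "{x. form_val l x = 0} = vec.span {f + t *s p, p}"
      using plane_basis_complete[OF l nz _ lp np] by simp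
    from even_int[OF nz this] obtain k where k: "line_poly Q (f + t *s p) p \<noteq> 0"
      "order 0 (line_poly Q (f + t *s p) p) = 2 * k" by (auto split: if_splits)
    have pcp: "pcompose (q ^ n) r = pcompose q r ^ n" for q r :: "complex poly" and n
      by (induction n) (simp_all add: pcompose_mult pcompose_1)
    have "line_poly Q (f + t *s p) p = pcompose g [:t, 1:]"
    proof (rule line_poly_eqI)
      fix u
      have "f + t *s p + u *s p = f + (t + u) *s p" by (simp add: vector_sadd_rdistrib add.assoc)
      then show "form_val Q (f + t *s p + u *s p) = poly (g \<circ>\<^sub>p [:t, 1:]) u"
        by (simp add: poly_pcompose g_def poly_line_poly vector_sadd_rdistrib add.assoc)
    qed
    also have "\<dots> = pcompose [:- t, 1:] [:t, 1:] ^ order t g * pcompose h [:t, 1:]"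
      by (subst h(1)) (simp add: pcompose_mult pcp)
    also have "pcompose [:- t, 1:] [:t, 1:] = [:- 0, 1:]" by (simp add: pcompose_pCons)
    finally have "line_poly Q (f + t *s p) p = [:- 0, 1:] ^ order t g * pcompose h [:t, 1:]" .
    moreover have "poly (pcompose h [:t, 1:]) 0 \<noteq> 0" using h(2) by (simp add: poly_pcompose poly_eq_0_iff_dvd)
    ultimately have "order 0 (line_poly Q (f + t *s p) p) = order t g" by (rule order_eqI)
    then show ?thesis using k by presburger
  qed
  then obtain c s t where c: "c \<noteq> 0" "g = smult c (([:- s, 1:] * [:- t, 1:]) ^ 2)"
    by (rule even_order_quartic[OF deg])
  have "form_val Q (x *s f + y *s p) = c * ((y - s * x) * (y - t * x)) ^ 2" for x y
  proof (cases "x = 0")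
    case False
    have "x *s f + y *s p = x *s (f + (y / x) *s p)" using False by (simp add: vector_add_ldistrib)
    then have "form_val Q (x *s f + y *s p) = x ^ 4 * poly g (y / x)"
      by (simp only: form_val_scale[OF Q] poly_line_poly g_def)
    also have "poly g u = c * ((u - s) * (u - t)) ^ 2" for u by (simp add: c(2) algebra_simps)
    also have "x ^ 4 * (c * ((y / x - s) * (y / x - t)) ^ 2) = c * ((x * (y / x - s)) * (x * (y / x - t))) ^ 2"
      by (simp only: power_mult_distrib power2_eq_square power4_eq_xxxx mult_ac)
    also have "x * (y / x - s) = y - s * x" using False by (simp add: field_simps)
    also have "x * (y / x - t) = y - t * x" using False by (simp add: field_simps)
    finally show ?thesis .
  next
    case True
    have "lead_coeff g = c"
      unfolding c(2) by (simp only: lead_coeff_smult lead_coeff_power lead_coeff_mult) simp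
    then have "coeff g 4 = c" using deg by simp
    then show ?thesis using True c4 by (simp add: form_val_scale[OF Q] power_mult_distrib power2_eq_square power4_eq_xxxx)
  qed
  then show ?thesis using that[OF fp f0 pf c(1)] by blast
qed

section \<open>Families of special quartics\<close>

text \<open>The dimension count for a set of quartics given as a polynomial expression in finitely many forms of
prescribed degrees in prescribed variables; the parameters are the coefficients of these forms. The
expression \<open>\<Psi>\<close> may use only finitely many of the forms, so all others are set to 0.\<close>

lemma negligible_forms:
  fixes W :: "nat \<Rightarrow> 3 set" and d :: "nat \<Rightarrow> nat" and \<Psi> :: "(nat \<Rightarrow> 3 mpoly) \<Rightarrow> 3 mpoly"
  assumes card: "(\<Sum>j<n. card (exps (W j) (d j))) \<le> 14"
    and fam: "\<And>A (\<Phi> :: nat \<Rightarrow> (nat \<times> (3 \<Rightarrow>\<^sub>0 nat) \<Rightarrow> complex) \<Rightarrow> 3 mpoly).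
      (\<And>j. poly_family A (\<Phi> j)) \<Longrightarrow> poly_family A (\<lambda>x. \<Psi> (\<lambda>j. \<Phi> j x))"
    and scale: "\<And>Q t. Q \<in> S \<Longrightarrow> t \<noteq> 0 \<Longrightarrow> Cst t * Q \<in> S"
    and img: "\<And>Q. Q \<in> S \<Longrightarrow> \<exists>F. (\<forall>j<n. form_in (W j) (d j) (F j)) \<and> (\<forall>j\<ge>n. F j = 0) \<and> Q = \<Psi> F"
  shows "negligible S"
proof (rule negligible_image)
  define A where "A = (SIGMA j:{..<n}. exps (W j) (d j))"
  define \<Phi> where "\<Phi> j x = (if j < n then \<Sum>m\<in>exps (W j) (d j). single m (x (j, m)) else 0)"
    for j and x :: "nat \<times> (3 \<Rightarrow>\<^sub>0 nat) \<Rightarrow> complex"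
  show "finite A" "card A \<le> 14" using card by (auto simp: A_def)
  show "poly_family A (\<lambda>x. \<Psi> (\<lambda>j. \<Phi> j x))"
  proof (rule fam)
    fix j
    show "poly_family A (\<Phi> j)"
      unfolding \<Phi>_def[abs_def]
      by (cases "j < n") (auto intro: poly_family_const poly_family_sum poly_family_single)
  qed
  fix Q assume "Q \<in> S"
  then obtain F where F: "\<forall>j<n. form_in (W j) (d j) (F j)" "\<forall>j\<ge>n. F j = 0" "Q = \<Psi> F" using img by blast
  define x where "x = (\<lambda>(j, m). if (j, m) \<in> A then lookup (F j) m else 0)"
  have "\<Phi> j x = F j" for j
  proof (cases "j < n")
    case True
    then have "\<Phi> j x = (\<Sum>m\<in>exps (W j) (d j). single m (lookup (F j) m))"
      by (auto simp: \<Phi>_def x_def A_def intro!: sum.cong)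
    also have "\<dots> = F j" using F(1) True
      by (intro form_in_sum_single[symmetric]) (auto simp: exps_def[symmetric])
    finally show ?thesis .
  next
    case False
    then show ?thesis using F(2) by (simp add: \<Phi>_def)
  qed
  then have "Q = \<Psi> (\<lambda>j. \<Phi> j x)" using F(3) by simp
  moreover have "\<forall>i. i \<notin> A \<longrightarrow> x i = 0" by (auto simp: x_def)
  ultimately show "\<exists>x. (\<forall>i. i \<notin> A \<longrightarrow> x i = 0) \<and> Q = \<Psi> (\<lambda>j. \<Phi> j x)" by blast
qed (rule scale)

lemma card_exps_1: "card (exps {i} d) \<le> 1"
proof -
  have "exps {i} d \<subseteq> {single i d}"
  proof
    fix m assume m: "m \<in> exps {i} d"
    then have d: "lookup m i = d" "keys m \<subseteq> {i}"
      using monom_deg_superset[of "{i}" m] by (auto simp: exps_def)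
    then have "m = single i d" by (intro poly_mapping_eqI) (auto simp: lookup_single when_def in_keys_iff)
    then show "m \<in> {single i d}" by simp
  qed
  then have "card (exps {i} d) \<le> card {single i d}" by (intro card_mono) auto
  then show ?thesis by simp
qed

lemma lessThan_sum_simps:
  "(\<Sum>j<2. f j) = f 0 + f (1::nat)" "(\<Sum>j<3. f j) = f 0 + f 1 + f (2::nat)"
  "(\<Sum>j<4. f j) = f 0 + f 1 + f 2 + f (3::nat)"
  "(\<Sum>j<5. f j) = f 0 + f 1 + f 2 + f 3 + f (4::nat)" for f :: "nat \<Rightarrow> nat"
  by (simp_all add: eval_nat_numeral)

lemma negligible_products:
  assumes "card (exps UNIV a) + card (exps UNIV b) \<le> 14"
  shows "negligible {G * H | G H. form_in UNIV a G \<and> form_in UNIV b H}"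
proof (rule negligible_forms[where n = 2 and W = "\<lambda>_. UNIV" and d = "\<lambda>j. [a, b] ! j" and \<Psi> = "\<lambda>F. F 0 * F 1"])
  show "(\<Sum>j<2. card (exps UNIV ([a, b] ! j))) \<le> 14" using assms by (simp add: lessThan_sum_simps)
next
  fix Q t assume "Q \<in> {G * H | G H. form_in UNIV a G \<and> form_in UNIV b H}" "t \<noteq> (0::complex)"
  then obtain G H where "form_in UNIV a G" "form_in UNIV b H" "Q = G * H" by blast
  then show "Cst t * Q \<in> {G * H | G H. form_in UNIV a G \<and> form_in UNIV b H}"
    by (intro CollectI exI[of _ "Cst t * G"] exI[of _ H]) (simp add: form_in_smult mult.assoc)
next
  fix Q assume "Q \<in> {G * H | G H. form_in UNIV a G \<and> form_in UNIV b H}"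
  then obtain G H where "form_in UNIV a G" "form_in UNIV b H" "Q = G * H" by blast
  then show "\<exists>F. (\<forall>j<2. form_in UNIV ([a, b] ! j) (F j)) \<and> (\<forall>j\<ge>2. F j = 0) \<and> Q = F 0 * F 1"
    by (intro exI[of _ "\<lambda>j. if j = 0 then G else if j = 1 then H else 0"]) (auto simp: less_2_cases_iff)
qed (intro poly_family_mult)

text \<open>Quartics with a line \<open>X\<^sub>i = r\<close> of fourfold contact; the form \<open>m\<close> matters only on this line and so needs only two variables. There are 2 + 2 + 10 parameters.\<close>

definition hyperflex_quartics :: "3 \<Rightarrow> 3 \<Rightarrow> 3 \<Rightarrow> 3 mpoly set" where
  "hyperflex_quartics i j k = {m ^ 4 + (Var i - r) * C | m r C.
     form_in {j, k} 1 m \<and> form_in {j, k} 1 r \<and> form_in UNIV 3 C}"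

lemma negligible_hyperflex: "negligible (hyperflex_quartics i j k)"
proof (rule negligible_forms[where n = 3 and W = "\<lambda>n. [{j, k}, {j, k}, UNIV] ! n" and d = "\<lambda>n. [1, 1, 3] ! n"
      and \<Psi> = "\<lambda>F. F 0 ^ 4 + (Var i - F 1) * F 2"])
  show "(\<Sum>n<3. card (exps ([{j, k}, {j, k}, UNIV] ! n) ([1, 1, 3] ! n))) \<le> 14"
    using card_exps_2[of j k 1] by (simp add: lessThan_sum_simps card_exps)
next
  fix Q t assume "Q \<in> hyperflex_quartics i j k" "t \<noteq> (0::complex)"
  then obtain m r C where Q: "form_in {j, k} 1 m" "form_in {j, k} 1 r" "form_in UNIV 3 C" "Q = m ^ 4 + (Var i - r) * C"
    unfolding hyperflex_quartics_def by blast
  obtain s where s: "s ^ 4 = t" using exists_complex_root[of 4 t] by auto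
  have "(Cst t :: 3 mpoly) = Cst s ^ 4" by (simp add: s[symmetric] hom_power[OF semiring_hom_Cst])
  then have "Cst t * Q = (Cst s * m) ^ 4 + (Var i - r) * (Cst t * C)"
    by (simp add: Q power_mult_distrib algebra_simps)
  then show "Cst t * Q \<in> hyperflex_quartics i j k"
    unfolding hyperflex_quartics_def using form_in_smult Q by blast
next
  fix Q assume "Q \<in> hyperflex_quartics i j k"
  then obtain m r C where "form_in {j, k} 1 m" "form_in {j, k} 1 r" "form_in UNIV 3 C" "Q = m ^ 4 + (Var i - r) * C"
    unfolding hyperflex_quartics_def by blast
  then show "\<exists>F. (\<forall>n<3. form_in ([{j, k}, {j, k}, UNIV] ! n) ([1, 1, 3] ! n) (F n)) \<and> (\<forall>n\<ge>3. F n = 0)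
      \<and> Q = F 0 ^ 4 + (Var i - F 1) * F 2"
    by (intro exI[of _ "\<lambda>n. if n < 3 then [m, r, C] ! n else 0"]) (auto simp: numeral_3_eq_3 less_Suc_eq)
qed (intro poly_family_mult poly_family_add poly_family_diff poly_family_power poly_family_const)

text \<open>The lines \<open>X\<^sub>i = r\<close>, \<open>l = 0\<close> and \<open>X\<^sub>i - r + l = 0\<close> are concurrent, and the quartic is a square on each of them.
The scaling of three dependent linear forms is used to make their relation \<open>l\<^sub>1 + l\<^sub>2 = l\<^sub>3\<close> and
the coefficient of \<open>X\<^sub>i\<close> in \<open>l\<^sub>1\<close> equal to 1. There are 6 + 2 + 3 + 3 parameters.\<close>

definition concurrent_quartics :: "3 \<Rightarrow> 3 \<Rightarrow> 3 \<Rightarrow> 3 mpoly set" where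
  "concurrent_quartics i j k = {q ^ 2 + (Var i - r) * l * (Var i - r + l) * m | q r l m.
     form_in UNIV 2 q \<and> form_in {j, k} 1 r \<and> form_in UNIV 1 l \<and> form_in UNIV 1 m}"

lemma negligible_concurrent: "negligible (concurrent_quartics i j k)"
proof (rule negligible_forms[where n = 4 and W = "\<lambda>n. [UNIV, {j, k}, UNIV, UNIV] ! n" and d = "\<lambda>n. [2, 1, 1, 1] ! n"
      and \<Psi> = "\<lambda>F. F 0 ^ 2 + (Var i - F 1) * F 2 * (Var i - F 1 + F 2) * F 3"])
  show "(\<Sum>n<4. card (exps ([UNIV, {j, k}, UNIV, UNIV] ! n) ([2, 1, 1, 1] ! n))) \<le> 14"
    using card_exps_2[of j k 1] card_exps(1) by (simp add: lessThan_sum_simps card_exps(2))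
next
  fix Q t assume "Q \<in> concurrent_quartics i j k" "t \<noteq> (0::complex)"
  then obtain q r l m where Q: "form_in UNIV 2 q" "form_in {j, k} 1 r" "form_in UNIV 1 l" "form_in UNIV 1 m"
    "Q = q ^ 2 + (Var i - r) * l * (Var i - r + l) * m"
    unfolding concurrent_quartics_def by blast
  obtain s where s: "s ^ 2 = t" using exists_complex_root[of 2 t] by auto
  have "(Cst t :: 3 mpoly) = Cst s ^ 2" by (simp add: s[symmetric] hom_power[OF semiring_hom_Cst])
  then have "Cst t * Q = (Cst s * q) ^ 2 + (Var i - r) * l * (Var i - r + l) * (Cst t * m)"
    by (simp add: Q power_mult_distrib algebra_simps)
  then show "Cst t * Q \<in> concurrent_quartics i j k"
    unfolding concurrent_quartics_def using form_in_smult Q by blast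
next
  fix Q assume "Q \<in> concurrent_quartics i j k"
  then obtain q r l m where "form_in UNIV 2 q" "form_in {j, k} 1 r" "form_in UNIV 1 l" "form_in UNIV 1 m"
    "Q = q ^ 2 + (Var i - r) * l * (Var i - r + l) * m"
    unfolding concurrent_quartics_def by blast
  then show "\<exists>F. (\<forall>n<4. form_in ([UNIV, {j, k}, UNIV, UNIV] ! n) ([2, 1, 1, 1] ! n) (F n)) \<and> (\<forall>n\<ge>4. F n = 0)
      \<and> Q = F 0 ^ 2 + (Var i - F 1) * F 2 * (Var i - F 1 + F 2) * F 3"
    by (intro exI[of _ "\<lambda>n. if n < 4 then [q, r, l, m] ! n else 0"]) (auto simp: eval_nat_numeral less_Suc_eq)
qed (intro poly_family_mult poly_family_add poly_family_diff poly_family_power poly_family_const)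

text \<open>Quartics singular at the point where \<open>X\<^sub>j = r\<close> and \<open>X\<^sub>k = s\<close>. In \<open>B\<close> and \<open>C\<close> the variable \<open>X\<^sub>j\<close> can be avoided, as
multiples of \<open>X\<^sub>j - r\<close> are moved to the other terms. There are 1 + 1 + 6 + 3 + 3 parameters.\<close>

definition singular_quartics :: "3 \<Rightarrow> 3 \<Rightarrow> 3 \<Rightarrow> 3 mpoly set" where
  "singular_quartics i j k = {(Var j - r) ^ 2 * A + (Var j - r) * (Var k - s) * B + (Var k - s) ^ 2 * C | r s A B C.
     form_in {i} 1 r \<and> form_in {i} 1 s \<and> form_in UNIV 2 A \<and> form_in {i, k} 2 B \<and> form_in {i, k} 2 C}"

lemma negligible_singular: "negligible (singular_quartics i j k)"
proof (rule negligible_forms[where n = 5 and W = "\<lambda>n. [{i}, {i}, UNIV, {i, k}, {i, k}] ! n" and d = "\<lambda>n. [1, 1, 2, 2, 2] ! n"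
      and \<Psi> = "\<lambda>F. (Var j - F 0) ^ 2 * F 2 + (Var j - F 0) * (Var k - F 1) * F 3 + (Var k - F 1) ^ 2 * F 4"])
  show "(\<Sum>n<5. card (exps ([{i}, {i}, UNIV, {i, k}, {i, k}] ! n) ([1, 1, 2, 2, 2] ! n))) \<le> 14"
    using card_exps_2[of i k 2] card_exps_1[of i 1] card_exps(2) by (simp add: lessThan_sum_simps eval_nat_numeral)
next
  fix Q t assume "Q \<in> singular_quartics i j k" "t \<noteq> (0::complex)"
  then obtain r s A B C where Q: "form_in {i} 1 r" "form_in {i} 1 s" "form_in UNIV 2 A" "form_in {i, k} 2 B"
    "form_in {i, k} 2 C" "Q = (Var j - r) ^ 2 * A + (Var j - r) * (Var k - s) * B + (Var k - s) ^ 2 * C"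
    unfolding singular_quartics_def by blast
  have "Cst t * Q = (Var j - r) ^ 2 * (Cst t * A) + (Var j - r) * (Var k - s) * (Cst t * B) + (Var k - s) ^ 2 * (Cst t * C)"
    by (simp add: Q algebra_simps)
  then show "Cst t * Q \<in> singular_quartics i j k"
    unfolding singular_quartics_def using form_in_smult Q by blast
next
  fix Q assume "Q \<in> singular_quartics i j k"
  then obtain r s A B C where "form_in {i} 1 r" "form_in {i} 1 s" "form_in UNIV 2 A" "form_in {i, k} 2 B"
    "form_in {i, k} 2 C" "Q = (Var j - r) ^ 2 * A + (Var j - r) * (Var k - s) * B + (Var k - s) ^ 2 * C"
    unfolding singular_quartics_def by blast
  then show "\<exists>F. (\<forall>n<5. form_in ([{i}, {i}, UNIV, {i, k}, {i, k}] ! n) ([1, 1, 2, 2, 2] ! n) (F n)) \<and> (\<forall>n\<ge>5. F n = 0)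
      \<and> Q = (Var j - F 0) ^ 2 * F 2 + (Var j - F 0) * (Var k - F 1) * F 3 + (Var k - F 1) ^ 2 * F 4"
    by (intro exI[of _ "\<lambda>n. if n < 5 then [r, s, A, B, C] ! n else 0"]) (auto simp: eval_nat_numeral less_Suc_eq)
qed (intro poly_family_mult poly_family_add poly_family_diff poly_family_power poly_family_const)

text \<open>Repeated division by the two linear forms through the point is a Taylor expansion of \<open>Q\<close>. The remainders
of degree 0 and 1 are forms in \<open>X\<^sub>i\<close> alone, with coefficients the value and the two partial derivatives of
\<open>Q\<close> at the point.\<close>

lemma singular_quartic_in_family:
  assumes Q: "Q \<in> forms 4" and sing: "singular_points Q \<noteq> {}"
  shows "\<exists>i j k. Q \<in> singular_quartics i j k"
proof -
  have Q4: "form_in UNIV 4 Q" using Q by (simp add: forms_iff)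
  obtain P where P: "P \<in> singular_points Q" using sing by blast
  then obtain p0 where p0: "p0 \<noteq> 0" "P = vec.span {p0}"
    by (auto simp: singular_points_def on_curve_def proj_plane_def)
  obtain i where i: "p0 $ i \<noteq> 0" using p0(1) by (auto simp: vec_eq_iff)
  define p where "p = (1 / p0 $ i) *s p0"
  have pi: "p $ i = 1" using i by (simp add: p_def)
  then have p: "p \<noteq> 0" by auto
  have "vec.span {p0} = vec.span {p}" using span_eq_iff[OF p0(1) p] i by (auto simp: p_def intro!: exI[of _ "1 / p0 $ i"])
  then have Qp: "form_val Q p = 0" "\<And>v. grad Q p v = 0"
    using singular_points_span[OF p Q4] P p0 by auto
  obtain j k where ijk: "i \<noteq> j" "i \<noteq> k" "j \<noteq> k" "UNIV = {i, j, k}" "UNIV - {i} = {j, k}" by (rule coordinates_3[of i])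
  have Uj: "UNIV - {j} = {i, k}" using ijk by auto
  have ik: "{i, k} - {k} = {i}" using ijk by auto
  define r where "r = Cst (p $ j) * Var i"
  define s where "s = Cst (p $ k) * Var i"
  have rs: "form_in {i} 1 r" "form_in {i} 1 s" unfolding r_def s_def by (intro form_in_smult form_in_Var insertI1)+
  have r': "form_in (UNIV - {j}) 1 r" and s': "form_in ({i, k} - {k}) 1 s"
    unfolding Uj ik using rs by (auto intro: form_in_mono)
  obtain F0 G where 1: "form_in {i, k} 4 F0" "form_in UNIV 3 G" "Q = F0 + (Var j - r) * G"
    using form_division[OF Q4 UNIV_I r'] unfolding Uj by auto
  obtain G0 A where 2: "form_in {i, k} 3 G0" "form_in UNIV 2 A" "G = G0 + (Var j - r) * A"
    using form_division[OF 1(2) UNIV_I r'] unfolding Uj by auto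
  obtain F00 F1 where 3: "form_in {i} 4 F00" "form_in {i, k} 3 F1" "F0 = F00 + (Var k - s) * F1"
    using form_division[OF 1(1) _ s'] unfolding ik by auto
  obtain F10 C where 4: "form_in {i} 3 F10" "form_in {i, k} 2 C" "F1 = F10 + (Var k - s) * C"
    using form_division[OF 3(2) _ s'] unfolding ik by auto
  obtain G00 B where 5: "form_in {i} 3 G00" "form_in {i, k} 2 B" "G0 = G00 + (Var k - s) * B"
    using form_division[OF 2(1) _ s'] unfolding ik by auto
  have Qeq: "Q = F00 + (Var k - s) * F10 + (Var k - s) ^ 2 * C + (Var j - r) * G00
      + (Var j - r) * (Var k - s) * B + (Var j - r) ^ 2 * A"
    unfolding 1(3) 2(3) 3(3) 4(3) 5(3) by (simp add: algebra_simps power2_eq_square)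
  have zero: "F = 0" if F: "form_in {i} d F" and Fp: "form_val F p = 0" for F d
  proof (rule form_zero_if_vanishes)
    fix x :: "complex^3"
    have "form_val F x = form_val F ((x $ i) *s p)" by (rule form_val_cong[OF F]) (simp add: pi)
    then show "form_val F x = 0" using Fp by (simp add: form_val_scale[OF F])
  qed
  have yz: "form_val (Var j - r) p = 0" "form_val (Var k - s) p = 0" by (simp_all add: r_def s_def pi)
  have "F00 = 0" using Qp(1) yz by (intro zero[OF 3(1)]) (simp add: Qeq)
  have gdiff: "grad (F - G) p v = grad F p v - grad G p v" for F G v
    using grad_add[of "F - G" G p v] by simp
  have gy: "grad (Var j - r) p (axis j 1) = 1" "grad (Var j - r) p (axis k 1) = 0"
     "grad (Var k - s) p (axis j 1) = 0" "grad (Var k - s) p (axis k 1) = 1"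
    using ijk(1-3) by (simp_all add: gdiff r_def s_def axis_def)
  have "grad Q p (axis k 1) = form_val F10 p" "grad Q p (axis j 1) = form_val G00 p"
    using yz gy unfolding Qeq \<open>F00 = 0\<close> power2_eq_square by (simp_all del: form_val_diff add: hom_zero[OF line_poly_hom] grad_def[of 0])
  then have "F10 = 0" "G00 = 0" using Qp(2) zero[OF 4(1)] zero[OF 5(1)] by auto
  then have "Q = (Var j - r) ^ 2 * A + (Var j - r) * (Var k - s) * B + (Var k - s) ^ 2 * C"
    using Qeq \<open>F00 = 0\<close> by simp
  then show ?thesis unfolding singular_quartics_def using rs 2(2) 4(2) 5(2) by blast
qed

lemma form_degree_0_unit:
  assumes "form_in W 0 F" "F \<noteq> 0" shows "F dvd 1"
proof -
  have "keys F \<subseteq> {0}" using assms(1) by (auto simp: form_in_def)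
  then have F: "F = Cst (lookup F 0)"
    unfolding Cst_def by (intro poly_mapping_eqI) (auto simp: lookup_single when_def in_keys_iff)
  have "lookup F 0 \<noteq> 0" using F assms(2) by (auto simp: hom_zero[OF semiring_hom_Cst])
  then have "Cst (lookup F 0) * Cst (1 / lookup F 0) = (1 :: 'a mpoly)"
    by (simp add: hom_mult[OF semiring_hom_Cst, symmetric] hom_one[OF semiring_hom_Cst])
  then show ?thesis using F by (metis dvdI)
qed

lemma total_degree_unit: "F dvd 1 \<Longrightarrow> total_degree (F :: 3 mpoly) = 0"
proof -
  assume "F dvd 1"
  then obtain G where FG: "1 = F * G" by (auto simp: dvd_def)
  have "1 \<in> forms 0" by (simp add: forms_iff)
  then have "total_degree (F * G) = 0" using FG total_degree_form[of 1 0] by simp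
  moreover have "F \<noteq> 0" "G \<noteq> 0" using FG by auto
  ultimately show ?thesis using total_degree_mult[of F G] by simp
qed

text \<open>The factors of a form are forms, and their degrees can only be 1 and 3, or 2 and 2.\<close>

lemma irreducible_quartic:
  assumes Q: "Q \<in> forms 4"
    and "Q \<notin> {G * H | G H. form_in UNIV 1 G \<and> form_in UNIV 3 H}"
    and "Q \<notin> {G * H | G H. form_in UNIV 2 G \<and> form_in UNIV 2 H}"
  shows "irreducible Q"
proof (rule irreducibleI)
  show "Q \<noteq> 0" using Q by (simp add: forms_def)
  show "\<not> Q dvd 1" using total_degree_unit[of Q] total_degree_form[OF Q] by auto
  fix G H assume GH: "Q = G * H"
  have nz: "G \<noteq> 0" "H \<noteq> 0" "G * H \<noteq> 0" "homogeneous 4 (G * H)" using Q GH by (auto simp: forms_def)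
  note h = homogeneous_factors[OF nz(4,3)]
  let ?a = "total_degree G" and ?b = "total_degree H"
  have f: "form_in UNIV ?a G" "form_in UNIV ?b H" using h by (simp_all add: homogeneous_form_in)
  have "?a = 0 \<or> ?b = 0 \<or> (?a = 1 \<and> ?b = 3) \<or> (?a = 3 \<and> ?b = 1) \<or> (?a = 2 \<and> ?b = 2)" using h(3) by presburger
  then have "?a = 0 \<or> ?b = 0" using f assms(2,3) GH mult.commute[of G H]
    by (elim disjE conjE) auto
  then show "G dvd 1 \<or> H dvd 1" using f nz form_degree_0_unit by metis
qed

section \<open>Contacts and concurrency of bitangents\<close>

lemma bitangent_forms: "bitangent Q l \<Longrightarrow> l \<in> forms 1"
  by (simp add: bitangent_def)

lemma forms_1_form_in: "l \<in> forms 1 \<Longrightarrow> form_in UNIV 1 l"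
  by (simp add: forms_iff)

lemma bitangent_square:
  assumes Q: "form_in UNIV 4 Q" and b: "bitangent Q l"
  obtains q where "form_in UNIV 2 q" "vanishes_on l (Q - q ^ 2)"
proof -
  obtain v p c s t where vp: "{x. form_val l x = 0} = vec.span {v, p}" "v \<noteq> 0" "p \<notin> vec.span {v}" "c \<noteq> 0"
    and eq: "\<forall>x y. form_val Q (x *s v + y *s p) = c * ((y - s * x) * (y - t * x)) ^ 2"
    by (rule bitangent_on_line[OF Q b])
  obtain m where m: "form_in UNIV 1 m" "form_val m v = - s" "form_val m p = 1"
    by (rule linear_form_prescribed[OF vp(2,3)])
  obtain n where n: "form_in UNIV 1 n" "form_val n v = - t" "form_val n p = 1"
    by (rule linear_form_prescribed[OF vp(2,3)])
  obtain d where d: "c = d ^ 2" using exists_complex_root[of 2 c] by auto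
  define q where "q = Cst d * (m * n)"
  have "form_in UNIV 2 q" unfolding q_def using form_in_smult[OF form_in_mult[OF m(1) n(1)]] by (simp add: numeral_2_eq_2)
  moreover have "vanishes_on l (Q - q ^ 2)"
    unfolding vanishes_on_def
  proof (intro allI impI)
    fix z assume "form_val l z = 0"
    then have "z \<in> vec.span {v, p}" using vp(1) by auto
    then obtain x y where z: "z = x *s v + y *s p" by (auto simp: span_pair)
    have "form_val m z = y - s * x" "form_val n z = y - t * x"
      using m n by (simp_all add: z linear_form_combination mult.commute)
    then show "form_val (Q - q ^ 2) z = 0" by (simp add: q_def z[symmetric] d eq[folded z] power_mult_distrib)
      (simp add: z eq d power_mult_distrib)
  qed
  ultimately show ?thesis using that by blast
qed

text \<open>Along the bitangent \<open>Q\<close> is a square, so it vanishes to order two where it vanishes.\<close>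

lemma grad_at_contact:
  assumes Q: "form_in UNIV 4 Q" and b: "bitangent Q l" and p: "form_val l p = 0" "form_val Q p = 0" and w: "form_val l w = 0"
  shows "grad Q p w = 0"
proof -
  obtain q where q: "form_in UNIV 2 q" "vanishes_on l (Q - q ^ 2)" by (rule bitangent_square[OF Q b])
  note lf = forms_1_form_in[OF bitangent_forms[OF b]]
  have on: "form_val Q x = form_val q x ^ 2" if "form_val l x = 0" for x
    using q(2) that by (simp add: vanishes_on_def)
  have "line_poly Q p w = line_poly (q * q) p w"
  proof (rule line_poly_eqI)
    fix t
    have "form_val l (p + t *s w) = 0" using p w by (simp add: linear_form_add[OF lf] linear_form_scale[OF lf])
    then show "form_val Q (p + t *s w) = poly (line_poly (q * q) p w) t"
      by (simp add: on poly_line_poly power2_eq_square del: line_poly_mult)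
  qed
  then have "grad Q p w = grad (q * q) p w" by (simp add: grad_def)
  also have "\<dots> = 0" using on[OF p(1)] p(2) by simp
  finally show ?thesis .
qed

lemma vanishes_on_sym:
  assumes "l \<in> forms 1" "l' \<in> forms 1" "vanishes_on l l'" shows "vanishes_on l' l"
proof -
  obtain c where "c \<noteq> 0" "l' = Cst c * l" by (rule linear_forms_proportional[OF assms])
  then show ?thesis by (simp add: vanishes_on_def)
qed

text \<open>A basis of \<open>\<complex>\<^sup>3\<close> adapted to two lines through \<open>p\<close>; the coordinates along \<open>e1\<close> and \<open>e2\<close> are \<open>l2\<close> and \<open>l1\<close>.\<close>

lemma two_lines_basis:
  assumes l: "l1 \<in> forms 1" "l2 \<in> forms 1" and ne: "\<not> vanishes_on l1 l2"
    and p: "p \<noteq> 0" "form_val l1 p = 0" "form_val l2 p = 0"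
  obtains e1 e2 where "form_val l1 e1 = 0" "form_val l2 e1 = 1" "form_val l1 e2 = 1" "form_val l2 e2 = 0"
    "\<forall>x. \<exists>z. x = z *s p + (form_val l2 x *s e1 + form_val l1 x *s e2)"
proof -
  note lf = forms_1_form_in[OF l(1)] forms_1_form_in[OF l(2)]
  obtain x1 where x1: "form_val l1 x1 = 0" "form_val l2 x1 \<noteq> 0" using ne by (auto simp: vanishes_on_def)
  have "\<not> vanishes_on l2 l1" using ne vanishes_on_sym l by blast
  then obtain x2 where x2: "form_val l2 x2 = 0" "form_val l1 x2 \<noteq> 0" by (auto simp: vanishes_on_def)
  define e1 where "e1 = (1 / form_val l2 x1) *s x1"
  define e2 where "e2 = (1 / form_val l1 x2) *s x2"
  have e: "form_val l1 e1 = 0" "form_val l2 e1 = 1" "form_val l1 e2 = 1" "form_val l2 e2 = 0"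
    using x1 x2 by (simp_all add: e1_def e2_def linear_form_scale[OF lf(1)] linear_form_scale[OF lf(2)])
  have "\<exists>z. x = z *s p + (form_val l2 x *s e1 + form_val l1 x *s e2)" for x
  proof -
    define y where "y = x - (form_val l2 x *s e1 + form_val l1 x *s e2)"
    have y: "form_val l1 y = 0" "form_val l2 y = 0"
      by (simp_all add: y_def linear_form_diff[OF lf(1)] linear_form_diff[OF lf(2)]
          linear_form_combination[OF lf(1)] linear_form_combination[OF lf(2)] e)
    have "y \<in> vec.span {p}"
    proof (rule ccontr)
      assume "y \<notin> vec.span {p}"
      then have "{x. form_val l1 x = 0} = vec.span {p, y}"
        by (rule plane_basis_complete[OF l(1) p(1,2) y(1)])
      then have "x1 \<in> vec.span {p, y}" using x1(1) by auto
      then obtain a b where "x1 = a *s p + b *s y" by (auto simp: span_pair)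
      then show False using x1(2) p(3) y(2) by (simp add: linear_form_combination[OF lf(2)])
    qed
    then obtain z where "y = z *s p" by (auto simp: span_1)
    then have "x = z *s p + (form_val l2 x *s e1 + form_val l1 x *s e2)" by (simp add: y_def algebra_simps)
    then show ?thesis by blast
  qed
  then show ?thesis using that e by blast
qed

text \<open>Otherwise the derivative of \<open>Q\<close> at \<open>p\<close> vanishes along both lines, which together span the space, and \<open>p\<close> is singular.\<close>

lemma no_contact_on_two_bitangents:
  assumes Q: "Q \<in> smooth_quartics" and b: "bitangent Q l1" "bitangent Q l2" and ne: "\<not> vanishes_on l1 l2"
    and p: "p \<noteq> 0" "form_val l1 p = 0" "form_val l2 p = 0"
  shows "form_val Q p \<noteq> 0"
proof
  assume Qp: "form_val Q p = 0"
  have Q4: "form_in UNIV 4 Q" using smooth_quartic_form[OF Q] by simp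
  obtain e1 e2 where e: "form_val l1 e1 = 0" "form_val l2 e1 = 1" "form_val l1 e2 = 1" "form_val l2 e2 = 0"
    "\<forall>x. \<exists>z. x = z *s p + (form_val l2 x *s e1 + form_val l1 x *s e2)"
    by (rule two_lines_basis[OF bitangent_forms[OF b(1)] bitangent_forms[OF b(2)] ne p])
  have g: "grad Q p p = 0" "grad Q p e1 = 0" "grad Q p e2 = 0"
    using grad_at_contact[OF Q4 b(1) p(2) Qp p(2)] grad_at_contact[OF Q4 b(1) p(2) Qp e(1)]
      grad_at_contact[OF Q4 b(2) p(3) Qp e(4)] by simp_all
  have "grad Q p x = 0" for x
  proof -
    obtain z where z: "x = z *s p + (form_val l2 x *s e1 + form_val l1 x *s e2)" using e(5) by blast
    show ?thesis by (subst z) (simp add: grad_plus grad_scale g)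
  qed
  then show False using smooth_quartic_grad[OF Q p(1) Qp] by blast
qed

lemma contact_multiplicity_2:
  assumes Q: "form_in UNIV 4 Q" and l: "l \<in> forms 1" and vp: "{x. form_val l x = 0} = vec.span {v, p}"
    and c: "c \<noteq> 0" and eq: "\<forall>x y. form_val Q (x *s v + y *s p) = c * ((y - s * x) * (y - t * x)) ^ 2"
    and st: "s \<noteq> t"
  shows "v + s *s p \<noteq> 0" "form_val l (v + s *s p) = 0" "form_val Q (v + s *s p) = 0"
    "intersection_number Q l (vec.span {v + s *s p}) = 2"
proof -
  note lf = forms_1_form_in[OF l]
  have lvp: "form_val l v = 0" "form_val l p = 0" using vp vec.span_base[of v "{v, p}"] vec.span_base[of p "{v, p}"] by auto
  let ?z = "v + s *s p"
  show lz: "form_val l ?z = 0" using lvp by (simp add: linear_form_add[OF lf] linear_form_scale[OF lf])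
  show "form_val Q ?z = 0" using eq[rule_format, of 1 s] by simp
  have zp: "{x. form_val l x = 0} = vec.span {?z, p}"
  proof (intro set_eqI iffI)
    fix x assume "x \<in> {x. form_val l x = 0}"
    then have "x \<in> vec.span {v, p}" using vp by auto
    then obtain a b where "x = a *s v + b *s p" by (auto simp: span_pair)
    then have "x = a *s ?z + (b - a * s) *s p" by (simp add: vector_add_ldistrib vector_sub_rdistrib)
    then show "x \<in> vec.span {?z, p}" unfolding span_pair by blast
  next
    fix x assume "x \<in> vec.span {?z, p}"
    then obtain a b where x: "x = a *s ?z + b *s p" unfolding span_pair by blast
    have "form_val l x = a * form_val l ?z + b * form_val l p"
      unfolding x by (rule linear_form_combination[OF lf])
    then show "x \<in> {x. form_val l x = 0}" using lz lvp by simp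
  qed
  then show nz: "?z \<noteq> 0" using plane_basis_independent(1)[OF l, of ?z p] by simp
  have "line_poly Q ?z p = [:- 0, 1:] ^ 2 * smult c ([:s - t, 1:] ^ 2)"
  proof (rule line_poly_eqI)
    fix u
    have "?z + u *s p = 1 *s v + (s + u) *s p" by (simp add: vector_sadd_rdistrib add.assoc)
    then have "form_val Q (?z + u *s p) = c * ((s + u - s * 1) * (s + u - t * 1)) ^ 2"
      by (simp only: eq)
    also have "\<dots> = poly ([:- 0, 1:] ^ 2 * smult c ([:s - t, 1:] ^ 2)) u"
      by (simp add: power2_eq_square algebra_simps)
    finally show "form_val Q (?z + u *s p) = poly ([:- 0, 1:] ^ 2 * smult c ([:s - t, 1:] ^ 2)) u" .
  qed
  moreover have "poly (smult c ([:s - t, 1:] ^ 2)) 0 \<noteq> 0" using c st by simp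
  ultimately have "line_poly Q ?z p \<noteq> 0" "order 0 (line_poly Q ?z p) = 2" using order_eqI by blast+
  then show "intersection_number Q l (vec.span {?z}) = 2"
    using intersection_number_basis[OF Q l nz zp] by (simp add: numeral_eq_enat)
qed

lemma distinct_contacts:
  assumes l: "l \<in> forms 1" and vp: "{x. form_val l x = 0} = vec.span {v, p}" and st: "s \<noteq> t"
    and nz: "v + s *s p \<noteq> 0" "v + t *s p \<noteq> 0"
  shows "vec.span {v + s *s p} \<noteq> vec.span {v + t *s p}"
proof
  assume "vec.span {v + s *s p} = vec.span {v + t *s p}"
  then have m: "v + t *s p \<in> vec.span {v + s *s p}" using vec.span_base[of "v + t *s p" "{v + t *s p}"] by simp
  let ?S = "vec.span {v + s *s p}"
  have "v + t *s p - (v + s *s p) \<in> ?S" by (intro vec.span_diff m) (simp add: vec.span_base)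
  also have "v + t *s p - (v + s *s p) = (t - s) *s p" by (simp add: vector_sub_rdistrib)
  finally have "(1 / (t - s)) *s ((t - s) *s p) \<in> ?S" by (rule vec.span_scale)
  moreover have "(1 / (t - s)) *s ((t - s) *s p) = p" using st by (simp only: vector_smult_assoc) simp
  ultimately have p: "p \<in> ?S" by simp
  then have "v + s *s p - s *s p \<in> ?S" by (intro vec.span_diff vec.span_scale) (simp_all add: vec.span_base)
  then have "vec.span {v, p} \<subseteq> ?S" using p by (intro vec.span_minimal vec.subspace_span) auto
  then show False using plane_dim_2[OF l] vp by simp
qed

text \<open>If the two contact points coincide, then \<open>Q\<close> is on the line a fourth power of a linear form \<open>m\<close>, hence \<open>Q\<close> differs from
\<open>m ^ 4\<close> by a multiple of \<open>l\<close>.\<close>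

lemma true_bitangent_contacts:
  assumes Q: "form_in UNIV 4 Q" and b: "bitangent Q l" and tb: "\<exists>i j k. Q \<in> hyperflex_quartics i j k \<Longrightarrow> False"
  obtains P P' where "P \<noteq> P'" "{R. on_curve R Q \<and> on_curve R l} = {P, P'}"
    "intersection_number Q l P = 2" "intersection_number Q l P' = 2"
proof -
  obtain v p c s t where vp: "{x. form_val l x = 0} = vec.span {v, p}" "v \<noteq> 0" "p \<notin> vec.span {v}" "c \<noteq> 0"
    and eq: "\<forall>x y. form_val Q (x *s v + y *s p) = c * ((y - s * x) * (y - t * x)) ^ 2"
    by (rule bitangent_on_line[OF Q b])
  note l = bitangent_forms[OF b]
  note lf = forms_1_form_in[OF l]
  have st: "s \<noteq> t"
  proof
    assume st: "s = t"
    obtain d where d: "c = d ^ 4" using exists_complex_root[of 4 c] by auto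
    obtain m where m: "form_in UNIV 1 m" "form_val m v = - (s * d)" "form_val m p = d"
      by (rule linear_form_prescribed[OF vp(2,3)])
    have on: "form_val Q z = form_val m z ^ 4" if "form_val l z = 0" for z
    proof -
      have "z \<in> vec.span {v, p}" using vp(1) that by auto
      then obtain x y where z: "z = x *s v + y *s p" by (auto simp: span_pair)
      have "form_val m z = d * (y - s * x)"
        using m by (simp add: z linear_form_combination algebra_simps)
      moreover have "form_val Q z = d ^ 4 * ((y - s * x) * (y - s * x)) ^ 2" using eq st d z by simp
      ultimately show ?thesis by (simp add: power_mult_distrib power2_eq_square power4_eq_xxxx)
    qed
    obtain i j k a r where lr: "i \<noteq> j" "i \<noteq> k" "j \<noteq> k" "UNIV = {i, j, k}" "UNIV - {i} = {j, k}" "a \<noteq> 0"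
      "form_in {j, k} 1 r" "l = Cst a * (Var i - r)"
      by (rule linear_form_normalised[OF l])
    obtain m0 m1 where m01: "form_in {j, k} 1 m0" "m = m0 + (Var i - r) * m1"
      using form_division[OF m(1) UNIV_I, of i r] lr by auto
    have "vanishes_on l (Q - m0 ^ 4)"
      unfolding vanishes_on_def
    proof (intro allI impI)
      fix z assume z: "form_val l z = 0"
      then have "form_val m z = form_val m0 z" using lr m01 by auto
      then show "form_val (Q - m0 ^ 4) z = 0" using on[OF z] by simp
    qed
    moreover have m04: "form_in UNIV 1 m0" using m01(1) by (rule form_in_mono) simp
    have "form_in UNIV 4 (m0 ^ 4)" using form_in_power[OF m04, of 4] by simp
    then have "form_in UNIV 4 (Q - m0 ^ 4)" by (rule form_in_diff[OF Q])
    ultimately obtain G where G: "form_in UNIV (4 - 1) G" "Q - m0 ^ 4 = l * G"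
      using vanishes_on_dvd[OF l] by metis
    have "Q = m0 ^ 4 + (Var i - r) * (Cst a * G)" using G(2) lr(8) by (simp add: algebra_simps)
    moreover have "form_in UNIV 3 (Cst a * G)" using form_in_smult[OF G(1)] by simp
    ultimately have "Q \<in> hyperflex_quartics i j k" unfolding hyperflex_quartics_def using m01(1) lr(7) by blast
    then show False using tb by blast
  qed
  have eq': "\<forall>x y. form_val Q (x *s v + y *s p) = c * ((y - t * x) * (y - s * x)) ^ 2"
    using eq by (simp add: mult.commute)
  note s = contact_multiplicity_2[OF Q l vp(1,4) eq st]
  note t = contact_multiplicity_2[OF Q l vp(1,4) eq' st[symmetric]]
  have "{R. on_curve R Q \<and> on_curve R l} = {vec.span {v + s *s p}, vec.span {v + t *s p}}"
  proof (intro set_eqI iffI)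
    fix R assume "R \<in> {R. on_curve R Q \<and> on_curve R l}"
    then have R: "on_curve R Q" "on_curve R l" by auto
    then obtain z where z: "z \<noteq> 0" "R = vec.span {z}" using proj_plane_E by (auto simp: on_curve_def)
    have Qz: "form_val Q z = 0" "form_val l z = 0"
      using R on_curve_span[OF z(1) Q] on_curve_span[OF z(1) lf] z(2) by auto
    then have "z \<in> vec.span {v, p}" using vp(1) by auto
    then obtain x y where xy: "z = x *s v + y *s p" by (auto simp: span_pair)
    have "y = s * x \<or> y = t * x" using Qz(1) eq vp(4) xy by auto
    then have "z = x *s (v + s *s p) \<or> z = x *s (v + t *s p)" using xy by (auto simp: vector_add_ldistrib mult.commute)
    moreover from this have "x \<noteq> 0" using z(1) by auto
    ultimately show "R \<in> {vec.span {v + s *s p}, vec.span {v + t *s p}}"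
      using span_eq_iff[OF s(1) z(1)] span_eq_iff[OF t(1) z(1)] z(2) by auto
  next
    fix R assume "R \<in> {vec.span {v + s *s p}, vec.span {v + t *s p}}"
    then show "R \<in> {R. on_curve R Q \<and> on_curve R l}"
      using on_curve_span[OF s(1) Q] on_curve_span[OF s(1) lf] on_curve_span[OF t(1) Q] on_curve_span[OF t(1) lf] s t by auto
  qed
  then show ?thesis using that distinct_contacts[OF l vp(1) st s(1) t(1)] s(4) t(4) by blast
qed

text \<open>In the basis \<open>p\<close>, \<open>e1\<close>, \<open>e2\<close> the third line is spanned by \<open>p\<close> and \<open>e1 - e2\<close>. The three binary forms have
the same value \<open>c\<close> at \<open>p\<close>, and the relation between the derivatives of \<open>Q\<close> along \<open>e1\<close>, \<open>e2\<close> and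
\<open>e1 - e2\<close>, divided by \<open>2 c\<close>, is the relation between the derivatives of the \<open>q\<^sub>i\<close>. The remaining
coefficient of the conic, that of \<open>l1 l2\<close>, is free on the first two lines and is determined by the third.\<close>

lemma concurrent_lines_conic:
  assumes Q: "form_in UNIV 4 Q" and l: "l1 \<in> forms 1" "l2 \<in> forms 1" "l1 + l2 \<in> forms 1"
    and ne: "\<not> vanishes_on l1 l2"
    and p: "p \<noteq> 0" "form_val l1 p = 0" "form_val l2 p = 0" and Qp: "form_val Q p \<noteq> 0"
    and q: "form_in UNIV 2 q1" "form_in UNIV 2 q2" "form_in UNIV 2 q3"
      "vanishes_on l1 (Q - q1 ^ 2)" "vanishes_on l2 (Q - q2 ^ 2)" "vanishes_on (l1 + l2) (Q - q3 ^ 2)"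
    and norm: "form_val q1 p = c" "form_val q2 p = c" "form_val q3 p = c"
  shows "\<exists>q m. form_in UNIV 2 q \<and> form_in UNIV 1 m \<and> Q = q ^ 2 + l1 * l2 * (l1 + l2) * m"
proof -
  note lf = forms_1_form_in[OF l(1)] forms_1_form_in[OF l(2)] forms_1_form_in[OF l(3)]
  obtain f1 f2 where f: "form_val l1 f1 = 0" "form_val l2 f1 = 1" "form_val l1 f2 = 1" "form_val l2 f2 = 0"
    "\<forall>x. \<exists>z. x = z *s p + (form_val l2 x *s f1 + form_val l1 x *s f2)"
    by (rule two_lines_basis[OF l(1,2) ne p])
  obtain i where i: "p $ i \<noteq> 0" using p(1) by (auto simp: vec_eq_iff)
  define \<zeta> where "\<zeta> = Cst (1 / p $ i) * Var i"
  have z: "form_in UNIV 1 \<zeta>" unfolding \<zeta>_def by (intro form_in_smult form_in_Var UNIV_I)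
  have zp: "form_val \<zeta> p = 1" using i by (simp add: \<zeta>_def)
  \<comment> \<open>Adding multiples of \<open>p\<close> does not change the values of \<open>l1\<close> and \<open>l2\<close>, and makes \<open>\<zeta>\<close> the coordinate along \<open>p\<close>.\<close>
  define e1 where "e1 = f1 - form_val \<zeta> f1 *s p"
  define e2 where "e2 = f2 - form_val \<zeta> f2 *s p"
  have e: "form_val l1 e1 = 0" "form_val l2 e1 = 1" "form_val l1 e2 = 1" "form_val l2 e2 = 0"
    "form_val \<zeta> e1 = 0" "form_val \<zeta> e2 = 0"
    by (simp_all add: e1_def e2_def linear_form_diff[OF lf(1)] linear_form_diff[OF lf(2)] linear_form_scale[OF lf(1)]
       linear_form_scale[OF lf(2)] linear_form_diff[OF z] linear_form_scale[OF z] f p zp)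
  have dec: "\<exists>z. x = z *s p + (form_val l2 x *s e1 + form_val l1 x *s e2)" for x
  proof -
    obtain z where "x = z *s p + (form_val l2 x *s f1 + form_val l1 x *s f2)" using f(5) by blast
    then have "x = (z + form_val l2 x * form_val \<zeta> f1 + form_val l1 x * form_val \<zeta> f2) *s p
         + (form_val l2 x *s e1 + form_val l1 x *s e2)"
      by (simp add: e1_def e2_def vector_ssub_ldistrib vector_sadd_rdistrib algebra_simps)
    then show ?thesis by blast
  qed
  have sq: "form_val Q x = form_val q x ^ 2" if "vanishes_on k (Q - q ^ 2)" "form_val k x = 0" for k q x
    using that by (simp add: vanishes_on_def)
  have cQ: "c ^ 2 = form_val Q p" using sq[OF q(4) p(2)] norm(1) by simp
  then have c: "c \<noteq> 0" using Qp by auto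
  have deriv: "grad Q p e = 2 * c * grad q p e"
    if k: "form_in UNIV 1 k" "form_val k p = 0" "form_val k e = 0" and v: "vanishes_on k (Q - q ^ 2)" "form_val q p = c" for k q e
  proof -
    have "line_poly Q p e = line_poly (q * q) p e"
    proof (rule line_poly_eqI)
      fix t
      have "form_val k (p + t *s e) = 0" using k by (simp add: linear_form_add[OF k(1)] linear_form_scale[OF k(1)])
      then show "form_val Q (p + t *s e) = poly (line_poly (q * q) p e) t"
        by (simp add: sq[OF v(1)] poly_line_poly power2_eq_square del: line_poly_mult)
    qed
    then have "grad Q p e = grad (q * q) p e" by (simp only: grad_def)
    then show ?thesis using v(2) by simp
  qed
  have e3: "form_val (l1 + l2) (e1 - e2) = 0" "form_val (l1 + l2) p = 0"
    using e p by (simp_all add: linear_form_diff[OF lf(1)] linear_form_diff[OF lf(2)])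
  have gm: "grad Q p (e1 - e2) = grad Q p e1 - grad Q p e2"
    using grad_plus[of Q p "e1 - e2" e2] by simp
  have "2 * c * grad q3 p (e1 - e2) = 2 * c * grad q1 p e1 - 2 * c * grad q2 p e2"
    using gm deriv[OF lf(1) p(2) e(1) q(4) norm(1)] deriv[OF lf(2) p(3) e(4) q(5) norm(2)]
      deriv[OF lf(3) e3(2,1) q(6) norm(3)] by simp
  then have b3: "grad q3 p (e1 - e2) = grad q1 p e1 - grad q2 p e2"
    using c by (metis mult_cancel_left mult_eq_0_iff right_diff_distrib zero_neq_numeral)
  have val: "form_val q (z *s p + w *s e) = c * z ^ 2 + grad q p e * z * w + coeff (line_poly q p e) 2 * w ^ 2"
    if "form_in UNIV 2 q" "form_val q p = c" for q z w e
    using form_val_on_line[OF that(1), of z p w e] that(2) by (simp add: numeral_2_eq_2 grad_def)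
  define a1 where "a1 = coeff (line_poly q1 p e1) 2"
  define a2 where "a2 = coeff (line_poly q2 p e2) 2"
  define a3 where "a3 = coeff (line_poly q3 p (e1 - e2)) 2"
  define q where "q = Cst c * (\<zeta> * \<zeta>) + \<zeta> * (Cst (grad q1 p e1) * l2 + Cst (grad q2 p e2) * l1)
     + Cst a1 * (l2 * l2) + Cst a2 * (l1 * l1) + Cst (a1 + a2 - a3) * (l1 * l2)"
  have mult2: "form_in UNIV 2 (F * G)" if "form_in UNIV 1 F" "form_in UNIV 1 G" for F G :: "3 mpoly"
    using form_in_mult[OF that] by (simp add: numeral_2_eq_2)
  have qf: "form_in UNIV 2 q" unfolding q_def by (intro form_in_add form_in_smult mult2 z lf)
  have Qq: "form_in UNIV 4 (Q - q ^ 2)" using form_in_power[OF qf, of 2] by (intro form_in_diff Q) simp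
  have zval: "form_val \<zeta> (z *s p + (u *s e1 + w *s e2)) = z" "form_val l1 (z *s p + (u *s e1 + w *s e2)) = w"
    "form_val l2 (z *s p + (u *s e1 + w *s e2)) = u" for z u w
    using zp e p by (simp_all add: linear_form_add[OF z] linear_form_scale[OF z] linear_form_add[OF lf(1)]
        linear_form_scale[OF lf(1)] linear_form_add[OF lf(2)] linear_form_scale[OF lf(2)])
  have v1: "vanishes_on l1 (Q - q ^ 2)" unfolding vanishes_on_def
  proof (intro allI impI)
    fix x assume x: "form_val l1 x = 0"
    obtain z where z: "x = z *s p + (form_val l2 x *s e1 + 0 *s e2)" using dec[of x] x by auto
    define w where "w = form_val l2 x"
    have "form_val q x = c * z ^ 2 + grad q1 p e1 * z * w + a1 * w ^ 2"
      by (subst z) (simp only: q_def form_val_add form_val_mult form_val_Cst zval, simp add: w_def power2_eq_square)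
    moreover have "form_val q1 x = c * z ^ 2 + grad q1 p e1 * z * w + a1 * w ^ 2"
      by (subst z) (simp add: val[OF q(1) norm(1)] a1_def w_def)
    ultimately show "form_val (Q - q ^ 2) x = 0" using sq[OF q(4) x] by simp
  qed
  have v2: "vanishes_on l2 (Q - q ^ 2)" unfolding vanishes_on_def
  proof (intro allI impI)
    fix x assume x: "form_val l2 x = 0"
    obtain z where z: "x = z *s p + (0 *s e1 + form_val l1 x *s e2)" using dec[of x] x by auto
    define w where "w = form_val l1 x"
    have "form_val q x = c * z ^ 2 + grad q2 p e2 * z * w + a2 * w ^ 2"
      by (subst z) (simp only: q_def form_val_add form_val_mult form_val_Cst zval, simp add: w_def power2_eq_square)
    moreover have "form_val q2 x = c * z ^ 2 + grad q2 p e2 * z * w + a2 * w ^ 2"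
      by (subst z) (simp add: val[OF q(2) norm(2)] a2_def w_def)
    ultimately show "form_val (Q - q ^ 2) x = 0" using sq[OF q(5) x] by simp
  qed
  have v3: "vanishes_on (l1 + l2) (Q - q ^ 2)" unfolding vanishes_on_def
  proof (intro allI impI)
    fix x assume x: "form_val (l1 + l2) x = 0"
    define w where "w = form_val l2 x"
    have w: "form_val l1 x = - w" using x by (simp add: w_def eq_neg_iff_add_eq_0)
    obtain z where z: "x = z *s p + (w *s e1 + (- w) *s e2)" using dec[of x] w by (auto simp: w_def)
    have "form_val q x = c * z ^ 2 + (grad q1 p e1 - grad q2 p e2) * z * w + a3 * w ^ 2"
      by (subst z) (simp only: q_def form_val_add form_val_mult form_val_Cst zval, simp add: power2_eq_square algebra_simps)
    moreover have x': "x = z *s p + w *s (e1 - e2)" using z by (simp add: vector_ssub_ldistrib)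
    have "form_val q3 x = c * z ^ 2 + (grad q1 p e1 - grad q2 p e2) * z * w + a3 * w ^ 2"
      unfolding x' val[OF q(3) norm(3)] a3_def b3 ..
    ultimately show "form_val (Q - q ^ 2) x = 0" using sq[OF q(6) x] by simp
  qed
  obtain G1 where G1: "form_in UNIV (4 - 1) G1" "Q - q ^ 2 = l1 * G1" by (rule vanishes_on_dvd[OF l(1) Qq v1])
  have "\<not> vanishes_on l2 l1" using e by (auto simp: vanishes_on_def)
  then have "vanishes_on l2 G1" using vanishes_on_mult[OF l(2) lf(1) G1(1)] v2 G1(2) by simp
  then obtain G2 where G2: "form_in UNIV (4 - 1 - 1) G2" "G1 = l2 * G2" by (rule vanishes_on_dvd[OF l(2) G1(1)])
  have n: "\<not> vanishes_on (l1 + l2) l1" "\<not> vanishes_on (l1 + l2) l2"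
    using e e3(1) by (auto simp: vanishes_on_def linear_form_diff[OF lf(1)] linear_form_diff[OF lf(2)] intro!: exI[of _ "e1 - e2"])
  have "vanishes_on (l1 + l2) G1" using vanishes_on_mult[OF l(3) lf(1) G1(1)] v3 G1(2) n(1) by simp
  then have "vanishes_on (l1 + l2) G2" using vanishes_on_mult[OF l(3) lf(2) G2(1)] G2(2) n(2) by simp
  then obtain m where m: "form_in UNIV (4 - 1 - 1 - 1) m" "G2 = (l1 + l2) * m" by (rule vanishes_on_dvd[OF l(3) G2(1)])
  have "Q = q ^ 2 + l1 * l2 * (l1 + l2) * m" using G1(2) G2(2) m(2) by (simp add: algebra_simps)
  then show ?thesis using qf m(1) by auto
qed

text \<open>After rescaling, the three equations satisfy \<open>k1 + k2 = l3\<close>. The signs of the square roots of \<open>Q\<close> on the three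
lines are chosen so that they agree at the common point.\<close>

lemma concurrent_bitangents_in_family:
  assumes Q: "Q \<in> smooth_quartics" and b: "bitangent Q l1" "bitangent Q l2" "bitangent Q l3"
    and ne: "\<not> vanishes_on l1 l2" "\<not> vanishes_on l1 l3" "\<not> vanishes_on l2 l3"
    and conc: "concurrent l1 l2 l3"
  shows "\<exists>i j k. Q \<in> concurrent_quartics i j k"
proof -
  have Q4: "form_in UNIV 4 Q" using smooth_quartic_form[OF Q] by simp
  note l = b[THEN bitangent_forms]
  note lf = l[THEN forms_1_form_in]
  obtain P where P: "on_curve P l1" "on_curve P l2" "on_curve P l3" using conc by (auto simp: concurrent_def)
  then have "P \<in> proj_plane" by (simp add: on_curve_def)
  then obtain p where p: "p \<noteq> 0" "P = vec.span {p}" by (rule proj_plane_E)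
  have lp: "form_val l1 p = 0" "form_val l2 p = 0" "form_val l3 p = 0"
    using P on_curve_span[OF p(1)] lf p(2) by auto
  obtain f1 f2 where f: "form_val l1 f1 = 0" "form_val l2 f1 = 1" "form_val l1 f2 = 1" "form_val l2 f2 = 0"
    "\<forall>x. \<exists>z. x = z *s p + (form_val l2 x *s f1 + form_val l1 x *s f2)"
    by (rule two_lines_basis[OF l(1,2) ne(1) p(1) lp(1,2)])
  define \<alpha> where "\<alpha> = form_val l3 f2"
  define \<beta> where "\<beta> = form_val l3 f1"
  have l3: "l3 = Cst \<alpha> * l1 + Cst \<beta> * l2"
  proof (rule form_eqI)
    fix x
    obtain z where z: "x = z *s p + (form_val l2 x *s f1 + form_val l1 x *s f2)" using f(5) by blast
    have "form_val l3 (z *s p + (form_val l2 x *s f1 + form_val l1 x *s f2)) = form_val l2 x * \<beta> + form_val l1 x * \<alpha>"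
      by (simp add: linear_form_add[OF lf(3)] linear_form_scale[OF lf(3)] lp \<alpha>_def \<beta>_def)
    then show "form_val l3 x = form_val (Cst \<alpha> * l1 + Cst \<beta> * l2) x" using z by (simp add: mult.commute)
  qed
  have ab: "\<alpha> \<noteq> 0" "\<beta> \<noteq> 0"
    using ne(2,3) unfolding l3 vanishes_on_def by auto
  define k1 where "k1 = Cst \<alpha> * l1"
  define k2 where "k2 = Cst \<beta> * l2"
  have k12: "k1 + k2 = l3" by (simp add: k1_def k2_def l3)
  have van: "vanishes_on k1 F = vanishes_on l1 F" "vanishes_on k2 F = vanishes_on l2 F" for F
    using ab by (simp_all add: vanishes_on_def k1_def k2_def)
  have nk: "\<not> vanishes_on k1 k2" using ne(1) ab unfolding van by (simp add: vanishes_on_def k2_def)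
  have k0: "k1 \<noteq> 0" "k2 \<noteq> 0"
    using f ab by (metis form_val_0 form_val_Cst form_val_mult k1_def k2_def mult_eq_0_iff zero_neq_one)+
  have k: "k1 \<in> forms 1" "k2 \<in> forms 1" "k1 + k2 \<in> forms 1"
    using k0 l(3) form_in_smult[OF lf(1), of \<alpha>] form_in_smult[OF lf(2), of \<beta>] unfolding k12
    by (simp_all add: forms_iff k1_def k2_def)
  have kp: "form_val k1 p = 0" "form_val k2 p = 0" by (simp_all add: k1_def k2_def lp)
  have Qp: "form_val Q p \<noteq> 0" by (rule no_contact_on_two_bitangents[OF Q b(1,2) ne(1) p(1) lp(1,2)])
  obtain c where c: "form_val Q p = c ^ 2" using exists_complex_root[of 2 "form_val Q p"] by auto
  have sgn: "\<exists>q. form_in UNIV 2 q \<and> vanishes_on l (Q - q ^ 2) \<and> form_val q p = c"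
    if bl: "bitangent Q l" and lp: "form_val l p = 0" for l
  proof -
    obtain q where q: "form_in UNIV 2 q" "vanishes_on l (Q - q ^ 2)" by (rule bitangent_square[OF Q4 bl])
    have "form_val q p ^ 2 = c ^ 2" using q(2) lp c by (simp add: vanishes_on_def)
    then have "form_val q p = c \<or> form_val q p = - c" by (rule power2_eq_iff[THEN iffD1])
    then show ?thesis
    proof
      assume "form_val q p = - c"
      then show ?thesis using q form_in_uminus[OF q(1)] form_val_diff[of 0 q p] by (intro exI[of _ "- q"]) simp
    qed (use q in blast)
  qed
  obtain q1 q2 q3 where q: "form_in UNIV 2 q1" "vanishes_on l1 (Q - q1 ^ 2)" "form_val q1 p = c"
    "form_in UNIV 2 q2" "vanishes_on l2 (Q - q2 ^ 2)" "form_val q2 p = c"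
    "form_in UNIV 2 q3" "vanishes_on l3 (Q - q3 ^ 2)" "form_val q3 p = c"
    using sgn[OF b(1) lp(1)] sgn[OF b(2) lp(2)] sgn[OF b(3) lp(3)] by auto
  obtain q m where qm: "form_in UNIV 2 q" "form_in UNIV 1 m" "Q = q ^ 2 + k1 * k2 * (k1 + k2) * m"
    using concurrent_lines_conic[OF Q4 k nk p(1) kp Qp q(1,4,7) _ _ _ q(3,6,9)] q(2,5,8) unfolding van k12 by blast
  obtain i j k a r where lr: "i \<noteq> j" "i \<noteq> k" "j \<noteq> k" "UNIV = {i, j, k}" "UNIV - {i} = {j, k}" "a \<noteq> 0"
      "form_in {j, k} 1 r" "k1 = Cst a * (Var i - r)"
    by (rule linear_form_normalised[OF k(1)])
  define n where "n = Cst (1 / a) * k2"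
  have n: "k2 = Cst a * n" unfolding n_def using lr(6)
    by (simp add: mult.assoc[symmetric] hom_mult[OF semiring_hom_Cst, symmetric] hom_one[OF semiring_hom_Cst])
  have "Q = q ^ 2 + (Var i - r) * n * (Var i - r + n) * (Cst a * (Cst a * (Cst a * m)))"
    unfolding qm(3) lr(8) n by (simp add: algebra_simps)
  moreover have "form_in UNIV 1 n" unfolding n_def using k(2) by (intro form_in_smult) (simp add: forms_iff)
  moreover have "form_in UNIV 1 (Cst a * (Cst a * (Cst a * m)))" by (intro form_in_smult qm(2))
  ultimately show ?thesis unfolding concurrent_quartics_def using qm(1) lr(7) by blast
qed

definition general_quartic :: "3 mpoly \<Rightarrow> bool" where
  "general_quartic Q \<longleftrightarrow> Q \<in> smooth_quartics \<and> irreducible Q \<and> (\<forall>i j k. Q \<notin> hyperflex_quartics i j k)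
     \<and> (\<forall>i j k. Q \<notin> concurrent_quartics i j k)"

lemma general_quartics_exist:
  "\<exists>U. zariski_open_smooth_quartics U \<and> U \<noteq> {} \<and> (\<forall>Q\<in>U. general_quartic Q)"
proof -
  define T :: "(3 \<times> 3 \<times> 3) set" where "T = UNIV"
  define B where "B = (\<Union>(i, j, k)\<in>T. singular_quartics i j k) \<union> (\<Union>(i, j, k)\<in>T. hyperflex_quartics i j k)
    \<union> (\<Union>(i, j, k)\<in>T. concurrent_quartics i j k)
    \<union> {G * H | G H. form_in UNIV 1 G \<and> form_in UNIV 3 H} \<union> {G * H | G H. form_in UNIV 2 G \<and> form_in UNIV 2 H}"
  have "finite T" by (simp add: T_def)
  then have "negligible B" unfolding B_def
    by (intro negligible_Un negligible_UN)
      (auto intro: negligible_singular negligible_hyperflex negligible_concurrent negligible_products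
        simp: card_exps card_exps[unfolded One_nat_def])
  from negligible_avoid[OF this] obtain Z Q0 where Z: "zariski_closed Z" "B \<inter> forms 4 \<subseteq> Z" "Q0 \<in> forms 4" "Q0 \<notin> Z"
    by blast
  define U where "U = smooth_quartics - Z"
  have inB: "Q \<notin> B" if "Q \<in> forms 4" "Q \<notin> Z" for Q using Z(2) that by blast
  have "zariski_open_smooth_quartics U" unfolding zariski_open_smooth_quartics_def U_def using Z(1) by blast
  moreover have "Q0 \<in> U"
  proof -
    have "\<not> (\<exists>i j k. Q0 \<in> singular_quartics i j k)" using inB[OF Z(3,4)] by (auto simp: B_def T_def)
    then have "singular_points Q0 = {}" using singular_quartic_in_family[OF Z(3)] by blast
    then show ?thesis using Z(3,4) by (simp add: U_def smooth_quartics_def)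
  qed
  moreover have "general_quartic Q" if "Q \<in> U" for Q
  proof -
    have Q: "Q \<in> smooth_quartics" "Q \<in> forms 4" "Q \<notin> B" using that inB by (auto simp: U_def smooth_quartics_def)
    have "irreducible Q" by (rule irreducible_quartic[OF Q(2)]) (use Q(3) in \<open>auto simp: B_def\<close>)
    moreover have "\<forall>i j k. Q \<notin> hyperflex_quartics i j k" "\<forall>i j k. Q \<notin> concurrent_quartics i j k"
      using Q(3) by (auto simp: B_def T_def)
    ultimately show ?thesis using Q(1) by (simp add: general_quartic_def)
  qed
  ultimately show ?thesis by blast
qed

section \<open>Power series in two variables\<close>

notation fps_nth (infixl "$$" 75)

text \<open>The power series \<open>h(a x, b x)\<close> in \<open>x\<close>, for \<open>h\<close> in the variables \<open>s\<close> (inner) and \<open>t\<close> (outer): the restriction to a line through the origin.\<close>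

definition restrict_line :: "complex \<Rightarrow> complex \<Rightarrow> complex fps fps \<Rightarrow> complex fps" where
  "restrict_line a b h = Abs_fps (\<lambda>N. \<Sum>n=0..N. h $$ n $$ (N - n) * a ^ (N - n) * b ^ n)"

lemma restrict_line_mult: "restrict_line a b (g * h) = restrict_line a b g * restrict_line a b h"
proof (rule fps_ext)
  fix N
  have "restrict_line a b (g * h) $$ N = (\<Sum>n=0..N. \<Sum>i=0..n. \<Sum>j=0..N - n.
      g $$ i $$ j * h $$ (n - i) $$ (N - n - j) * (a ^ (N - n) * b ^ n))"
    by (simp add: restrict_line_def fps_mult_nth fps_sum_nth sum_distrib_right mult.assoc)
  also have "\<dots> = (\<Sum>(n, i, j)\<in>(SIGMA n:{0..N}. SIGMA i:{0..n}. {0..N - n}).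
      g $$ i $$ j * h $$ (n - i) $$ (N - n - j) * (a ^ (N - n) * b ^ n))"
    by (simp add: sum.Sigma)
  also have "\<dots> = (\<Sum>(M, i, k)\<in>(SIGMA M:{0..N}. SIGMA i:{0..M}. {0..N - M}).
      g $$ i $$ (M - i) * a ^ (M - i) * b ^ i * (h $$ k $$ (N - M - k) * a ^ (N - M - k) * b ^ k))"
  proof (rule sum.reindex_bij_witness[where i = "\<lambda>(M, i, k). (i + k, i, M - i)" and j = "\<lambda>(n, i, j). (i + j, i, n - i)"], goal_cases)
    case (5 x)
    obtain n i j where x: "x = (n, i, j)" by (cases x)
    have le: "n \<le> N" "i \<le> n" "j \<le> N - n" using 5 x by auto
    have e: "N - (i + j) - (n - i) = N - n - j" "i + (n - i) = n" "j + (N - n - j) = N - n" using le by auto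
    have "a ^ (N - n) = a ^ j * a ^ (N - n - j)" "b ^ n = b ^ i * b ^ (n - i)"
      by (simp_all only: power_add[symmetric] e)
    moreover have "N - (i + j + (n - i)) = N - (n + j)" using le by auto
    ultimately show ?case by (simp add: x mult_ac)
  qed auto
  also have "\<dots> = (\<Sum>M=0..N. \<Sum>i=0..M. \<Sum>k=0..N - M.
      g $$ i $$ (M - i) * a ^ (M - i) * b ^ i * (h $$ k $$ (N - M - k) * a ^ (N - M - k) * b ^ k))"
    by (simp add: sum.Sigma)
  also have "\<dots> = (restrict_line a b g * restrict_line a b h) $$ N"
    by (simp add: fps_mult_nth restrict_line_def sum_product)
  finally show "restrict_line a b (g * h) $$ N = (restrict_line a b g * restrict_line a b h) $$ N" .
qed

lemma restrict_line_const: "restrict_line a b (fps_const (fps_const c)) = fps_const c"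
  by (rule fps_ext) (auto simp: restrict_line_def sum.delta if_distrib[of "\<lambda>x. fps_nth x _"] if_distrib[of "\<lambda>x. x * _"]
      cong: if_cong)

lemma restrict_line_s: "restrict_line a b (fps_const fps_X) = fps_const a * fps_X"
  by (rule fps_ext) (auto simp: restrict_line_def sum.delta if_distrib[of "\<lambda>x. fps_nth x _"] if_distrib[of "\<lambda>x. x * _"]
      cong: if_cong)

lemma restrict_line_t: "restrict_line a b fps_X = fps_const b * fps_X"
proof (rule fps_ext)
  fix N
  have "restrict_line a b fps_X $$ N = (\<Sum>n=0..N. if n = 1 then (1::complex fps) $$ (N - 1) * a ^ (N - 1) * b else 0)"
    unfolding restrict_line_def fps_nth_Abs_fps by (intro sum.cong) auto
  also have "\<dots> = (fps_const b * fps_X) $$ N" by auto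
  finally show "restrict_line a b fps_X $$ N = (fps_const b * fps_X) $$ N" .
qed

lemma restrict_line_hom: "semiring_hom (restrict_line a b)"
proof (rule semiring_homI)
  show "restrict_line a b 0 = 0" by (rule fps_ext) (simp add: restrict_line_def)
  show "restrict_line a b 1 = 1" using restrict_line_const[of a b 1] by simp
  show "restrict_line a b (g + h) = restrict_line a b g + restrict_line a b h" for g h
    by (rule fps_ext) (simp add: restrict_line_def sum.distrib algebra_simps)
qed (rule restrict_line_mult)

lemma restrict_line_nth_0 [simp]: "restrict_line a b h $$ 0 = h $$ 0 $$ 0"
  by (simp add: restrict_line_def)

lemma restrict_line_nth_1: "restrict_line a b h $$ 1 = h $$ 0 $$ 1 * a + h $$ 1 $$ 0 * b"
  by (simp add: restrict_line_def)

lemma unit_fps2_iff: "(h :: complex fps fps) dvd 1 \<longleftrightarrow> h $$ 0 $$ 0 \<noteq> 0"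
proof
  assume "h dvd 1"
  then obtain k where "1 = h * k" by (auto simp: dvd_def)
  then have "h $$ 0 $$ 0 * k $$ 0 $$ 0 = 1" by (metis fps_mult_nth_0 fps_one_nth)
  then show "h $$ 0 $$ 0 \<noteq> 0" by auto
next
  assume "h $$ 0 $$ 0 \<noteq> 0"
  then have "h $$ 0 * inverse (h $$ 0) = 1" by (simp add: inverse_mult_eq_1')
  then have "h * fps_right_inverse h (inverse (h $$ 0)) = 1" by (rule fps_right_inverse)
  then show "h dvd 1" by (metis dvdI)
qed

text \<open>A product of two series without constant term has no linear part.\<close>

lemma irreducible_fps2:
  fixes h :: "complex fps fps"
  assumes 0: "h $$ 0 $$ 0 = 0" and 1: "h $$ 0 $$ 1 \<noteq> 0 \<or> h $$ 1 $$ 0 \<noteq> 0"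
  shows "irreducible h"
proof (rule irreducibleI)
  show "h \<noteq> 0" using 1 by auto
  show "\<not> h dvd 1" using 0 by (simp add: unit_fps2_iff)
  fix g k assume h: "h = g * k"
  show "g dvd 1 \<or> k dvd 1"
  proof (rule ccontr)
    assume "\<not> ?thesis"
    then have gk: "g $$ 0 $$ 0 = 0" "k $$ 0 $$ 0 = 0" by (auto simp: unit_fps2_iff)
    have "restrict_line a b h $$ 1 = 0" for a b
      unfolding h restrict_line_mult by (simp add: fps_mult_nth gk)
    from this[of 1 0] this[of 0 1] show False using 1 by (simp add: restrict_line_nth_1[unfolded One_nat_def])
  qed
qed

definition linear_fps :: "complex \<Rightarrow> complex \<Rightarrow> complex fps fps" where
  "linear_fps \<alpha> \<beta> = fps_const (fps_const \<alpha>) * fps_const fps_X + fps_const (fps_const \<beta>) * fps_X"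

lemma linear_fps_mult_nth:
  "(linear_fps \<alpha> \<beta> * q) $$ n $$ m = (if m = 0 then 0 else \<alpha> * q $$ n $$ (m - 1)) + (if n = 0 then 0 else \<beta> * q $$ (n - 1) $$ m)"
proof -
  have "linear_fps \<alpha> \<beta> * q = fps_const (fps_const \<alpha> * fps_X) * q + fps_const (fps_const \<beta>) * (fps_X * q)"
    by (simp add: linear_fps_def algebra_simps)
  then show ?thesis by (simp add: mult.assoc)
qed

lemma restrict_linear_fps: "restrict_line \<beta> (- \<alpha>) (linear_fps \<alpha> \<beta>) = 0"
  unfolding linear_fps_def hom_add[OF restrict_line_hom] restrict_line_mult restrict_line_const
    restrict_line_s restrict_line_t
  by (simp add: mult.assoc[symmetric] mult.commute[of \<alpha>])

text \<open>The coefficient at \<open>s\<^sup>m t\<^sup>n\<close> of the series \<open>q\<close> for which \<open>(\<alpha> s + \<beta> t) q\<close> agrees with \<open>h\<close> in all monomials that involve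
\<open>t\<close>, for nonzero \<open>\<beta>\<close>. The equation at \<open>s\<^sup>m t\<^sup>n\<^sup>+\<^sup>1\<close> gives the coefficient in terms of the one at
\<open>s\<^sup>m\<^sup>-\<^sup>1 t\<^sup>n\<^sup>+\<^sup>1\<close>, hence the recursion on \<open>m\<close>.\<close>

primrec quotient_coeff :: "complex fps fps \<Rightarrow> complex \<Rightarrow> complex \<Rightarrow> nat \<Rightarrow> nat \<Rightarrow> complex" where
  "quotient_coeff h \<alpha> \<beta> 0 = (\<lambda>n. h $$ Suc n $$ 0 / \<beta>)"
| "quotient_coeff h \<alpha> \<beta> (Suc m) = (\<lambda>n. (h $$ Suc n $$ Suc m - \<alpha> * quotient_coeff h \<alpha> \<beta> m (Suc n)) / \<beta>)"

text \<open>Division leaves a remainder in \<open>s\<close> alone (in \<open>t\<close> alone if \<open>\<beta> = 0\<close>). The restriction to the line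
\<open>\<alpha> s + \<beta> t = 0\<close> is injective on such remainders and kills multiples of the linear form.\<close>

lemma linear_fps_dvd_iff:
  assumes nz: "\<alpha> \<noteq> 0 \<or> \<beta> \<noteq> 0"
  shows "linear_fps \<alpha> \<beta> dvd h \<longleftrightarrow> restrict_line \<beta> (- \<alpha>) h = 0"
proof
  assume "linear_fps \<alpha> \<beta> dvd h"
  then show "restrict_line \<beta> (- \<alpha>) h = 0"
    using hom_dvd[OF restrict_line_hom] restrict_linear_fps by (metis dvd_0_left)
next
  assume h: "restrict_line \<beta> (- \<alpha>) h = 0"
  have r0: "restrict_line \<beta> (- \<alpha>) (h - linear_fps \<alpha> \<beta> * q) = 0" for q
    by (simp add: hom_minus[OF restrict_line_hom] restrict_line_mult restrict_linear_fps h)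
  show "linear_fps \<alpha> \<beta> dvd h"
  proof (cases "\<beta> = 0")
    case False
    define q where "q = Abs_fps (\<lambda>n. Abs_fps (\<lambda>m. quotient_coeff h \<alpha> \<beta> m n))"
    define r where "r = h - linear_fps \<alpha> \<beta> * q"
    have rS: "r $$ Suc n $$ m = 0" for n m
      using False by (cases m) (simp_all add: r_def linear_fps_mult_nth q_def)
    have "r $$ 0 $$ N = 0" for N
    proof -
      have "0 = restrict_line \<beta> (- \<alpha>) r $$ N" using r0[of q] by (simp add: r_def)
      also have "\<dots> = (\<Sum>n=0..N. if n = 0 then r $$ 0 $$ N * \<beta> ^ N else 0)"
        unfolding restrict_line_def fps_nth_Abs_fps
      proof (intro sum.cong refl)
        fix n show "r $$ n $$ (N - n) * \<beta> ^ (N - n) * (- \<alpha>) ^ n = (if n = 0 then r $$ 0 $$ N * \<beta> ^ N else 0)"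
          using rS by (cases n) auto
      qed
      finally show ?thesis using False by simp
    qed
    then have "r $$ n $$ m = 0" for n m using rS by (cases n) auto
    then have "r = 0" by (intro fps_ext) simp
    then have "h = linear_fps \<alpha> \<beta> * q" by (simp add: r_def)
    then show ?thesis by simp
  next
    case True
    then have a: "\<alpha> \<noteq> 0" using nz by simp
    define q where "q = Abs_fps (\<lambda>n. Abs_fps (\<lambda>m. h $$ n $$ Suc m / \<alpha>))"
    define r where "r = h - linear_fps \<alpha> \<beta> * q"
    have rS: "r $$ n $$ Suc m = 0" for n m
      using True a by (simp add: r_def linear_fps_mult_nth q_def)
    have "r $$ N $$ 0 = 0" for N
    proof -
      have "0 = restrict_line \<beta> (- \<alpha>) r $$ N" using r0[of q] by (simp add: r_def)
      also have "\<dots> = (\<Sum>n=0..N. if n = N then r $$ N $$ 0 * (- \<alpha>) ^ N else 0)"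
        unfolding restrict_line_def fps_nth_Abs_fps
      proof (intro sum.cong refl)
        fix n assume "n \<in> {0..N}"
        then show "r $$ n $$ (N - n) * \<beta> ^ (N - n) * (- \<alpha>) ^ n = (if n = N then r $$ N $$ 0 * (- \<alpha>) ^ N else 0)"
          using True by (cases "N - n") auto
      qed
      finally show ?thesis using a by simp
    qed
    then have "r $$ n $$ m = 0" for n m using rS by (cases m) auto
    then have "r = 0" by (intro fps_ext) simp
    then have "h = linear_fps \<alpha> \<beta> * q" by (simp add: r_def)
    then show ?thesis by simp
  qed
qed

text \<open>Restriction to the line is a homomorphism to a domain whose kernel is generated by the linear form.\<close>

lemma linear_fps_prime:
  assumes "\<alpha> \<noteq> 0 \<or> \<beta> \<noteq> 0" "linear_fps \<alpha> \<beta> dvd g * h"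
  shows "linear_fps \<alpha> \<beta> dvd g \<or> linear_fps \<alpha> \<beta> dvd h"
  using assms(2) by (simp add: linear_fps_dvd_iff[OF assms(1)] restrict_line_mult)

lemma frame_spec:
  assumes "P \<in> proj_plane" "frame P = (p, u, v)"
  shows "vec.span {p} = P" "vec.span {p, u, v} = UNIV" "p \<noteq> 0"
proof -
  obtain p0 where p0: "p0 \<noteq> 0" "P = vec.span {p0}" using assms(1) by (rule proj_plane_E)
  let ?good = "\<lambda>(p, u, v). vec.span {p} = P \<and> vec.span {p, u, v} = UNIV"
  obtain i where i: "p0 $ i \<noteq> 0" using p0(1) by (auto simp: vec_eq_iff)
  obtain j k where ijk: "i \<noteq> j" "i \<noteq> k" "j \<noteq> k" "UNIV = {i, j, k}" "UNIV - {i} = {j, k}" by (rule coordinates_3[of i])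
  have "x \<in> vec.span {p0, axis j 1, axis k 1}" for x
  proof -
    define y where "y = (x $ i / p0 $ i) *s p0 + ((x $ j - x $ i / p0 $ i * p0 $ j) *s axis j 1
       + (x $ k - x $ i / p0 $ i * p0 $ k) *s axis k 1)"
    have "x $ m = y $ m" for m
    proof -
      have "m = i \<or> m = j \<or> m = k" using ijk(4) by blast
      then show ?thesis using i ijk(1-3) by (elim disjE) (simp_all add: y_def axis_def)
    qed
    then have "x = y" by (simp add: vec_eq_iff)
    moreover have "y \<in> vec.span {p0, axis j 1, axis k 1}" unfolding y_def
      by (intro vec.span_add vec.span_scale) (simp_all add: vec.span_base)
    ultimately show ?thesis by simp
  qed
  then have "?good (p0, axis j 1, axis k 1)" using p0 by auto
  then have "?good (frame P)" unfolding frame_def by (rule someI)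
  then show g: "vec.span {p} = P" "vec.span {p, u, v} = UNIV" using assms(2) by auto
  show "p \<noteq> 0" using g(1) p0 vec.span_base[of p0 "{p0}"] by (auto simp: span_1)
qed

lemma frame_combination:
  assumes "vec.span {p, u, v} = (UNIV :: (complex^3) set)"
  obtains a b c where "x = a *s p + (b *s u + c *s v)"
proof -
  have "x \<in> vec.span {p, u, v}" using assms by simp
  then obtain a where "x - a *s p \<in> vec.span {u, v}" unfolding vec.span_breakdown_eq[of x p] by blast
  then obtain b c where "x - a *s p = b *s u + c *s v" unfolding span_pair by blast
  then have "x = a *s p + (b *s u + c *s v)" by (simp add: algebra_simps)
  then show ?thesis using that by blast
qed

lemma coeff_fps_hom: "semiring_hom (\<lambda>a::complex. fps_const (fps_const a))"
  by (intro semiring_homI) (simp_all add: fps_const_add[symmetric] del: fps_const_add)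

lemma local_equation_hom: "semiring_hom (\<lambda>F. local_equation F P)"
  unfolding local_equation_def Let_def by (cases "frame P") (simp add: semiring_hom_subst_mpoly[OF coeff_fps_hom])

text \<open>Restricting the local equation to a line through the origin amounts to restricting the form to the corresponding line through \<open>P\<close>.\<close>

lemma restrict_local_equation:
  assumes "frame P = (p, u, v)"
  shows "restrict_line a b (local_equation F P) = fps_of_poly (line_poly F p (a *s u + b *s v))"
proof (rule mpoly_hom_unique[where f = "\<lambda>F. restrict_line a b (local_equation F P)"])
  show "semiring_hom (\<lambda>F. restrict_line a b (local_equation F P))"
    by (rule hom_comp[OF restrict_line_hom local_equation_hom])
  have "semiring_hom (fps_of_poly :: complex poly \<Rightarrow> complex fps)"
    by (intro semiring_homI) (simp_all add: fps_of_poly_add fps_of_poly_mult)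
  then show "semiring_hom (\<lambda>F. fps_of_poly (line_poly F p (a *s u + b *s v)))"
    by (rule hom_comp[OF _ line_poly_hom])
  show "restrict_line a b (local_equation (Cst c) P) = fps_of_poly (line_poly (Cst c) p (a *s u + b *s v))" for c
    by (simp add: local_equation_def assms subst_mpoly_Cst[OF coeff_fps_hom] restrict_line_const fps_of_poly_const)
  show "restrict_line a b (local_equation (Var i) P) = fps_of_poly (line_poly (Var i) p (a *s u + b *s v))" for i
  proof -
    have "local_equation (Var i) P = fps_const (fps_const (p $ i)) + fps_const (fps_const (u $ i)) * fps_const fps_X
        + fps_const (fps_const (v $ i)) * fps_X"
      by (simp only: local_equation_def assms Let_def prod.case subst_mpoly_Var[OF coeff_fps_hom])
    then have "restrict_line a b (local_equation (Var i) P) = fps_const (p $ i) + fps_const (u $ i) * (fps_const a * fps_X)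
        + fps_const (v $ i) * (fps_const b * fps_X)"
      by (simp only: hom_add[OF restrict_line_hom] restrict_line_mult restrict_line_const restrict_line_s restrict_line_t)
    then show ?thesis
      by (intro fps_ext) (auto simp: coeff_pCons algebra_simps split: nat.split)
  qed
qed

lemma local_equation_coeffs:
  assumes "frame P = (p, u, v)"
  shows "local_equation F P $$ 0 $$ 0 = form_val F p"
    "local_equation F P $$ 0 $$ 1 = grad F p u" "local_equation F P $$ 1 $$ 0 = grad F p v"
proof -
  have 1: "restrict_line a b (local_equation F P) $$ 1 = grad F p (a *s u + b *s v)" for a b
    by (simp add: restrict_local_equation[OF assms] grad_def)
  show "local_equation F P $$ 0 $$ 1 = grad F p u" "local_equation F P $$ 1 $$ 0 = grad F p v"
    using 1[of 1 0] 1[of 0 1] unfolding restrict_line_nth_1 by simp_all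
  have "restrict_line 0 0 (local_equation F P) $$ 0 = form_val F p"
    unfolding restrict_local_equation[OF assms] by simp
  then show "local_equation F P $$ 0 $$ 0 = form_val F p" by simp
qed

lemma local_equation_unit:
  assumes "frame P = (p, u, v)" shows "local_equation F P dvd 1 \<longleftrightarrow> form_val F p \<noteq> 0"
  by (simp add: unit_fps2_iff local_equation_coeffs[OF assms])

text \<open>The directions \<open>u\<close> and \<open>v\<close> detect a nonzero derivative, because by Euler the derivative in the direction of the point itself vanishes.\<close>

lemma local_equation_irreducible:
  assumes P: "P \<in> proj_plane" "frame P = (p, u, v)" and F: "form_in UNIV d F"
    and Fp: "form_val F p = 0" and w: "grad F p w \<noteq> 0"
  shows "irreducible (local_equation F P)"
proof (rule irreducible_fps2)
  show "local_equation F P $$ 0 $$ 0 = 0" using local_equation_coeffs[OF P(2)] Fp by simp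
  obtain a b c where abc: "w = a *s p + (b *s u + c *s v)" by (rule frame_combination[OF frame_spec(2)[OF P]])
  then have "grad F p w = b * grad F p u + c * grad F p v"
    using grad_euler[OF F Fp] by (simp add: grad_plus grad_scale)
  then show "local_equation F P $$ 0 $$ 1 \<noteq> 0 \<or> local_equation F P $$ 1 $$ 0 \<noteq> 0"
    using w local_equation_coeffs[OF P(2)] by auto
qed

lemma local_equation_line:
  assumes "frame P = (p, u, v)" "form_in UNIV 1 l" "form_val l p = 0"
  shows "local_equation l P = linear_fps (form_val l u) (form_val l v)"
proof -
  let ?c = "\<lambda>a. fps_const (fps_const a) :: complex fps fps"
  define b :: "complex^3" where "b = (\<chi> i. form_val l (axis i 1))"
  have l: "l = lin b" unfolding b_def by (rule linear_form_eq_lin[OF assms(2)])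
  note ch = hom_sum[OF coeff_fps_hom] hom_mult[OF coeff_fps_hom]
  have "local_equation l P = (\<Sum>i\<in>UNIV. ?c (b $ i) * (?c (p $ i) + ?c (u $ i) * fps_const fps_X + ?c (v $ i) * fps_X))"
    unfolding l lin_def hom_sum[OF local_equation_hom] hom_mult[OF local_equation_hom]
    by (simp add: local_equation_def assms(1) subst_mpoly_Cst[OF coeff_fps_hom] subst_mpoly_Var[OF coeff_fps_hom])
  also have "\<dots> = (\<Sum>i\<in>UNIV. ?c (b $ i) * ?c (p $ i)) + (\<Sum>i\<in>UNIV. ?c (b $ i) * ?c (u $ i)) * fps_const fps_X
      + (\<Sum>i\<in>UNIV. ?c (b $ i) * ?c (v $ i)) * fps_X"
    by (simp only: distrib_left sum.distrib sum_distrib_right mult.assoc)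
  also have "\<dots> = ?c (form_val l p) + ?c (form_val l u) * fps_const fps_X + ?c (form_val l v) * fps_X"
    by (simp only: l form_val_lin ch)
  finally show ?thesis using assms(3) by (simp add: linear_fps_def)
qed

section \<open>Nodes and tacnodes as germs\<close>

definition germ_equiv :: "(complex \<times> complex) set \<Rightarrow> (complex \<times> complex) set \<Rightarrow> bool" where
  "germ_equiv X Y \<longleftrightarrow> (\<exists>V V' h k. open V \<and> 0 \<in> V \<and> open V' \<and> 0 \<in> V' \<and> homeomorphism V V' h k \<and> h 0 = 0 \<and>
     h ` (V \<inter> X) = V' \<inter> Y)"

lemma same_topological_type_iff_germ_equiv:
  "same_topological_type F P F' P' \<longleftrightarrow> germ_equiv (affine_zeros F P) (affine_zeros F' P')"
  by (simp add: same_topological_type_def germ_equiv_def)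

lemma germ_equiv_local:
  assumes "open V" "0 \<in> V" "V \<inter> X = V \<inter> Y" shows "germ_equiv X Y"
  unfolding germ_equiv_def
  by (intro exI[of _ V] exI[of _ "\<lambda>x. x"]) (use assms in \<open>auto simp: homeomorphism_def\<close>)

lemma germ_equiv_sym:
  assumes "germ_equiv X Y" shows "germ_equiv Y X"
proof -
  obtain V V' h k where h: "open V" "0 \<in> V" "open V'" "0 \<in> V'" "homeomorphism V V' h k" "h 0 = 0"
    "h ` (V \<inter> X) = V' \<inter> Y" using assms unfolding germ_equiv_def by blast
  have kh: "k (h x) = x" if "x \<in> V" for x using h(5) that by (simp add: homeomorphism_def)
  have "k ` (V' \<inter> Y) = V \<inter> X" unfolding h(7)[symmetric] image_image using kh by auto
  moreover have "k 0 = 0" using kh[OF h(2)] h(6) by simp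
  ultimately show ?thesis unfolding germ_equiv_def using h homeomorphism_symD[OF h(5)] by blast
qed

lemma germ_equiv_trans:
  assumes "germ_equiv X Y" "germ_equiv Y Z" shows "germ_equiv X Z"
proof -
  obtain V V' h k where h: "open V" "0 \<in> V" "open V'" "0 \<in> V'" "homeomorphism V V' h k" "h 0 = 0"
    "h ` (V \<inter> X) = V' \<inter> Y" using assms(1) unfolding germ_equiv_def by blast
  obtain W W' g m where g: "open W" "0 \<in> W" "open W'" "0 \<in> W'" "homeomorphism W W' g m" "g 0 = 0"
    "g ` (W \<inter> Y) = W' \<inter> Z" using assms(2) unfolding germ_equiv_def by blast
  have hV: "h ` V = V'" "k ` V' = V" "continuous_on V h" "continuous_on V' k" and kh: "\<And>x. x \<in> V \<Longrightarrow> k (h x) = x"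
    and hk: "\<And>y. y \<in> V' \<Longrightarrow> h (k y) = y"
    using h(5) by (auto simp: homeomorphism_def)
  have gW: "g ` W = W'" "m ` W' = W" "continuous_on W g" "continuous_on W' m" and mg: "\<And>x. x \<in> W \<Longrightarrow> m (g x) = x"
    and gm: "\<And>y. y \<in> W' \<Longrightarrow> g (m y) = y"
    using g(5) by (auto simp: homeomorphism_def)
  define A where "A = V \<inter> h -` W"
  define B where "B = W' \<inter> m -` V'"
  have A: "open A" "0 \<in> A" unfolding A_def using continuous_open_preimage[OF hV(3) h(1) g(1)] h g by auto
  have "m 0 = 0" using mg[OF g(2)] g(6) by simp
  then have B: "open B" "0 \<in> B" unfolding B_def using continuous_open_preimage[OF gW(4) g(3) h(3)] h g by auto
  have "homeomorphism A (V' \<inter> W) h k"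
    by (rule homeomorphism_of_subsets[OF h(5), where T'' = "{}"]) (use hV kh hk in \<open>auto simp: A_def\<close>)
  moreover have "homeomorphism (V' \<inter> W) B g m"
    by (rule homeomorphism_of_subsets[OF g(5), where T'' = "{}"]) (use gW mg gm in \<open>auto simp: B_def\<close>)
  ultimately have "homeomorphism A B (g \<circ> h) (k \<circ> m)" by (rule homeomorphism_compose)
  moreover have "(g \<circ> h) ` (A \<inter> X) = B \<inter> Z"
  proof -
    have "h ` (A \<inter> X) = W \<inter> (V' \<inter> Y)" unfolding h(7)[symmetric] by (auto simp: A_def)
    moreover have "g ` (W \<inter> (V' \<inter> Y)) = B \<inter> Z"
    proof (intro set_eqI iffI)
      fix z assume "z \<in> g ` (W \<inter> (V' \<inter> Y))"
      then obtain y where y: "z = g y" "y \<in> W" "y \<in> V'" "y \<in> Y" by auto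
      then have "z \<in> W' \<inter> Z" using g(7) by blast
      then show "z \<in> B \<inter> Z" using y mg by (auto simp: B_def)
    next
      fix z assume z: "z \<in> B \<inter> Z"
      then have "z \<in> g ` (W \<inter> Y)" unfolding g(7) by (auto simp: B_def)
      then obtain y where y: "z = g y" "y \<in> W" "y \<in> Y" by auto
      then have "y \<in> V'" using z mg by (auto simp: B_def)
      then show "z \<in> g ` (W \<inter> (V' \<inter> Y))" using y by auto
    qed
    ultimately show ?thesis by (simp only: image_comp[symmetric])
  qed
  moreover have "(g \<circ> h) 0 = 0" using h g by simp
  ultimately show ?thesis unfolding germ_equiv_def using A B by blast
qed

lemma germ_equiv_linear:
  assumes det: "a * d - b * c \<noteq> (0 :: complex)"
    and XY: "\<And>x y. (x, y) \<in> X \<longleftrightarrow> (a * x + b * y, c * x + d * y) \<in> Y"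
  shows "germ_equiv X Y"
proof -
  let ?D = "a * d - b * c"
  define h where "h = (\<lambda>(x, y). (a * x + b * y, c * x + d * y))"
  define k where "k = (\<lambda>(x, y). ((d * x - b * y) / ?D, (a * y - c * x) / ?D))"
  have kh: "k (h (x, y)) = (x, y)" for x y
  proof -
    have "d * (a * x + b * y) - b * (c * x + d * y) = x * ?D" "a * (c * x + d * y) - c * (a * x + b * y) = y * ?D"
      by (simp_all add: algebra_simps)
    then show ?thesis using det by (simp add: h_def k_def)
  qed
  have hk: "h (k (x, y)) = (x, y)" for x y
  proof -
    have "a * ((d * x - b * y) / ?D) + b * ((a * y - c * x) / ?D) = (x * ?D) / ?D"
      "c * ((d * x - b * y) / ?D) + d * ((a * y - c * x) / ?D) = (y * ?D) / ?D"
      by (simp_all only: times_divide_eq_right add_divide_distrib[symmetric]) (simp_all add: algebra_simps)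
    then show ?thesis using det by (simp add: h_def k_def)
  qed
  have "continuous_on UNIV h" "continuous_on UNIV k"
    unfolding h_def k_def case_prod_beta using det by (intro continuous_intros; simp)+
  then have "homeomorphism UNIV UNIV h k"
    by (rule homeomorphismI) (auto simp: kh hk)
  moreover have "h ` X = Y"
  proof (intro set_eqI iffI)
    fix z assume "z \<in> h ` X"
    then show "z \<in> Y" using XY by (auto simp: h_def)
  next
    fix z assume "z \<in> Y"
    then have "h (k z) \<in> Y" using hk by (cases z) simp
    then have "k z \<in> X" using XY[of "fst (k z)" "snd (k z)"] by (simp add: h_def case_prod_beta)
    then have "h (k z) \<in> h ` X" by (rule imageI)
    then show "z \<in> h ` X" using hk by (cases z) simp
  qed
  moreover have "h 0 = 0" by (simp add: h_def zero_prod_def)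
  ultimately show ?thesis unfolding germ_equiv_def by (intro exI[of _ UNIV] exI[of _ h] exI[of _ k]) auto
qed

definition tacnode :: "(complex \<times> complex) set" where
  "tacnode = {(x, y). y * (y - x ^ 2) = 0}"

definition node :: "(complex \<times> complex) set" where
  "node = {(x, y). x * y = 0}"

text \<open>The curve \<open>x\<^sup>2 A(x) + y K(x,y) = 0\<close> with \<open>A\<close> and \<open>K\<close> nonzero at the origin is carried to the parabola
\<open>y = x\<^sup>2\<close> by \<open>(x, y) \<mapsto> (x, - y K(x,y) / A(x))\<close>, which preserves the axis \<open>y = 0\<close>. This map is injective near
the origin: a difference of two values at the same \<open>x\<close> is \<open>y - z\<close> times a function that does
not vanish there. By invariance of domain it is a local homeomorphism.\<close>

lemma tacnode_germ:
  fixes g :: "nat \<Rightarrow> complex \<Rightarrow> complex" and A :: "complex \<Rightarrow> complex"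
  assumes g: "\<And>j. continuous_on UNIV (g j)" and A: "continuous_on UNIV A" "A 0 \<noteq> 0"
    and g0: "\<And>x. g 0 x = x ^ 2 * A x" and g1: "g 1 0 \<noteq> 0" and N: "N \<ge> 1"
  shows "germ_equiv {(x, y). y * (\<Sum>j\<le>N. g j x * y ^ j) = 0} tacnode"
proof -
  define G where "G x y = (\<Sum>j\<le>N. g j x * y ^ j)" for x y
  \<comment> \<open>The divided difference of \<open>G\<close> in its second argument; \<open>K x y 0\<close> is the function \<open>K\<close> of the map above.\<close>
  define K where "K x y z = (\<Sum>j\<le>N. g j x * (\<Sum>i<j. z ^ (j - Suc i) * y ^ i))" for x y z
  have GK: "G x y - G x z = (y - z) * K x y z" for x y z
  proof -
    have *: "g j x * y ^ j - g j x * z ^ j = (y - z) * (g j x * (\<Sum>i<j. z ^ (j - Suc i) * y ^ i))" for j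
      by (simp only: right_diff_distrib[symmetric] power_diff_sumr2 mult.left_commute)
    show ?thesis unfolding G_def K_def sum_subtractf[symmetric] * by (rule sum_distrib_left[symmetric])
  qed
  have Gx0: "G x 0 = x ^ 2 * A x" for x
  proof -
    have "G x 0 = (\<Sum>j\<le>N. if j = 0 then g 0 x else 0)" unfolding G_def by (intro sum.cong) auto
    then show ?thesis by (simp add: g0)
  qed
  have "K 0 0 0 = (\<Sum>j\<le>N. if j = 1 then g 1 0 else 0)"
    unfolding K_def
  proof (intro sum.cong refl)
    fix j
    have "(\<Sum>i<j. 0 ^ (j - Suc i) * 0 ^ i) = (if j = 1 then 1 else (0::complex))"
    proof (cases "j = 1")
      case False
      have "(0::complex) ^ (j - Suc i) * 0 ^ i = 0" if "i < j" for i using that False by (cases i) auto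
      then show ?thesis using False by (simp add: sum.neutral)
    qed simp
    then show "g j 0 * (\<Sum>i<j. 0 ^ (j - Suc i) * 0 ^ i) = (if j = 1 then g 1 0 else 0)" by simp
  qed
  then have K0: "K 0 0 0 \<noteq> 0" using g1 N by simp
  have gc: "continuous_on S (\<lambda>z. g j (f z))" if "continuous_on S f" for j S and f :: "complex \<times> complex \<times> complex \<Rightarrow> complex"
    by (rule continuous_on_compose2[OF g that]) auto
  have Kc: "continuous_on UNIV (\<lambda>(x, y, z). K x y z)"
    unfolding K_def case_prod_beta by (intro continuous_intros gc)
  have "continuous_on UNIV (\<lambda>(x, y, z). K x y z * A x)"
    unfolding K_def case_prod_beta
    by (intro continuous_intros gc continuous_on_compose2[OF A(1)]) auto
  then have "open ((\<lambda>(x, y, z). K x y z * A x) -` (- {0}))"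
    by (intro open_vimage) auto
  moreover have "(0, 0, 0) \<in> (\<lambda>(x, y, z). K x y z * A x) -` (- {0})" using K0 A(2) by simp
  ultimately obtain S T where S: "open S" "0 \<in> S" "open T" "(0, 0) \<in> T" "S \<times> T \<subseteq> (\<lambda>(x, y, z). K x y z * A x) -` (- {0})"
    by (rule open_prod_elim) auto
  obtain T1 T2 where T: "open T1" "open T2" "0 \<in> T1" "0 \<in> T2" "T1 \<times> T2 \<subseteq> T"
    using S(3,4) by (rule open_prod_elim) auto
  define V where "V = S \<times> (T1 \<inter> T2)"
  have "open V" unfolding V_def using S T by (intro open_Times open_Int)
  then have V: "open V" "0 \<in> V" using S T by (auto simp: V_def zero_prod_def)
  have nz: "K x y z \<noteq> 0" "A x \<noteq> 0" if "(x, y) \<in> V" "(x, z) \<in> V" for x y z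
  proof -
    have "(x, y, z) \<in> S \<times> T" using that T(5) by (auto simp: V_def)
    then have "K x y z * A x \<noteq> 0" using S(5) by auto
    then show "K x y z \<noteq> 0" "A x \<noteq> 0" by auto
  qed
  have V0: "(x, 0) \<in> V" if "(x, y) \<in> V" for x y using that T by (auto simp: V_def)
  define f where "f = (\<lambda>(x, y). (x, - (y * K x y 0) / A x))"
  have fc: "continuous_on V f"
    unfolding f_def case_prod_beta
  proof (intro continuous_intros)
    show "continuous_on V (\<lambda>p. K (fst p) (snd p) 0)"
      using continuous_on_compose2[OF Kc, of V "\<lambda>p. (fst p, snd p, 0)"] by (simp add: continuous_intros)
    show "continuous_on V (\<lambda>p. A (fst p))" by (intro continuous_on_compose2[OF A(1)] continuous_intros) auto
    show "\<forall>p\<in>V. A (fst p) \<noteq> 0" using nz by auto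
  qed
  have "inj_on f V"
  proof (rule inj_onI)
    fix p q assume pq: "p \<in> V" "q \<in> V" "f p = f q"
    obtain x y x' z where p: "p = (x, y)" and q: "q = (x', z)" by (cases p; cases q)
    have x: "x' = x" and eq: "y * K x y 0 / A x = z * K x z 0 / A x" using pq(3) by (auto simp: f_def p q)
    have v: "(x, y) \<in> V" "(x, z) \<in> V" using pq p q x by auto
    have "y * K x y 0 = z * K x z 0" using eq nz(2)[OF v] by simp
    then have "G x y - G x 0 = G x z - G x 0" unfolding GK by simp
    then have "(y - z) * K x y z = 0" unfolding GK[symmetric] by simp
    then show "p = q" using nz(1)[OF v] x p q by simp
  qed
  then obtain k where k: "homeomorphism V (f ` V) f k"
    using invariance_of_domain_homeomorphism[OF V(1) fc] by auto
  have fV: "open (f ` V)" using invariance_of_domain[OF fc V(1) \<open>inj_on f V\<close>] .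
  have f0: "f 0 = 0" by (simp add: f_def zero_prod_def)
  have mem: "(x, y) \<in> {(x, y). y * (\<Sum>j\<le>N. g j x * y ^ j) = 0} \<longleftrightarrow> f (x, y) \<in> tacnode" if v: "(x, y) \<in> V" for x y
  proof -
    note n = nz[OF v V0[OF v]]
    have "G x y = x ^ 2 * A x + y * K x y 0" using GK[of x y 0] Gx0[of x] by (simp add: algebra_simps)
    moreover have "- b / a = c \<longleftrightarrow> c * a + b = 0" if "a \<noteq> 0" for a b c :: complex
    proof -
      have "- b / a = c \<longleftrightarrow> - b = c * a" using that by (rule nonzero_divide_eq_eq)
      also have "\<dots> \<longleftrightarrow> c * a + b = 0" by (rule iffI; algebra)
      finally show ?thesis .
    qed
    ultimately have "G x y = 0 \<longleftrightarrow> - (y * K x y 0) / A x = x ^ 2" using n(2) by simp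
    then show ?thesis using n by (auto simp: tacnode_def f_def G_def[symmetric])
  qed
  define X where "X = {(x, y). y * (\<Sum>j\<le>N. g j x * y ^ j) = 0}"
  have "p \<in> X \<longleftrightarrow> f p \<in> tacnode" if "p \<in> V" for p
    using mem that by (cases p) (simp add: X_def)
  then have "f ` (V \<inter> X) = f ` V \<inter> tacnode" by auto
  moreover have "0 \<in> f ` V" using V(2) f0 by (rule rev_image_eqI[OF _ sym])
  ultimately have "germ_equiv X tacnode" unfolding germ_equiv_def
    by (intro exI[of _ V] exI[of _ "f ` V"] exI[of _ f] exI[of _ k] conjI V fV k f0)
  then show ?thesis by (simp add: X_def)
qed

text \<open>The expansion is a polynomial in \<open>y\<close> whose coefficients are polynomials in \<open>x\<close>; zero terms may be added so that there is a linear term.\<close>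

lemma plane_expansion:
  "\<exists>g N. N \<ge> 1 \<and> (\<forall>x y. form_val F (p + x *s d + y *s e) = (\<Sum>j\<le>N. poly (g j) x * y ^ j))"
proof -
  have h1: "semiring_hom (\<lambda>c::complex. [:[:c:]:])" using hom_const_poly[OF const_poly_hom] .
  define G where "G = subst_mpoly (\<lambda>c. [:[:c:]:]) (\<lambda>i. [:[:p $ i, d $ i:], [:e $ i:]:]) F"
  have ev: "semiring_hom (\<lambda>h. poly (poly h [:y:]) x)" for x y :: complex
    by (intro semiring_homI) simp_all
  define N where "N = Suc (degree G)"
  have "form_val F (p + x *s d + y *s e) = (\<Sum>j\<le>N. poly (coeff G j) x * y ^ j)" for x y
  proof -
    have "form_val F (p + x *s d + y *s e) = poly (poly G [:y:]) x"
      unfolding G_def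
    proof (rule mpoly_hom_unique[where f = "\<lambda>F. form_val F (p + x *s d + y *s e)", OF form_val_hom hom_comp[OF ev semiring_hom_subst_mpoly[OF h1]]])
      show "form_val (Cst c) (p + x *s d + y *s e) =
          poly (poly (subst_mpoly (\<lambda>c. [:[:c:]:]) (\<lambda>i. [:[:p $ i, d $ i:], [:e $ i:]:]) (Cst c)) [:y:]) x" for c
        by (simp add: subst_mpoly_Cst[OF h1])
      show "form_val (Var i) (p + x *s d + y *s e) =
          poly (poly (subst_mpoly (\<lambda>c. [:[:c:]:]) (\<lambda>i. [:[:p $ i, d $ i:], [:e $ i:]:]) (Var i)) [:y:]) x" for i
        by (simp add: subst_mpoly_Var[OF h1])
    qed
    also have "poly G [:y:] = (\<Sum>j\<le>N. coeff G j * [:y:] ^ j)"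
      unfolding poly_altdef by (rule sum.mono_neutral_left) (auto simp: N_def intro: coeff_eq_0)
    finally show ?thesis by (simp add: poly_sum poly_power)
  qed
  then show ?thesis by (intro exI[of _ "coeff G"] exI[of _ N]) (simp add: N_def)
qed

text \<open>Linear coordinates are chosen so that the tangent line is \<open>y = 0\<close>: the first basis vector \<open>d\<close> is the direction of the line and the second
is a vector on which \<open>\<alpha> s + \<beta> t\<close> has the value 1. Contact of order two and smoothness are exactly the hypotheses
of the standard form.\<close>

lemma tangent_line_germ:
  fixes \<alpha> \<beta> :: complex
  assumes d: "d = \<beta> *s u - \<alpha> *s v"
    and order: "line_poly Q p d = [:0, 1:] ^ 2 * A" "poly A 0 \<noteq> 0"
    and grad: "grad Q p (x0 *s u + y0 *s v) \<noteq> 0"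
    and e: "\<alpha> * x0 + \<beta> * y0 = 1"
  shows "germ_equiv {(s, t). (\<alpha> * s + \<beta> * t) * form_val Q (p + s *s u + t *s v) = 0} tacnode"
proof -
  define e where "e = x0 *s u + y0 *s v"
  obtain g N where N: "N \<ge> 1" and g: "\<And>x y. form_val Q (p + x *s d + y *s e) = (\<Sum>j\<le>N. poly (g j) x * y ^ j)"
    using plane_expansion[of Q p d e] by blast
  have at0: "(\<Sum>j\<le>N. poly (g j) x * 0 ^ j) = poly (g 0) x" for x
  proof -
    have "(\<Sum>j\<le>N. poly (g j) x * 0 ^ j) = (\<Sum>j\<le>N. if j = 0 then poly (g 0) x else 0)" by (intro sum.cong) auto
    then show ?thesis by simp
  qed
  have g0: "poly (g 0) x = x ^ 2 * poly A x" for x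
    using g[of x 0] at0[of x] poly_line_poly[of Q p d x] order(1) by simp
  have "line_poly Q p e = (\<Sum>j\<le>N. monom (poly (g j) 0) j)"
  proof (rule line_poly_eqI)
    fix t show "form_val Q (p + t *s e) = poly (\<Sum>j\<le>N. monom (poly (g j) 0) j) t"
      using g[of 0 t] by (simp add: poly_sum poly_monom)
  qed
  then have "grad Q p e = poly (g 1) 0" using N by (simp add: grad_def coeff_sum)
  then have g1: "poly (g 1) 0 \<noteq> 0" using grad by (simp add: e_def)
  have germ: "germ_equiv {(x, y). y * (\<Sum>j\<le>N. poly (g j) x * y ^ j) = 0} tacnode"
    by (rule tacnode_germ[where A = "poly A", OF _ _ order(2) g0 g1 N]) (auto intro!: continuous_intros)
  have e': "x0 * \<alpha> + y0 * \<beta> = 1" using e by (simp add: mult.commute)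
  have "germ_equiv {(x, y). y * (\<Sum>j\<le>N. poly (g j) x * y ^ j) = 0}
     {(s, t). (\<alpha> * s + \<beta> * t) * form_val Q (p + s *s u + t *s v) = 0}"
  proof (rule germ_equiv_linear[of \<beta> y0 x0 "- \<alpha>"])
    show "\<beta> * y0 - x0 * - \<alpha> \<noteq> 0" using e by (simp add: mult.commute add.commute)
    fix x y
    have "p + (\<beta> * x + x0 * y) *s u + (- \<alpha> * x + y0 * y) *s v = p + x *s d + y *s e"
      by (simp add: d e_def vec_eq_iff algebra_simps)
    moreover have "\<alpha> * (\<beta> * x + x0 * y) + \<beta> * (- \<alpha> * x + y0 * y) = y * (\<alpha> * x0 + \<beta> * y0)" by (simp add: algebra_simps)
    then have "\<alpha> * (\<beta> * x + x0 * y) + \<beta> * (- \<alpha> * x + y0 * y) = y" using e by simp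
    ultimately show "(x, y) \<in> {(x, y). y * (\<Sum>j\<le>N. poly (g j) x * y ^ j) = 0} \<longleftrightarrow>
        (\<beta> * x + x0 * y, - \<alpha> * x + y0 * y) \<in> {(s, t). (\<alpha> * s + \<beta> * t) * form_val Q (p + s *s u + t *s v) = 0}"
      by (simp only: mem_Collect_eq prod.case g)
  qed
  then show ?thesis using germ germ_equiv_sym germ_equiv_trans by blast
qed

lemma two_lines_germ:
  assumes "\<alpha> * \<beta>' - \<beta> * \<alpha>' \<noteq> (0::complex)"
  shows "germ_equiv {(s, t). (\<alpha> * s + \<beta> * t) * (\<alpha>' * s + \<beta>' * t) = 0} node"
  by (rule germ_equiv_linear[OF assms]) (simp add: node_def)

text \<open>Components that do not pass through the point do not affect the germ.\<close>

lemma affine_zeros_local: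
  assumes P: "frame P = (p, u, v)" and G: "form_val G p \<noteq> 0"
  shows "germ_equiv (affine_zeros (F * G) P) {(s, t). form_val F (p + s *s u + t *s v) = 0}"
proof -
  define f where "f = (\<lambda>(s, t). form_val G (p + s *s u + t *s v))"
  have "continuous_on UNIV f" unfolding f_def case_prod_beta
    by (rule continuous_on_compose2[OF continuous_on_form_val[of UNIV]])
      (auto intro!: continuous_intros simp: vector_scalar_mult_def)
  then have "open (f -` (- {0}))" by (intro open_vimage) auto
  moreover have "0 \<in> f -` (- {0})" using G by (simp add: f_def zero_prod_def)
  ultimately show ?thesis
    by (rule germ_equiv_local) (auto simp: f_def affine_zeros_def P)
qed

section \<open>Irreducible factors, fibres and lines\<close>

lemma assoc_class_eq_iff: "assoc_class a = assoc_class b \<longleftrightarrow> a dvd b \<and> b dvd (a :: 'a::comm_semiring_1)"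
proof
  assume *: "assoc_class a = assoc_class b"
  have "b \<in> assoc_class b" by (simp add: assoc_class_def)
  then have "b \<in> assoc_class a" using * by simp
  then show "a dvd b \<and> b dvd a" by (simp add: assoc_class_def)
next
  assume "a dvd b \<and> b dvd a"
  then show "assoc_class a = assoc_class b"
    unfolding assoc_class_def using dvd_trans by blast
qed

lemma assoc_class_self: "a \<in> assoc_class a"
  by (simp add: assoc_class_def)

lemma irreducible_dvd_irreducible:
  fixes g a :: "'a::idom"
  assumes "irreducible a" "g dvd a" "\<not> g dvd 1" shows "a dvd g"
proof -
  obtain k where k: "a = g * k" using assms(2) by (auto simp: dvd_def)
  then have "k dvd 1" using irreducibleD[OF assms(1) k] assms(3) by blast
  then obtain m where "1 = k * m" by (auto simp: dvd_def)
  then have "g = a * m" using k by (metis mult.assoc mult.right_neutral)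
  then show ?thesis by simp
qed

text \<open>A prime factor \<open>B i\<close> is either associated to \<open>g\<close> or can be cancelled from the product; what remains at the end
is \<open>A\<close>, which has to be irreducible but not prime. Primality is needed only for products that divide
\<open>M\<close>. In the polynomial ring \<open>M\<close> is taken to be a form, so that only products of forms occur; in
the power series ring it is 0, which is no restriction.\<close>

lemma irreducible_divisor_of_product:
  fixes g A u :: "'a::idom" and B :: "nat \<Rightarrow> 'a"
  assumes "finite I" and g: "irreducible g" "g dvd A * (\<Prod>i\<in>I. B i) * u" and u: "u dvd 1"
    and M: "A * (\<Prod>i\<in>I. B i) * u dvd M"
    and A: "irreducible A" and B: "\<And>i. i \<in> I \<Longrightarrow> irreducible (B i)"
    and prime: "\<And>i x y. i \<in> I \<Longrightarrow> x * y dvd M \<Longrightarrow> B i dvd x * y \<Longrightarrow> B i dvd x \<or> B i dvd y"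
  shows "assoc_class g = assoc_class A \<or> (\<exists>i\<in>I. assoc_class g = assoc_class (B i))"
  using assms(1) g(2) M B prime
proof (induction I rule: finite_induct)
  case empty
  then obtain k where k: "A * u = g * k" by (auto simp: dvd_def)
  obtain w where w: "1 = u * w" using u by (auto simp: dvd_def)
  have "A = A * u * w" using w by (simp add: mult.assoc)
  then have "A = g * (k * w)" using k by (simp add: mult.assoc)
  then have "g dvd A" by simp
  then show ?case using irreducible_dvd_irreducible[OF A] g(1) by (auto simp: assoc_class_eq_iff irreducible_not_unit)
next
  case (insert j I)
  let ?R = "A * (\<Prod>i\<in>I. B i) * u"
  have eq: "A * (\<Prod>i\<in>insert j I. B i) * u = B j * ?R" using insert.hyps by (simp add: mult_ac)
  obtain h where h: "B j * ?R = g * h" using insert.prems(1) unfolding eq by (auto simp: dvd_def)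
  have "g * h dvd M" using insert.prems(2) unfolding eq h .
  moreover have "B j dvd g * h" unfolding h[symmetric] by simp
  ultimately have "B j dvd g \<or> B j dvd h" using insert.prems(4) by blast
  then show ?case
  proof
    assume *: "B j dvd g"
    have "\<not> B j dvd 1" using insert.prems(3)[of j] by (simp add: irreducible_not_unit)
    from irreducible_dvd_irreducible[OF g(1) * this] * show ?thesis by (auto simp: assoc_class_eq_iff)
  next
    assume "B j dvd h"
    then obtain h' where h': "h = B j * h'" by (auto simp: dvd_def)
    have "B j \<noteq> 0" using insert.prems(3)[of j] by (auto simp: irreducible_def)
    moreover have "B j * ?R = B j * (g * h')" using h h' by (simp add: mult_ac)
    ultimately have "?R = g * h'" by simp
    then have "g dvd ?R" by simp
    moreover have "?R dvd M" using insert.prems(2) unfolding eq by (rule dvd_mult_right)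
    ultimately have "assoc_class g = assoc_class A \<or> (\<exists>i\<in>I. assoc_class g = assoc_class (B i))"
      using insert.prems(3,4) by (intro insert.IH) auto
    then show ?thesis by blast
  qed
qed

lemma irreducible_linear_form:
  assumes "l \<in> forms 1" shows "irreducible l"
proof (rule irreducibleI)
  show "l \<noteq> 0" using assms by (simp add: forms_def)
  show "\<not> l dvd 1" using total_degree_unit[of l] total_degree_form[OF assms] by auto
  fix G H assume GH: "l = G * H"
  have nz: "G \<noteq> 0" "H \<noteq> 0" "G * H \<noteq> 0" "homogeneous 1 (G * H)" using assms GH by (auto simp: forms_def)
  note h = homogeneous_factors[OF nz(4,3)]
  have f: "form_in UNIV (total_degree G) G" "form_in UNIV (total_degree H) H" using h by (simp_all add: homogeneous_form_in)
  have "total_degree G = 0 \<or> total_degree H = 0" using h(3) by linarith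
  then show "G dvd 1 \<or> H dvd 1" using f nz form_degree_0_unit by metis
qed

lemma grad_linear_form:
  assumes l: "form_in UNIV 1 l" shows "grad l p v = form_val l v"
proof -
  have "line_poly l p v = [:form_val l p, form_val l v:]"
    by (rule line_poly_eqI) (simp add: linear_form_add[OF l] linear_form_scale[OF l])
  then show ?thesis by (simp add: grad_def)
qed

text \<open>The bijections between corresponding fibres are glued.\<close>

lemma matching_fibres:
  assumes fin: "\<And>t. t \<in> T \<Longrightarrow> finite {x \<in> X. f x = t} \<and> finite {y \<in> Y. g y = \<tau> t}"
    and card: "\<And>t. t \<in> T \<Longrightarrow> card {x \<in> X. f x = t} = card {y \<in> Y. g y = \<tau> t}"
    and inj: "inj_on \<tau> T" and X: "\<And>x. x \<in> X \<Longrightarrow> f x \<in> T" and Y: "\<And>y. y \<in> Y \<Longrightarrow> g y \<in> \<tau> ` T"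
  obtains \<sigma> where "bij_betw \<sigma> X Y" "\<And>x. x \<in> X \<Longrightarrow> g (\<sigma> x) = \<tau> (f x)"
proof -
  have "\<forall>t\<in>T. \<exists>h. bij_betw h {x \<in> X. f x = t} {y \<in> Y. g y = \<tau> t}"
    using fin card finite_same_card_bij by blast
  then obtain h where h: "\<And>t. t \<in> T \<Longrightarrow> bij_betw (h t) {x \<in> X. f x = t} {y \<in> Y. g y = \<tau> t}" by metis
  define \<sigma> where "\<sigma> x = h (f x) x" for x
  have \<sigma>: "\<sigma> x \<in> Y \<and> g (\<sigma> x) = \<tau> (f x)" if "x \<in> X" for x
    using bij_betwE[OF h[OF X[OF that]]] that by (auto simp: \<sigma>_def)
  have "inj_on \<sigma> X"
  proof (rule inj_onI)
    fix x x' assume x: "x \<in> X" "x' \<in> X" "\<sigma> x = \<sigma> x'"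
    then have "\<tau> (f x) = \<tau> (f x')" using \<sigma> by metis
    then have eq: "f x = f x'" using inj X x by (auto dest: inj_onD)
    have "inj_on (h (f x)) {y \<in> X. f y = f x}" using h[OF X[OF x(1)]] by (simp add: bij_betw_def)
    then show "x = x'" using x eq unfolding \<sigma>_def by (auto dest: inj_onD)
  qed
  moreover have "y \<in> \<sigma> ` X" if y: "y \<in> Y" for y
  proof -
    obtain t where t: "t \<in> T" "g y = \<tau> t" using Y[OF y] by blast
    then have "y \<in> h t ` {x \<in> X. f x = t}" using h[OF t(1)] y by (simp add: bij_betw_def)
    then show ?thesis by (auto simp: \<sigma>_def)
  qed
  ultimately have "bij_betw \<sigma> X Y" using \<sigma> by (auto simp: bij_betw_def)
  then show ?thesis using that \<sigma> by blast
qed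

text \<open>The line \<open>l\<close> through \<open>P\<close> in the coordinates of the frame at \<open>P\<close> is \<open>l(u) s + l(v) t = 0\<close>, with direction \<open>(l(v), - l(u))\<close>.\<close>

lemma frame_line:
  assumes P: "P \<in> proj_plane" "frame P = (p, u, v)" and l: "l \<in> forms 1" and lp: "form_val l p = 0"
  defines "d \<equiv> form_val l v *s u + (- form_val l u) *s v"
  shows "form_val l u \<noteq> 0 \<or> form_val l v \<noteq> 0" "{x. form_val l x = 0} = vec.span {p, d}"
proof -
  note lf = forms_1_form_in[OF l]
  note fr = frame_spec[OF P]
  have comb: "form_val l (a *s p + (b *s u + c *s v)) = b * form_val l u + c * form_val l v" for a b c
    by (simp add: linear_form_add[OF lf] linear_form_scale[OF lf] lp)
  show nz: "form_val l u \<noteq> 0 \<or> form_val l v \<noteq> 0"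
  proof (rule ccontr)
    assume *: "\<not> ?thesis"
    have "form_val l x = 0" for x
    proof -
      obtain a b c where "x = a *s p + (b *s u + c *s v)" by (rule frame_combination[OF fr(2)])
      then show ?thesis using comb * by simp
    qed
    then show False using form_zero_if_vanishes l by (auto simp: forms_def)
  qed
  have ld: "form_val l d = 0" using comb[of 0 "form_val l v" "- form_val l u"] by (simp add: d_def mult.commute)
  show "{x. form_val l x = 0} = vec.span {p, d}"
  proof (intro set_eqI iffI)
    fix x assume "x \<in> {x. form_val l x = 0}"
    obtain a b c where x: "x = a *s p + (b *s u + c *s v)" by (rule frame_combination[OF fr(2)])
    then have 0: "b * form_val l u + c * form_val l v = 0" using comb \<open>x \<in> _\<close> by simp
    have "\<exists>k. b = k * form_val l v \<and> c = k * (- form_val l u)"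
    proof (cases "form_val l u = 0")
      case True
      then show ?thesis using nz 0 by (intro exI[of _ "b / form_val l v"]) simp
    next
      case False
      have "b * form_val l u = - (c * form_val l v)" using 0 by (simp add: eq_neg_iff_add_eq_0)
      then have "b = - (c * form_val l v) / form_val l u" using False by (simp add: field_simps)
      then show ?thesis using False by (intro exI[of _ "- c / form_val l u"]) simp
    qed
    then obtain k where "b = k * form_val l v" "c = k * (- form_val l u)" by blast
    then have "x = a *s p + k *s d" unfolding x d_def by (simp add: vector_add_ldistrib vector_ssub_ldistrib)
    then show "x \<in> vec.span {p, d}" unfolding span_pair by blast
  next
    fix x assume "x \<in> vec.span {p, d}"
    then obtain a b where "x = a *s p + b *s d" unfolding span_pair by blast
    then show "x \<in> {x. form_val l x = 0}" using linear_form_combination[OF lf] lp ld by simp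
  qed
qed

text \<open>On the first plane, with basis \<open>e\<close> and \<open>f\<close>, the second equation has the solution \<open>l2(f) e - l2(e) f\<close>, unique up to a scalar.\<close>

lemma two_lines_meet_once:
  assumes l: "l1 \<in> forms 1" "l2 \<in> forms 1" and ne: "\<not> vanishes_on l1 l2"
  shows "\<exists>P. {R. on_curve R l1 \<and> on_curve R l2} = {P}"
proof -
  note lf = forms_1_form_in[OF l(1)] forms_1_form_in[OF l(2)]
  obtain e f where ef: "{x. form_val l1 x = 0} = vec.span {e, f}" "e \<noteq> 0" "f \<notin> vec.span {e}"
    by (rule exists_plane_basis[OF l(1)])
  have l1: "form_val l1 e = 0" "form_val l1 f = 0" using ef(1) vec.span_base[of e "{e, f}"] vec.span_base[of f "{e, f}"] by auto
  define p where "p = form_val l2 f *s e + (- form_val l2 e) *s f"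
  have lp: "form_val l1 p = 0" "form_val l2 p = 0"
    using l1 unfolding p_def linear_form_combination[OF lf(1)] linear_form_combination[OF lf(2)] by simp_all
  have p: "p \<noteq> 0"
  proof
    assume p0: "p = 0"
    have "form_val l2 e \<noteq> 0 \<or> form_val l2 f \<noteq> 0"
    proof (rule ccontr)
      assume *: "\<not> ?thesis"
      have "vanishes_on l1 l2" unfolding vanishes_on_def
      proof (intro allI impI)
        fix x assume "form_val l1 x = 0"
        then have "x \<in> vec.span {e, f}" using ef(1) by auto
        then obtain a b where "x = a *s e + b *s f" unfolding span_pair by blast
        then show "form_val l2 x = 0" using * linear_form_combination[OF lf(2)] by simp
      qed
      then show False using ne by simp
    qed
    moreover have eq: "form_val l2 f *s e = form_val l2 e *s f" using p0 by (simp add: p_def)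
    ultimately show False
    proof (cases "form_val l2 e = 0")
      case True
      then show ?thesis using eq ef(2) \<open>form_val l2 e \<noteq> 0 \<or> form_val l2 f \<noteq> 0\<close> by simp
    next
      case False
      have "f = (1 / form_val l2 e) *s (form_val l2 e *s f)" using False by simp
      also have "\<dots> = (form_val l2 f / form_val l2 e) *s e" unfolding eq[symmetric] by simp
      finally show ?thesis using ef(3) unfolding span_1 by blast
    qed
  qed
  obtain e1 e2 where b: "\<forall>x. \<exists>z. x = z *s p + (form_val l2 x *s e1 + form_val l1 x *s e2)"
    by (rule two_lines_basis[OF l ne p lp])
  have "{R. on_curve R l1 \<and> on_curve R l2} = {vec.span {p}}"
  proof (intro set_eqI iffI)
    fix R assume "R \<in> {R. on_curve R l1 \<and> on_curve R l2}"
    then have R: "on_curve R l1" "on_curve R l2" by auto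
    then have "R \<in> proj_plane" by (simp add: on_curve_def)
    then obtain z where z: "z \<noteq> 0" "R = vec.span {z}" by (rule proj_plane_E)
    have "form_val l1 z = 0" "form_val l2 z = 0"
      using R on_curve_span[OF z(1) lf(1)] on_curve_span[OF z(1) lf(2)] z(2) by auto
    then obtain c where c: "z = c *s p" using b[rule_format, of z] by auto
    then have "c \<noteq> 0" using z(1) by auto
    then show "R \<in> {vec.span {p}}" using span_eq_iff[OF p z(1)] c z(2) by auto
  next
    fix R assume "R \<in> {vec.span {p}}"
    then show "R \<in> {R. on_curve R l1 \<and> on_curve R l2}"
      using on_curve_span[OF p lf(1)] on_curve_span[OF p lf(2)] lp by auto
  qed
  then show ?thesis by blast
qed

lemma local_linear_dvd:
  assumes P: "P \<in> proj_plane" "frame P = (p, u, v)" and l: "l \<in> forms 1" and lp: "form_val l p = 0"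
  shows "local_equation l P dvd local_equation F P \<longleftrightarrow>
    line_poly F p (form_val l v *s u + (- form_val l u) *s v) = 0"
  unfolding local_equation_line[OF P(2) forms_1_form_in[OF l] lp] linear_fps_dvd_iff[OF frame_line(1)[OF P l lp]]
    restrict_local_equation[OF P(2)] by simp

section \<open>The curve formed by a general quartic and some of its bitangents\<close>

text \<open>The components of the curve are indexed by numbers, with 0 for the quartic; the bitangents are numbered from 1.\<close>

definition component_form :: "3 mpoly \<Rightarrow> (nat \<Rightarrow> 3 mpoly) \<Rightarrow> nat \<Rightarrow> 3 mpoly" where
  "component_form Q L a = (if a = 0 then Q else L a)"

definition incident :: "3 mpoly \<Rightarrow> (nat \<Rightarrow> 3 mpoly) \<Rightarrow> nat set \<Rightarrow> (complex^3) set \<Rightarrow> nat set" where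
  "incident Q L I P = {a \<in> insert 0 I. on_curve P (component_form Q L a)}"

lemma vanishes_on_iff_dvd:
  assumes "l \<in> forms 1" "form_in UNIV d F" shows "vanishes_on l F \<longleftrightarrow> l dvd F"
proof
  assume "vanishes_on l F"
  then obtain G where "F = l * G" by (rule vanishes_on_dvd[OF assms])
  then show "l dvd F" by simp
qed (rule dvd_vanishes_on)

text \<open>Everything below is expressed through the incidence sets \<open>inc P\<close>: the combinatorics of the curve is determined by
which components pass through each singular point.\<close>

locale bitangent_arrangement =
  fixes Q :: "3 mpoly" and L :: "nat \<Rightarrow> 3 mpoly" and I :: "nat set"
  assumes general: "general_quartic Q" and finite_I: "finite I" and zero_notin: "0 \<notin> I"
    and bitangents: "\<And>i. i \<in> I \<Longrightarrow> bitangent Q (L i)"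
    and distinct: "\<And>i j. i \<in> I \<Longrightarrow> j \<in> I \<Longrightarrow> i \<noteq> j \<Longrightarrow> \<not> vanishes_on (L i) (L j)"
begin

abbreviation "C \<equiv> component_form Q L"
abbreviation "T \<equiv> insert 0 I"
abbreviation "inc \<equiv> incident Q L I"
abbreviation "F \<equiv> Q * (\<Prod>i\<in>I. L i)"

lemma Q_smooth: "Q \<in> smooth_quartics" and Q_irreducible: "irreducible Q"
  and no_hyperflex: "\<exists>i j k. Q \<in> hyperflex_quartics i j k \<Longrightarrow> False"
  and no_concurrent: "\<exists>i j k. Q \<in> concurrent_quartics i j k \<Longrightarrow> False"
  using general by (auto simp: general_quartic_def)

lemma Q_form: "form_in UNIV 4 Q" "Q \<in> forms 4"
  using Q_smooth smooth_quartic_form[OF Q_smooth] by (auto simp: smooth_quartics_def)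

lemma C_simps: "C 0 = Q" "i \<in> I \<Longrightarrow> C i = L i"
  using zero_notin by (auto simp: component_form_def)

lemma L_form: "i \<in> I \<Longrightarrow> L i \<in> forms 1" "i \<in> I \<Longrightarrow> form_in UNIV 1 (L i)"
  using bitangents bitangent_forms forms_1_form_in by blast+

lemma C_forms: "a \<in> T \<Longrightarrow> C a \<in> forms (if a = 0 then 4 else 1)"
  using Q_form L_form(1) zero_notin by (auto simp: C_simps)

lemma C_form_in: "a \<in> T \<Longrightarrow> form_in UNIV (if a = 0 then 4 else 1) (C a)"
  using C_forms forms_iff by blast

lemma F_eq: "F = (\<Prod>a\<in>T. C a)"
  using finite_I zero_notin by (simp add: C_simps)

lemma F_split: "a \<in> T \<Longrightarrow> F = C a * (\<Prod>c\<in>T - {a}. C c)"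
  unfolding F_eq using finite_I by (intro prod.remove) auto

lemma C_dvd_F: "a \<in> T \<Longrightarrow> C a dvd F"
  by (rule dvdI[OF F_split])

lemma F_form: "form_in UNIV (\<Sum>a\<in>T. if a = 0 then 4 else 1) F"
  unfolding F_eq by (rule form_in_prod) (rule C_form_in)

lemma F_nonzero: "F \<noteq> 0"
proof -
  have "C a \<noteq> 0" if "a \<in> T" for a using C_forms[OF that] by (simp add: forms_def)
  then show ?thesis unfolding F_eq using finite_I by (simp add: prod_zero_iff)
qed

lemma C_irreducible: "a \<in> T \<Longrightarrow> irreducible (C a)"
  using Q_irreducible irreducible_linear_form[OF L_form(1)] by (auto simp: C_simps)

lemma inc_span: "p \<noteq> 0 \<Longrightarrow> a \<in> inc (vec.span {p}) \<longleftrightarrow> a \<in> T \<and> form_val (C a) p = 0"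
  unfolding incident_def using on_curve_span[of p UNIV _ "C a"] C_form_in[of a] by blast

lemma inc_subset: "inc P \<subseteq> T"
  by (auto simp: incident_def)

text \<open>Three components through a point are either the quartic and two bitangents or three bitangents, and both are excluded.\<close>

lemma not_three:
  assumes "P \<in> proj_plane" "a \<in> inc P" "b \<in> inc P" "c \<in> inc P" "a \<noteq> b" "a \<noteq> c" "b \<noteq> c"
  shows False
proof -
  obtain p where p: "p \<noteq> 0" "P = vec.span {p}" using assms(1) by (rule proj_plane_E)
  have on: "x \<in> T" "form_val (C x) p = 0" if "x \<in> inc P" for x using that inc_span[OF p(1)] p(2) by auto
  have no_Q: False if "0 \<in> inc P" "i \<in> inc P" "j \<in> inc P" "i \<noteq> j" "i \<noteq> 0" "j \<noteq> 0" for i j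
  proof -
    have ij: "i \<in> I" "j \<in> I" using on that by auto
    show False using no_contact_on_two_bitangents[OF Q_smooth bitangents[OF ij(1)] bitangents[OF ij(2)] distinct[OF ij that(4)] p(1)]
      on(2)[OF that(1)] on(2)[OF that(2)] on(2)[OF that(3)] ij by (simp add: C_simps)
  qed
  show False
  proof (cases "0 \<in> {a, b, c}")
    case True
    then show False using no_Q assms by (metis empty_iff insert_iff)
  next
    case False
    then have abc: "a \<in> I" "b \<in> I" "c \<in> I" using on assms by auto
    have "concurrent (L a) (L b) (L c)"
      using assms(2-4) abc unfolding concurrent_def incident_def by (auto simp: C_simps)
    then show False
      using no_concurrent concurrent_bitangents_in_family[OF Q_smooth bitangents[OF abc(1)] bitangents[OF abc(2)] bitangents[OF abc(3)]]
        distinct abc assms(5-7) by blast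
  qed
qed

lemma grad_C:
  assumes "p \<noteq> 0" "a \<in> T" "form_val (C a) p = 0"
  shows "\<exists>v. grad (C a) p v \<noteq> 0"
proof (cases "a = 0")
  case True
  then show ?thesis using smooth_quartic_grad[OF Q_smooth assms(1)] assms(3) by (simp add: C_simps)
next
  case False
  then have a: "a \<in> I" using assms by simp
  have "\<exists>v. form_val (L a) v \<noteq> 0" using form_zero_if_vanishes L_form(1)[OF a] by (auto simp: forms_def)
  then show ?thesis using a by (simp add: C_simps grad_linear_form[OF L_form(2)])
qed

text \<open>By the product rule the gradient of a product vanishes where two factors vanish; where only one factor vanishes, it is a nonzero multiple of the gradient of this factor, and each component is smooth.\<close>

lemma singular_iff:
  "P \<in> singular_points F \<longleftrightarrow> P \<in> proj_plane \<and> (\<exists>a b. a \<noteq> b \<and> inc P = {a, b})"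
proof (cases "P \<in> proj_plane")
  case False
  then show ?thesis by (auto simp: singular_points_def on_curve_def)
next
  case True
  then obtain p where p: "p \<noteq> 0" "P = vec.span {p}" by (rule proj_plane_E)
  have on: "x \<in> inc P \<longleftrightarrow> x \<in> T \<and> form_val (C x) p = 0" for x using inc_span[OF p(1)] p(2) by auto
  have sing: "P \<in> singular_points F \<longleftrightarrow> form_val F p = 0 \<and> (\<forall>v. grad F p v = 0)"
    unfolding p(2) by (rule singular_points_span[OF p(1) F_form])
  show ?thesis
  proof
    assume P: "P \<in> singular_points F"
    then have "form_val F p = 0" using sing by simp
    then obtain a where a: "a \<in> T" "form_val (C a) p = 0"
      unfolding F_eq form_val_prod using finite_I by (auto simp: prod_zero_iff)
    obtain v where v: "grad (C a) p v \<noteq> 0" using grad_C[OF p(1) a] by blast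
    have "grad F p v = 0" using P sing by simp
    then have "form_val (\<Prod>c\<in>T - {a}. C c) p = 0"
      unfolding F_split[OF a(1)] grad_mult using a(2) v by simp
    then obtain b where b: "b \<in> T - {a}" "form_val (C b) p = 0"
      unfolding form_val_prod using finite_I by (auto simp: prod_zero_iff)
    have "inc P = {a, b}" using not_three[OF True] a b on by blast
    then show "P \<in> proj_plane \<and> (\<exists>a b. a \<noteq> b \<and> inc P = {a, b})" using True b by blast
  next
    assume "P \<in> proj_plane \<and> (\<exists>a b. a \<noteq> b \<and> inc P = {a, b})"
    then obtain a b where ab: "a \<noteq> b" "inc P = {a, b}" by blast
    have a: "a \<in> T" "form_val (C a) p = 0" and b: "b \<in> T - {a}" "form_val (C b) p = 0"
      using on[of a] on[of b] ab by auto
    have 0: "form_val (\<Prod>c\<in>T - {a}. C c) p = 0"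
      unfolding form_val_prod using b finite_I by (auto simp: prod_zero_iff)
    then have "form_val F p = 0 \<and> (\<forall>v. grad F p v = 0)"
      unfolding F_split[OF a(1)] using a(2) by simp
    then show "P \<in> singular_points F" using sing by blast
  qed
qed

text \<open>A line meets the quartic only in its two contact points and another line in one point; by the preceding lemmas these points lie on no further component.\<close>

lemma fibre:
  assumes ab: "a \<in> T" "b \<in> T" "a \<noteq> b"
  shows "finite {P \<in> singular_points F. inc P = {a, b}}"
    "card {P \<in> singular_points F. inc P = {a, b}} = (if 0 \<in> {a, b} then 2 else 1)"
proof -
  have eq: "{P \<in> singular_points F. inc P = {x, y}} = {P. on_curve P (C x) \<and> on_curve P (C y)}"
    if "x \<in> T" "y \<in> T" "x \<noteq> y" for x y
  proof (intro set_eqI iffI)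
    fix P assume "P \<in> {P \<in> singular_points F. inc P = {x, y}}"
    then have "x \<in> inc P" "y \<in> inc P" by auto
    then show "P \<in> {P. on_curve P (C x) \<and> on_curve P (C y)}" by (auto simp: incident_def)
  next
    fix P assume P: "P \<in> {P. on_curve P (C x) \<and> on_curve P (C y)}"
    then have pp: "P \<in> proj_plane" by (auto simp: on_curve_def)
    have "x \<in> inc P" "y \<in> inc P" using P that by (auto simp: incident_def)
    then have "inc P = {x, y}" using not_three[OF pp] that(3) by blast
    then show "P \<in> {P \<in> singular_points F. inc P = {x, y}}" using singular_iff pp that(3) by blast
  qed
  have tac: "finite {P. on_curve P (C 0) \<and> on_curve P (C i)} \<and> card {P. on_curve P (C 0) \<and> on_curve P (C i)} = 2" if i: "i \<in> I" for i
  proof -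
    obtain P P' where "P \<noteq> P'" "{R. on_curve R Q \<and> on_curve R (L i)} = {P, P'}"
      by (rule true_bitangent_contacts[OF Q_form(1) bitangents[OF i] no_hyperflex])
    then show ?thesis using i by (simp add: C_simps)
  qed
  have nod: "finite {P. on_curve P (C i) \<and> on_curve P (C j)} \<and> card {P. on_curve P (C i) \<and> on_curve P (C j)} = 1"
    if ij: "i \<in> I" "j \<in> I" "i \<noteq> j" for i j
    using two_lines_meet_once[OF L_form(1)[OF ij(1)] L_form(1)[OF ij(2)] distinct[OF ij]] ij by (auto simp: C_simps)
  have all: "finite {P \<in> singular_points F. inc P = {a, b}} \<and>
    card {P \<in> singular_points F. inc P = {a, b}} = (if 0 \<in> {a, b} then 2 else 1)"
  proof (cases "a = 0")
    case True
    then show ?thesis using eq[OF ab] tac[of b] ab by auto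
  next
    case a: False
    show ?thesis
    proof (cases "b = 0")
      case True
      then show ?thesis using eq[of b a] tac[of a] ab a by (auto simp: insert_commute)
    next
      case False
      then show ?thesis using eq[OF ab] nod[of a b] ab a by auto
    qed
  qed
  then show "finite {P \<in> singular_points F. inc P = {a, b}}"
    "card {P \<in> singular_points F. inc P = {a, b}} = (if 0 \<in> {a, b} then 2 else 1)" by auto
qed

lemma component_degree:
  assumes a: "a \<in> T" and G: "G \<in> assoc_class (C a)" shows "total_degree G = (if a = 0 then 4 else 1)"
proof -
  have G: "C a dvd G" "G dvd C a" using G by (auto simp: assoc_class_def)
  obtain k where k: "C a = G * k" using G(2) by (auto simp: dvd_def)
  obtain m where m: "G = C a * m" using G(1) by (auto simp: dvd_def)
  have nz: "C a \<noteq> 0" using C_forms[OF a] by (simp add: forms_def)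
  then have nz': "G \<noteq> 0" "k \<noteq> 0" using k by auto
  then have "m \<noteq> 0" using m by auto
  have "total_degree (C a) = total_degree G + total_degree k"
    using total_degree_mult[OF nz'] unfolding k[symmetric] .
  moreover have "total_degree G = total_degree (C a) + total_degree m"
    using total_degree_mult[OF nz \<open>m \<noteq> 0\<close>] unfolding m[symmetric] .
  ultimately show ?thesis using total_degree_form[OF C_forms[OF a]] by simp
qed

lemma components_bij: "bij_betw (\<lambda>a. assoc_class (C a)) T (components F)"
proof -
  have "inj_on (\<lambda>a. assoc_class (C a)) T"
  proof (rule inj_onI, rule ccontr)
    fix a b assume ab: "a \<in> T" "b \<in> T" "assoc_class (C a) = assoc_class (C b)" "a \<noteq> b"
    have dvd: "C a dvd C b" "C b dvd C a" using ab(3) unfolding assoc_class_eq_iff by simp_all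
    have "C b \<in> assoc_class (C a)" unfolding ab(3) by (rule assoc_class_self)
    from trans[OF component_degree[OF ab(1) this, symmetric] component_degree[OF ab(2) assoc_class_self]]
    have "a = 0 \<longleftrightarrow> b = 0" by (cases "a = 0"; cases "b = 0") simp_all
    then have "a \<in> I" "b \<in> I" using ab by auto
    then show False using distinct[of a b] ab(4) dvd_vanishes_on[OF dvd(1)] by (simp add: C_simps)
  qed
  moreover have "(\<lambda>a. assoc_class (C a)) ` T = components F"
  proof (intro set_eqI iffI)
    fix K assume "K \<in> (\<lambda>a. assoc_class (C a)) ` T"
    then obtain a where a: "a \<in> T" "K = assoc_class (C a)" by blast
    show "K \<in> components F"
      unfolding components_def irreducible_factors_def using C_dvd_F[OF a(1)] a(2) C_irreducible[OF a(1)]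
      by (intro CollectI exI[of _ "C a"] conjI)
  next
    fix K assume "K \<in> components F"
    then obtain g where g: "K = assoc_class g" "irreducible g" "g dvd F"
      unfolding components_def irreducible_factors_def by blast
    have "assoc_class g = assoc_class Q \<or> (\<exists>i\<in>I. assoc_class g = assoc_class (L i))"
    proof (rule irreducible_divisor_of_product[where u = 1 and M = F])
      fix i x y assume i: "i \<in> I" and xy: "x * y dvd F" and d: "L i dvd x * y"
      obtain z where z: "F = (x * y) * z" using xy by (rule dvdE)
      have hF: "homogeneous (\<Sum>a\<in>T. if a = 0 then 4 else 1) ((x * y) * z)"
        using F_form unfolding z homogeneous_form_in .
      have xyz: "(x * y) * z \<noteq> 0" using F_nonzero unfolding z .
      have h1: "homogeneous (total_degree (x * y)) (x * y)" by (rule homogeneous_factors(1)[OF hF xyz])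
      have nz: "x * y \<noteq> 0" using xyz by auto
      have f: "form_in UNIV (total_degree x) x" "form_in UNIV (total_degree y) y"
        using homogeneous_factors(1,2)[OF h1 nz] by (simp_all add: homogeneous_form_in)
      have "vanishes_on (L i) x \<or> vanishes_on (L i) y"
        by (rule vanishes_on_mult[OF L_form(1)[OF i] f dvd_vanishes_on[OF d]])
      then show "L i dvd x \<or> L i dvd y"
        using vanishes_on_iff_dvd[OF L_form(1)[OF i] f(1)] vanishes_on_iff_dvd[OF L_form(1)[OF i] f(2)] by simp
    next
      show "irreducible (L i)" if "i \<in> I" for i by (rule irreducible_linear_form[OF L_form(1)[OF that]])
    qed (simp_all add: g finite_I Q_irreducible)
    then show "K \<in> (\<lambda>a. assoc_class (C a)) ` T"
    proof
      assume "assoc_class g = assoc_class Q"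
      then show ?thesis unfolding g(1) by (intro image_eqI[of _ _ 0]) (simp_all add: C_simps)
    next
      assume "\<exists>i\<in>I. assoc_class g = assoc_class (L i)"
      then obtain i where "i \<in> I" "assoc_class g = assoc_class (L i)" by blast
      then show ?thesis unfolding g(1) by (intro image_eqI[of _ _ i]) (simp_all add: C_simps)
    qed
  qed
  ultimately show ?thesis by (simp add: bij_betw_def)
qed

text \<open>The two intersection points are the two contact points, and the order can be computed in the frame.\<close>

lemma contact_order:
  assumes P: "P \<in> proj_plane" "frame P = (p, u, v)" and i: "i \<in> I" and on: "form_val (L i) p = 0" "form_val Q p = 0"
  defines "d \<equiv> form_val (L i) v *s u + (- form_val (L i) u) *s v"
  obtains A where "line_poly Q p d = [:0, 1:] ^ 2 * A" "poly A 0 \<noteq> 0"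
proof -
  note l = L_form[OF i]
  note p = frame_spec(1,3)[OF P]
  obtain P1 P2 where P12: "P1 \<noteq> P2" "{R. on_curve R Q \<and> on_curve R (L i)} = {P1, P2}"
    "intersection_number Q (L i) P1 = 2" "intersection_number Q (L i) P2 = 2"
    by (rule true_bitangent_contacts[OF Q_form(1) bitangents[OF i] no_hyperflex])
  have "on_curve P Q" "on_curve P (L i)"
    using on_curve_span[OF p(2) Q_form(1)] on_curve_span[OF p(2) l(2)] on p(1) by auto
  then have "P = P1 \<or> P = P2" using P12(2) by blast
  then have "intersection_number Q (L i) (vec.span {p}) = 2" using P12(3,4) p(1) by auto
  moreover have "{x. form_val (L i) x = 0} = vec.span {p, d}" unfolding d_def by (rule frame_line(2)[OF P l(1) on(1)])
  ultimately have ord: "line_poly Q p d \<noteq> 0" "order 0 (line_poly Q p d) = 2"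
    using intersection_number_basis[OF Q_form(1) l(1) p(2), of d] by (auto simp: numeral_eq_enat split: if_splits)
  obtain A where A: "line_poly Q p d = [:- 0, 1:] ^ 2 * A" "\<not> [:- 0, 1:] dvd A"
    using order_decomp[OF ord(1), of 0] ord(2) by auto
  then have "line_poly Q p d = [:0, 1:] ^ 2 * A" "poly A 0 \<noteq> 0" by (simp_all add: poly_eq_0_iff_dvd)
  then show ?thesis using that by blast
qed

text \<open>At least one of the two components through \<open>P\<close> is a line, say \<open>b\<close>. Its local equation is prime, and it does not
divide that of \<open>a\<close>, as \<open>C a\<close> does not vanish identically on the line. The other factors of the
curve are units at \<open>P\<close>.\<close>

lemma local_structure:
  assumes P: "P \<in> proj_plane" and ab: "inc P = {a, b}" "a \<noteq> b" and b: "b \<noteq> 0"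
  shows "\<And>c c'. c \<in> inc P \<Longrightarrow> c' \<in> inc P \<Longrightarrow> local_equation (C c) P dvd local_equation (C c') P \<Longrightarrow> c = c'"
    "bij_betw (\<lambda>c. assoc_class (local_equation (C c) P)) (inc P) (branches F P)"
    "germ_equiv (affine_zeros F P) (if a = 0 then tacnode else node)"
    "\<And>c. c \<in> T \<Longrightarrow> local_equation (C c) P dvd 1 \<longleftrightarrow> c \<notin> inc P"
proof -
  obtain p u v where fr: "frame P = (p, u, v)" by (cases "frame P")
  note sp = frame_spec[OF P fr]
  have on: "c \<in> inc P \<longleftrightarrow> c \<in> T \<and> form_val (C c) p = 0" for c using inc_span[OF sp(3)] sp(1) by simp
  show unit: "\<And>c. c \<in> T \<Longrightarrow> local_equation (C c) P dvd 1 \<longleftrightarrow> c \<notin> inc P"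
    by (simp add: local_equation_unit[OF fr] on)
  have aT: "a \<in> T" "form_val (C a) p = 0" and bI: "b \<in> I" and bp: "form_val (L b) p = 0"
    using on[of a] on[of b] ab b by (auto simp: C_simps)
  have bT: "b \<in> T" using bI by simp
  have irr: "irreducible (local_equation (C c) P)" if "c \<in> inc P" for c
  proof -
    have c: "c \<in> T" "form_val (C c) p = 0" using that on by auto
    obtain w where "grad (C c) p w \<noteq> 0" using grad_C[OF sp(3) c] by blast
    then show ?thesis by (rule local_equation_irreducible[OF P fr C_form_in[OF c(1)] c(2)])
  qed
  define \<alpha> where "\<alpha> = form_val (L b) u"
  define \<beta> where "\<beta> = form_val (L b) v"
  define d where "d = \<beta> *s u + (- \<alpha>) *s v"
  note lb = L_form[OF bI]
  have ker: "{x. form_val (L b) x = 0} = vec.span {p, d}" and ab0: "\<alpha> \<noteq> 0 \<or> \<beta> \<noteq> 0"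
    unfolding d_def \<alpha>_def \<beta>_def using frame_line[OF P fr lb(1) bp] by auto
  have other_line: "form_val (L a) d \<noteq> 0" if a: "a \<in> I"
  proof
    assume 0: "form_val (L a) d = 0"
    have ap: "form_val (L a) p = 0" using aT a by (simp add: C_simps)
    have "vanishes_on (L b) (L a)" unfolding vanishes_on_def
    proof (intro allI impI)
      fix x assume "form_val (L b) x = 0"
      then have "x \<in> vec.span {p, d}" using ker by auto
      then obtain k m where "x = k *s p + m *s d" unfolding span_pair by blast
      then show "form_val (L a) x = 0" using linear_form_combination[OF L_form(2)[OF a]] ap 0 by simp
    qed
    then show False using distinct[OF bI a] ab(2) by blast
  qed
  have ndvd: "\<not> local_equation (C b) P dvd local_equation (C a) P"
  proof
    assume "local_equation (C b) P dvd local_equation (C a) P"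
    then have 0: "line_poly (C a) p d = 0"
      using local_linear_dvd[OF P fr lb(1) bp, of "C a"] bI by (simp add: C_simps d_def \<alpha>_def \<beta>_def)
    show False
    proof (cases "a = 0")
      case True
      obtain A where "line_poly Q p d = [:0, 1:] ^ 2 * A" "poly A 0 \<noteq> 0"
        unfolding d_def \<alpha>_def \<beta>_def using contact_order[OF P fr bI bp] aT True by (auto simp: C_simps)
      then show False using 0 True by (auto simp: C_simps)
    next
      case False
      then have a: "a \<in> I" using aT by simp
      have "grad (L a) p d = 0" using 0 a by (simp add: grad_def C_simps)
      then show False using other_line[OF a] grad_linear_form[OF L_form(2)[OF a]] by simp
    qed
  qed
  have ndvd': "\<not> local_equation (C a) P dvd local_equation (C b) P"
  proof
    assume *: "local_equation (C a) P dvd local_equation (C b) P"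
    have "\<not> local_equation (C a) P dvd 1" using unit[OF aT(1)] ab by simp
    from irreducible_dvd_irreducible[OF irr * this] show False using ndvd ab by simp
  qed
  show dvd: "\<And>c c'. c \<in> inc P \<Longrightarrow> c' \<in> inc P \<Longrightarrow> local_equation (C c) P dvd local_equation (C c') P \<Longrightarrow> c = c'"
    using ndvd ndvd' unfolding ab(1) by auto
  define G where "G = (\<Prod>c\<in>T - {b} - {a}. C c)"
  have Gp: "form_val G p \<noteq> 0"
    unfolding G_def form_val_prod using finite_I on ab by (auto simp: prod_zero_iff)
  have FG: "F = C a * C b * G"
  proof -
    have "(\<Prod>c\<in>T - {b}. C c) = C a * G" unfolding G_def using aT ab(2) finite_I by (intro prod.remove) auto
    then show ?thesis unfolding F_split[OF bT] by (simp add: mult_ac)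
  qed
  show "bij_betw (\<lambda>c. assoc_class (local_equation (C c) P)) (inc P) (branches F P)"
  proof -
    have "inj_on (\<lambda>c. assoc_class (local_equation (C c) P)) (inc P)"
      by (rule inj_onI) (auto simp: assoc_class_eq_iff dest: dvd)
    moreover have "(\<lambda>c. assoc_class (local_equation (C c) P)) ` inc P = branches F P"
    proof (intro set_eqI iffI)
      fix K assume "K \<in> (\<lambda>c. assoc_class (local_equation (C c) P)) ` inc P"
      then obtain c where c: "c \<in> inc P" "K = assoc_class (local_equation (C c) P)" by blast
      have "C c dvd F" using C_dvd_F c(1) inc_subset by blast
      then have "local_equation (C c) P dvd local_equation F P" by (rule hom_dvd[OF local_equation_hom])
      then show "K \<in> branches F P"
        unfolding branches_def irreducible_factors_def using irr[OF c(1)] c(2)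
        by (intro CollectI exI[of _ "local_equation (C c) P"] conjI)
    next
      fix K assume "K \<in> branches F P"
      then obtain g where g: "K = assoc_class g" "irreducible g" "g dvd local_equation F P"
        unfolding branches_def irreducible_factors_def by blast
      have "assoc_class g = assoc_class (local_equation (C a) P) \<or> (\<exists>i\<in>{b}. assoc_class g = assoc_class (local_equation (C i) P))"
      proof (rule irreducible_divisor_of_product[where u = "local_equation G P" and M = 0])
        show "g dvd local_equation (C a) P * (\<Prod>i\<in>{b}. local_equation (C i) P) * local_equation G P"
          using g(3) unfolding FG hom_mult[OF local_equation_hom] by simp
        show "local_equation G P dvd 1" using Gp by (simp add: local_equation_unit[OF fr])
        fix i x y assume "i \<in> {b}" "local_equation (C i) P dvd x * y"
        then show "local_equation (C i) P dvd x \<or> local_equation (C i) P dvd y"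
          using bI linear_fps_prime[OF ab0, of x y] local_equation_line[OF fr lb(2) bp]
          by (simp add: C_simps \<alpha>_def \<beta>_def)
      qed (use g irr ab in auto)
      then show "K \<in> (\<lambda>c. assoc_class (local_equation (C c) P)) ` inc P" using g(1) ab(1) by auto
    qed
    ultimately show ?thesis by (simp add: bij_betw_def)
  qed
  have Lval: "form_val l (p + s *s u + t *s v) = form_val l u * s + form_val l v * t"
    if "form_in UNIV 1 l" "form_val l p = 0" for l s t
    using that by (simp add: linear_form_add[OF that(1)] linear_form_scale[OF that(1)] mult.commute)
  have loc: "germ_equiv (affine_zeros F P) {(s, t). form_val (C a * C b) (p + s *s u + t *s v) = 0}"
    unfolding FG by (rule affine_zeros_local[OF fr Gp])
  show "germ_equiv (affine_zeros F P) (if a = 0 then tacnode else node)"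
  proof (cases "a = 0")
    case True
    have Qp: "form_val Q p = 0" using aT True by (simp add: C_simps)
    obtain A where A: "line_poly Q p d = [:0, 1:] ^ 2 * A" "poly A 0 \<noteq> 0"
      unfolding d_def \<alpha>_def \<beta>_def by (rule contact_order[OF P fr bI bp Qp])
    have "\<exists>x y. \<alpha> * x + \<beta> * y = 1"
    proof (cases "\<alpha> = 0")
      case True
      then show ?thesis using ab0 by (intro exI[of _ 0] exI[of _ "1 / \<beta>"]) simp
    next
      case False
      then show ?thesis by (intro exI[of _ "1 / \<alpha>"] exI[of _ 0]) simp
    qed
    then obtain x y where xy: "\<alpha> * x + \<beta> * y = 1" by blast
    have gd: "grad Q p d = 0" unfolding grad_def A(1) by (simp add: power2_eq_square)
    have "grad Q p (x *s u + y *s v) \<noteq> 0"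
    proof
      assume "grad Q p (x *s u + y *s v) = 0"
      then have 1: "x * grad Q p u + y * grad Q p v = 0" by (simp add: grad_plus grad_scale)
      have 2: "\<beta> * grad Q p u = \<alpha> * grad Q p v" using gd unfolding d_def grad_plus grad_scale by simp
      have "grad Q p u = (\<alpha> * x + \<beta> * y) * grad Q p u" using xy by simp
      also have "\<dots> = \<alpha> * (x * grad Q p u + y * grad Q p v) + y * (\<beta> * grad Q p u - \<alpha> * grad Q p v)"
        by (simp add: algebra_simps)
      finally have gu: "grad Q p u = 0" using 1 2 by simp
      have "grad Q p v = (\<alpha> * x + \<beta> * y) * grad Q p v" using xy by simp
      also have "\<dots> = \<beta> * (x * grad Q p u + y * grad Q p v) - x * (\<beta> * grad Q p u - \<alpha> * grad Q p v)"
        by (simp add: algebra_simps)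
      finally have gv: "grad Q p v = 0" using 1 2 by simp
      have "grad Q p w = 0" for w
      proof -
        obtain k m n where "w = k *s p + (m *s u + n *s v)" by (rule frame_combination[OF sp(2)])
        then show ?thesis using gu gv grad_euler[OF Q_form(1) Qp] by (simp add: grad_plus grad_scale)
      qed
      then show False using smooth_quartic_grad[OF Q_smooth sp(3) Qp] by blast
    qed
    then have "germ_equiv {(s, t). (\<alpha> * s + \<beta> * t) * form_val Q (p + s *s u + t *s v) = 0} tacnode"
      by (intro tangent_line_germ[where d = d and A = A and ?x0.0 = x and ?y0.0 = y] A xy) (simp_all add: d_def)
    moreover have "{(s, t). form_val (C a * C b) (p + s *s u + t *s v) = 0} =
        {(s, t). (\<alpha> * s + \<beta> * t) * form_val Q (p + s *s u + t *s v) = 0}"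
      using True bI by (auto simp: C_simps Lval[OF lb(2) bp] \<alpha>_def \<beta>_def)
    ultimately show ?thesis using loc germ_equiv_trans True by simp
  next
    case False
    then have a: "a \<in> I" using aT by simp
    have ap: "form_val (L a) p = 0" using aT a by (simp add: C_simps)
    have "form_val (L a) d = \<beta> * form_val (L a) u - \<alpha> * form_val (L a) v"
      unfolding d_def linear_form_combination[OF L_form(2)[OF a]] by simp
    then have det: "form_val (L a) u * \<beta> - form_val (L a) v * \<alpha> \<noteq> 0" using other_line[OF a] by (simp add: mult.commute)
    have "{(s, t). form_val (C a * C b) (p + s *s u + t *s v) = 0} =
        {(s, t). (form_val (L a) u * s + form_val (L a) v * t) * (\<alpha> * s + \<beta> * t) = 0}"
      using a bI by (auto simp: C_simps Lval[OF lb(2) bp] Lval[OF L_form(2)[OF a] ap] \<alpha>_def \<beta>_def)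
    then show ?thesis using loc two_lines_germ[OF det] germ_equiv_trans False by simp
  qed
qed

lemma singular_inc_pair:
  assumes "P \<in> singular_points F"
  obtains x y where "P \<in> proj_plane" "inc P = {x, y}" "x \<noteq> y" "y \<noteq> 0"
proof -
  obtain x y where xy: "P \<in> proj_plane" "inc P = {x, y}" "x \<noteq> y" using assms singular_iff by blast
  then show ?thesis using that[of x y] that[of y x] by (cases "y = 0") (auto simp: insert_commute)
qed

text \<open>Local equations of different components through \<open>P\<close> do not divide each other, and those of the other components are units.\<close>

lemma branch_of_iff:
  assumes P: "P \<in> singular_points F" and a: "a \<in> inc P" and c: "c \<in> T"
  shows "branch_of P (assoc_class (local_equation (C a) P)) (assoc_class (C c)) \<longleftrightarrow> a = c"
proof
  assume "a = c"
  then show "branch_of P (assoc_class (local_equation (C a) P)) (assoc_class (C c))"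
    unfolding branch_of_def by (intro bexI[OF _ assoc_class_self]) simp
next
  assume "branch_of P (assoc_class (local_equation (C a) P)) (assoc_class (C c))"
  then obtain g G where g: "local_equation (C a) P dvd g" "G dvd C c" "g dvd local_equation G P"
    unfolding branch_of_def assoc_class_def by auto
  have "local_equation G P dvd local_equation (C c) P" by (rule hom_dvd[OF local_equation_hom g(2)])
  then have dvd: "local_equation (C a) P dvd local_equation (C c) P" using dvd_trans[OF dvd_trans[OF g(1,3)]] by simp
  obtain x y where xy: "P \<in> proj_plane" "inc P = {x, y}" "x \<noteq> y" "y \<noteq> 0" by (rule singular_inc_pair[OF P])
  note loc = local_structure[OF xy]
  have aT: "a \<in> T" using a inc_subset by blast
  have "c \<in> inc P"
  proof (rule ccontr)
    assume "c \<notin> inc P"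
    then have "local_equation (C c) P dvd 1" using loc(4)[OF c] by simp
    then have "local_equation (C a) P dvd 1" by (rule dvd_trans[OF dvd])
    then show False using loc(4)[OF aT] a by simp
  qed
  then show "a = c" by (rule loc(1)[OF a _ dvd])
qed

lemma branches_bij:
  assumes "P \<in> singular_points F"
  shows "bij_betw (\<lambda>c. assoc_class (local_equation (C c) P)) (inc P) (branches F P)"
proof -
  obtain x y where xy: "P \<in> proj_plane" "inc P = {x, y}" "x \<noteq> y" "y \<noteq> 0" by (rule singular_inc_pair[OF assms])
  show ?thesis by (rule local_structure(2)[OF xy])
qed

lemma singular_germ:
  assumes "P \<in> singular_points F"
  shows "germ_equiv (affine_zeros F P) (if 0 \<in> inc P then tacnode else node)"
proof -
  obtain x y where xy: "P \<in> proj_plane" "inc P = {x, y}" "x \<noteq> y" "y \<noteq> 0" by (rule singular_inc_pair[OF assms])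
  then have "0 \<in> inc P \<longleftrightarrow> x = 0" by auto
  then show ?thesis using local_structure(3)[OF xy] by simp
qed

end

text \<open>A bijection of the lines, extended by fixing the quartic, maps incidence sets of one curve to incidence sets of the other.
Corresponding incidence sets belong to the same number of singular points, so the singular points can be
matched; components and branches are then matched through their indices.\<close>

lemma same_combinatorics_of_arrangements:
  assumes AI: "bitangent_arrangement Q L I" and AJ: "bitangent_arrangement Q L J" and card: "card I = card J"
  shows "same_combinatorics (Q * (\<Prod>i\<in>I. L i)) (Q * (\<Prod>i\<in>J. L i))"
proof -
  interpret I: bitangent_arrangement Q L I by (rule AI)
  interpret J: bitangent_arrangement Q L J by (rule AJ)
  obtain \<pi>0 where \<pi>0: "bij_betw \<pi>0 I J" using finite_same_card_bij[OF I.finite_I J.finite_I card] by blast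
  define \<pi> where "\<pi> = \<pi>0(0 := 0)"
  have "bij_betw \<pi> I J"
    using \<pi>0 I.zero_notin by (subst bij_betw_cong[of _ _ \<pi>0]) (auto simp: \<pi>_def)
  then have \<pi>: "bij_betw \<pi> I.T J.T"
    using notIn_Un_bij_betw[of 0 I \<pi> J] I.zero_notin J.zero_notin by (simp add: \<pi>_def)
  have \<pi>_zero: "\<pi> a = 0 \<longleftrightarrow> a = 0" if "a \<in> I.T" for a
  proof (cases "a = 0")
    case False
    then have "\<pi> a \<in> J" using bij_betwE[OF \<pi>0] that by (simp add: \<pi>_def)
    then show ?thesis using False J.zero_notin by metis
  qed (simp add: \<pi>_def)
  have \<pi>_inj: "inj_on \<pi> I.T" and \<pi>_img: "\<pi> ` I.T = J.T" using \<pi> by (auto simp: bij_betw_def)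
  define pairs where "pairs = {{a, b} | a b. a \<in> I.T \<and> b \<in> I.T \<and> a \<noteq> b}"
  obtain \<sigma> where \<sigma>: "bij_betw \<sigma> (singular_points I.F) (singular_points J.F)"
    and inc: "\<And>P. P \<in> singular_points I.F \<Longrightarrow> J.inc (\<sigma> P) = \<pi> ` I.inc P"
  proof (rule matching_fibres[where f = I.inc and g = J.inc and \<tau> = "\<lambda>S. \<pi> ` S" and T = pairs])
    fix t assume "t \<in> pairs"
    then obtain a b where ab: "t = {a, b}" "a \<in> I.T" "b \<in> I.T" "a \<noteq> b" by (auto simp: pairs_def)
    have t': "\<pi> ` t = {\<pi> a, \<pi> b}" and ab': "\<pi> a \<in> J.T" "\<pi> b \<in> J.T" "\<pi> a \<noteq> \<pi> b"
      using ab \<pi>_img inj_onD[OF \<pi>_inj, of a b] by auto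
    show "finite {P \<in> singular_points I.F. I.inc P = t} \<and> finite {P \<in> singular_points J.F. J.inc P = \<pi> ` t}"
      using I.fibre(1)[OF ab(2-4)] J.fibre(1)[OF ab'] ab(1) t' by simp
    have "0 \<in> {a, b} \<longleftrightarrow> 0 \<in> {\<pi> a, \<pi> b}" using \<pi>_zero[OF ab(2)] \<pi>_zero[OF ab(3)] by auto
    then show "card {P \<in> singular_points I.F. I.inc P = t} = card {P \<in> singular_points J.F. J.inc P = \<pi> ` t}"
      using I.fibre(2)[OF ab(2-4)] J.fibre(2)[OF ab'] unfolding ab(1) t'[unfolded ab(1)] by simp
  next
    have "pairs \<subseteq> Pow I.T" by (auto simp: pairs_def)
    then show "inj_on ((`) \<pi>) pairs" using inj_on_image_Pow[OF \<pi>_inj] inj_on_subset by blast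
  next
    fix P assume "P \<in> singular_points I.F"
    then obtain a b where "I.inc P = {a, b}" "a \<noteq> b" using I.singular_iff by blast
    then show "I.inc P \<in> pairs" using I.inc_subset[of P] by (auto simp: pairs_def)
  next
    fix P assume "P \<in> singular_points J.F"
    then obtain a' b' where ab: "J.inc P = {a', b'}" "a' \<noteq> b'" using J.singular_iff by blast
    then have "a' \<in> \<pi> ` I.T" "b' \<in> \<pi> ` I.T" using J.inc_subset[of P] \<pi>_img by auto
    then obtain a b where "a \<in> I.T" "b \<in> I.T" "a' = \<pi> a" "b' = \<pi> b" by blast
    then have "{a, b} \<in> pairs" "J.inc P = \<pi> ` {a, b}" using ab by (auto simp: pairs_def)
    then show "J.inc P \<in> (`) \<pi> ` pairs" by blast
  qed blast
  define k where "k a = assoc_class (I.C a)" for a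
  define \<phi> where "\<phi> K = k (\<pi> (the_inv_into I.T k K))" for K
  have kI: "bij_betw k I.T (components I.F)" and kJ: "bij_betw k J.T (components J.F)"
    using I.components_bij J.components_bij by (simp_all add: k_def[abs_def])
  have \<phi>k: "\<phi> (k a) = k (\<pi> a)" if "a \<in> I.T" for a
    using that kI by (simp add: \<phi>_def the_inv_into_f_f bij_betw_def)
  have "bij_betw (k \<circ> (\<pi> \<circ> the_inv_into I.T k)) (components I.F) (components J.F)"
    by (intro bij_betw_trans[OF bij_betw_trans[OF bij_betw_the_inv_into[OF kI] \<pi>] kJ])
  then have \<phi>: "bij_betw \<phi> (components I.F) (components J.F)" by (simp add: \<phi>_def[abs_def] o_def)
  have comp: "\<exists>a\<in>I.T. K = k a" if "K \<in> components I.F" for K using that kI by (auto simp: bij_betw_def)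
  have deg: "total_degree G = total_degree G'" if K: "K \<in> components I.F" "G \<in> K" "G' \<in> \<phi> K" for K G G'
  proof -
    obtain a where a: "a \<in> I.T" "K = k a" using comp[OF K(1)] by blast
    have "\<pi> a \<in> J.T" using imageI[OF a(1), of \<pi>] unfolding \<pi>_img .
    then have "total_degree G' = (if \<pi> a = 0 then 4 else 1)" using K(3) \<phi>k[OF a(1)] a(2) J.component_degree by (simp add: k_def)
    moreover have "total_degree G = (if a = 0 then 4 else 1)" using K(2) a I.component_degree by (simp add: k_def)
    ultimately show ?thesis using \<pi>_zero[OF a(1)] by simp
  qed
  define br where "br P a = assoc_class (local_equation (I.C a) P)" for P a
  define \<beta> where "\<beta> P b = br (\<sigma> P) (\<pi> (the_inv_into (I.inc P) (br P) b))" for P b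
  have main: "same_topological_type I.F P J.F (\<sigma> P) \<and>
       bij_betw (\<beta> P) (branches I.F P) (branches J.F (\<sigma> P)) \<and>
       (\<forall>b\<in>branches I.F P. \<forall>K\<in>components I.F. branch_of P b K \<longleftrightarrow> branch_of (\<sigma> P) (\<beta> P b) (\<phi> K))"
    if P: "P \<in> singular_points I.F" for P
  proof -
    have P': "\<sigma> P \<in> singular_points J.F" using \<sigma> P by (auto dest: bij_betwE)
    have "0 \<in> I.inc P \<longleftrightarrow> 0 \<in> J.inc (\<sigma> P)"
    proof
      assume "0 \<in> I.inc P"
      then show "0 \<in> J.inc (\<sigma> P)" unfolding inc[OF P] by (intro image_eqI[of _ _ 0]) (simp_all add: \<pi>_def)
    next
      assume "0 \<in> J.inc (\<sigma> P)"
      then obtain a where a: "a \<in> I.inc P" "\<pi> a = 0" unfolding inc[OF P] by auto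
      then have "a = 0" using \<pi>_zero I.inc_subset[of P] by blast
      then show "0 \<in> I.inc P" using a by simp
    qed
    then have "germ_equiv (affine_zeros I.F P) (affine_zeros J.F (\<sigma> P))"
      using germ_equiv_trans[OF I.singular_germ[OF P] germ_equiv_sym] J.singular_germ[OF P'] by auto
    then have top: "same_topological_type I.F P J.F (\<sigma> P)" by (simp add: same_topological_type_iff_germ_equiv)
    have bI: "bij_betw (br P) (I.inc P) (branches I.F P)" and bJ: "bij_betw (br (\<sigma> P)) (J.inc (\<sigma> P)) (branches J.F (\<sigma> P))"
      using I.branches_bij[OF P] J.branches_bij[OF P'] by (simp_all add: br_def[abs_def])
    have \<pi>P: "bij_betw \<pi> (I.inc P) (J.inc (\<sigma> P))"
      unfolding inc[OF P] using inj_on_subset[OF \<pi>_inj I.inc_subset[of P]] by (simp add: bij_betw_def)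
    have "bij_betw (br (\<sigma> P) \<circ> (\<pi> \<circ> the_inv_into (I.inc P) (br P))) (branches I.F P) (branches J.F (\<sigma> P))"
      by (intro bij_betw_trans[OF bij_betw_trans[OF bij_betw_the_inv_into[OF bI] \<pi>P] bJ])
    then have \<beta>: "bij_betw (\<beta> P) (branches I.F P) (branches J.F (\<sigma> P))" by (simp add: \<beta>_def[abs_def] o_def)
    have "branch_of P b K \<longleftrightarrow> branch_of (\<sigma> P) (\<beta> P b) (\<phi> K)" if b: "b \<in> branches I.F P" and K: "K \<in> components I.F" for b K
    proof -
      obtain c where c: "c \<in> I.T" "K = k c" using comp[OF K] by blast
      obtain a where a: "a \<in> I.inc P" "b = br P a" using b bI by (auto simp: bij_betw_def)
      have \<beta>b: "\<beta> P b = br (\<sigma> P) (\<pi> a)" using a bI by (simp add: \<beta>_def the_inv_into_f_f bij_betw_def)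
      have aT: "a \<in> I.T" using a I.inc_subset by blast
      have "\<pi> a \<in> J.inc (\<sigma> P)" "\<pi> c \<in> J.T" using a c inc[OF P] \<pi>_img by auto
      then have "branch_of (\<sigma> P) (\<beta> P b) (\<phi> K) \<longleftrightarrow> \<pi> a = \<pi> c"
        unfolding \<beta>b c(2) \<phi>k[OF c(1)] unfolding br_def k_def by (rule J.branch_of_iff[OF P'])
      moreover have "branch_of P b K \<longleftrightarrow> a = c"
        unfolding a(2) c(2) br_def k_def by (rule I.branch_of_iff[OF P a(1) c(1)])
      ultimately show ?thesis using inj_onD[OF \<pi>_inj, of a c] aT c(1) by blast
    qed
    then show ?thesis using top \<beta> by blast
  qed
  show ?thesis unfolding same_combinatorics_def
    by (intro exI[of _ \<phi>] exI[of _ \<sigma>] exI[of _ \<beta>] conjI[OF \<phi>] conjI[OF _ conjI[OF \<sigma>]] ballI deg main)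
qed

lemma general_quartic_bitangents:
  assumes Q: "general_quartic Q" and L: "enumerates_bitangents Q L" and I: "I \<subseteq> {1..28}"
  shows "bitangent_arrangement Q L I"
proof
  show "general_quartic Q" by (rule Q)
  show "finite I" using I finite_subset by blast
  show "0 \<notin> I" using I by auto
  show bit: "bitangent Q (L i)" if "i \<in> I" for i using L I that by (auto simp: enumerates_bitangents_def)
  fix i j assume ij: "i \<in> I" "j \<in> I" "i \<noteq> j"
  show "\<not> vanishes_on (L i) (L j)"
  proof
    assume v: "vanishes_on (L i) (L j)"
    note l = bit[OF ij(1), THEN bitangent_forms] bit[OF ij(2), THEN bitangent_forms]
    have "L i dvd L j" using vanishes_on_iff_dvd[OF l(1) forms_1_form_in[OF l(2)]] v by simp
    moreover have "L j dvd L i"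
      using vanishes_on_iff_dvd[OF l(2) forms_1_form_in[OF l(1)]] vanishes_on_sym[OF l v] by simp
    ultimately have "assoc_class (L i) = assoc_class (L j)" by (simp add: assoc_class_eq_iff)
    moreover have "inj_on (\<lambda>i. assoc_class (L i)) {1..28}" using L by (simp add: enumerates_bitangents_def bij_betw_def)
    ultimately show False using ij I by (auto dest: inj_onD)
  qed
qed

lemma true_bitangents_of_general_quartic:
  assumes Q: "general_quartic Q" and l: "bitangent Q l"
  shows "true_bitangent Q l"
proof -
  have Q4: "form_in UNIV 4 Q" using Q smooth_quartic_form by (simp add: general_quartic_def)
  have nf: "\<exists>i j k. Q \<in> hyperflex_quartics i j k \<Longrightarrow> False" using Q by (auto simp: general_quartic_def)
  obtain P P' where P: "P \<noteq> P'" "{R. on_curve R Q \<and> on_curve R l} = {P, P'}"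
    "intersection_number Q l P = 2" "intersection_number Q l P' = 2"
    by (rule true_bitangent_contacts[OF Q4 l nf])
  then have "tangent_at Q l P" "tangent_at Q l P'" by (auto simp: tangent_at_def)
  then show ?thesis using l P(1) by (auto simp: true_bitangent_def)
qed

theorem proposition1p2:
  "\<exists>U. zariski_open_smooth_quartics U \<and> U \<noteq> {} \<and>
     (\<forall>Q\<in>U. \<forall>L. enumerates_bitangents Q L \<longrightarrow>
        (\<forall>r\<in>{1..28::nat}.
           (\<forall>I J. I \<subseteq> {1..28} \<and> card I = r \<and> J \<subseteq> {1..28} \<and> card J = r \<longrightarrow>
              same_combinatorics (Q * (\<Prod>i\<in>I. L i)) (Q * (\<Prod>i\<in>J. L i))) \<and>
           (\<forall>I. I \<subseteq> {1..28} \<and> card I = r \<longrightarrow>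
              (\<forall>k\<in>I. true_bitangent Q (L k)) \<and>
              (\<forall>i\<in>I. \<forall>j\<in>I. \<forall>k\<in>I. i \<noteq> j \<and> i \<noteq> k \<and> j \<noteq> k \<longrightarrow>
                 \<not> concurrent (L i) (L j) (L k)))))"
proof -
  obtain U where U: "zariski_open_smooth_quartics U" "U \<noteq> {}" "\<forall>Q\<in>U. general_quartic Q"
    using general_quartics_exist by blast
  have main: "(\<forall>I J. I \<subseteq> {1..28} \<and> card I = r \<and> J \<subseteq> {1..28} \<and> card J = r \<longrightarrow>
            same_combinatorics (Q * (\<Prod>i\<in>I. L i)) (Q * (\<Prod>i\<in>J. L i))) \<and>
         (\<forall>I. I \<subseteq> {1..28} \<and> card I = r \<longrightarrow>
            (\<forall>k\<in>I. true_bitangent Q (L k)) \<and>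
            (\<forall>i\<in>I. \<forall>j\<in>I. \<forall>k\<in>I. i \<noteq> j \<and> i \<noteq> k \<and> j \<noteq> k \<longrightarrow> \<not> concurrent (L i) (L j) (L k)))"
    if "Q \<in> U" and L: "enumerates_bitangents Q L" for Q L r
  proof (intro conjI allI impI ballI)
    have Q: "general_quartic Q" using U(3) that by blast
    note arr = general_quartic_bitangents[OF Q L]
    fix I J :: "nat set" assume "I \<subseteq> {1..28} \<and> card I = r \<and> J \<subseteq> {1..28} \<and> card J = r"
    then show "same_combinatorics (Q * (\<Prod>i\<in>I. L i)) (Q * (\<Prod>i\<in>J. L i))"
      by (intro same_combinatorics_of_arrangements arr) auto
  next
    have Q: "general_quartic Q" using U(3) that by blast
    fix I and k :: nat assume "I \<subseteq> {1..28} \<and> card I = r" "k \<in> I"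
    then show "true_bitangent Q (L k)"
      using L by (intro true_bitangents_of_general_quartic[OF Q]) (auto simp: enumerates_bitangents_def)
  next
    have Q: "general_quartic Q" using U(3) that by blast
    fix I and i j k :: nat assume I: "I \<subseteq> {1..28} \<and> card I = r" and ijk: "i \<in> I" "j \<in> I" "k \<in> I" "i \<noteq> j \<and> i \<noteq> k \<and> j \<noteq> k"
    interpret bitangent_arrangement Q L I using general_quartic_bitangents[OF Q L] I by blast
    show "\<not> concurrent (L i) (L j) (L k)"
      using no_concurrent concurrent_bitangents_in_family[OF Q_smooth bitangents bitangents bitangents, of i j k]
        distinct ijk by blast
  qed
  show ?thesis
    by (intro exI[of _ U] conjI[OF U(1) conjI[OF U(2)]] ballI allI impI main)
qed

end
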